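(* Let $0<T<\infty$, $1<p<\infty$, $\frac1p+\frac1{p'}=1$. Let $V$ be a real separable reflexive Banach space and $H$ a real Hilbert space such that $(V,H,V^\ast)$ is a Gelfand triple. (Spaces) Assume there exists a reflexive, separable Banach space $Z$ with a dense continuous embedding $Z\hookrightarrow V$; an increasing sequence $(V_n)_{n\in\mathbb N}$ of finite-dimensional subspaces $V_n\subseteq Z$ such that $\bigcup_{n\in\mathbb N}V_n$ is dense in $V$; and self-adjoint projections $P_n\colon H\to H$ such that $P_n(V)=V_n$ and $\|P_n|_Z\|_{\mathcal L(Z,Z)}\le c$ with a constant $c$ independent of $n\in\mathbb N$. (Operators) Let $\{A(t)\mid 0\le t\le T\}$ be a family of operators $A(t)\colon V\to V^\ast$ such that: (A1) $A(t)\colon V\to V^\ast$ is pseudo-monotone for almost every $t\in[0,T]$. (A2) For every $u\in L^p(0,T;V)\cap L^\infty(0,T;H)$ the mapping $t\mapsto A(t)u(t)$ from $[0,T]$ to $V^\ast$ is Bochner measurable. (A3) There exist a constant $c_1>0$ and a non-negative function $C_2\in L^1((0,T))$ such that $\langle A(t)x,x\rangle_V\ge c_1\|x\|_V^p-C_2(t)$ for almost every $t\in[0,T]$ and all $x\in V$. (A4) There exist $0\le q<\infty$, constants $c_3>0$, $c_4\ge0$ and a non-negative function $C_5\in L^{p'}((0,T))$ such that $\|A(t)x\|_{V^\ast}\le c_3\|x\|_V^{p-1}+c_4\|x\|_H^q\|x\|_V^{p-1}+C_5(t)$ for almost every $t\in[0,T]$ and all $x\in V$. Put $\mathcal V:=L^p(0,T;V)$,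 $\mathcal W:=W^{1,p,p'}(0,T;V,Z^\ast)$, and let $\mathcal A\colon L^p(0,T;V)\cap L^\infty(0,T;H)\to L^{p'}(0,T;V^\ast)=\mathcal V^\ast$ be the induced operator $(\mathcal Au)(t):=A(t)u(t)$. Let $(v_n)_{n\ge1}$ be a sequence in $\mathcal W\cap L^\infty(0,T;H)$ and let $v_0\in\mathcal W$ be such that $v_n\rightharpoonup v_0$ weakly in $\mathcal W$, $\|v_n\|_{L^\infty(0,T;H)}\le K$ for all $n$ with a constant $K$, and $$\limsup_{n\to\infty}\langle\mathcal Av_n,v_n-v_0\rangle_{\mathcal V}\le0.$$ Then for every $z\in\mathcal V$ $$\langle\mathcal Av_0,v_0-z\rangle_{\mathcal V}\le\liminf_{n\to\infty}\langle\mathcal Av_n,v_n-z\rangle_{\mathcal V}.$$ Moreover, $\mathcal Av_n\rightharpoonup\mathcal Av_0$ weakly in $\mathcal V^\ast=L^{p'}(0,T;V^\ast)$.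
   Context: All Banach spaces are real, and embeddings are continuous. $X^\ast$ is the dual of $X$ and $\langle\cdot,\cdot\rangle_X$ the duality pairing; for $g\in L^{p'}(0,T;V^\ast)$ and $u\in\mathcal V$, $\langle g,u\rangle_{\mathcal V}=\int_0^T\langle g(t),u(t)\rangle_V\,dt$. $(V,H,V^\ast)$ is a Gelfand triple if $V$ is continuously and densely embedded in $H$; identifying $H\cong H^\ast$ by Riesz gives dense embeddings $V\hookrightarrow H\cong H^\ast\hookrightarrow V^\ast$. Together with $Z\hookrightarrow V$ dense this yields $V\hookrightarrow H\hookrightarrow V^\ast\hookrightarrow Z^\ast$. An operator $A\colon V\to V^\ast$ is pseudo-monotone if whenever $x_n\rightharpoonup x$ weakly in $V$ and $\limsup_{n\to\infty}\langle Ax_n,x_n-x\rangle_V\le0$, then $\langle Ax,x-y\rangle_V\le\liminf_{n\to\infty}\langle Ax_n,x_n-y\rangle_V$ for all $y\in V$. For a Banach space $W$ with dense embedding $V\hookrightarrow W$, a function $u\in L^p(0,T;V)$ has generalized derivative $\frac{du}{dt}=g\in L^q(0,T;W)$ if $\int_0^T\varphi'(t)u(t)\,dt=-\int_0^T\varphi(t)g(t)\,dt$ for all $\varphi\in C_0^\infty((0,T))$. Set $$W^{1,p,q}(0,T;V,W):=\{u\in L^p(0,T;V)\mid\tfrac{du}{dt}\in L^q(0,T;W)\}$$ with norm $\|u\|_{L^p(0,T;V)}+\|\tfrac{du}{dt}\|_{L^q(0,T;W)}$. *)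

theory Defs
  imports "HOL-Analysis.Analysis"
begin

text \<open>
  Conventions. The dual of a real Banach space \<open>'a\<close> is the type \<open>'a \<Rightarrow>\<^sub>L real\<close> with the operator norm.
  Separability is the class \<open>second_countable_topology\<close>. The continuous embeddings between different
  spaces are explicit injective bounded linear maps. Elements of Lebesgue spaces are represented by
  functions on \<^term>\<open>lebesgue_on {0..T}\<close>, not by equivalence classes; all notions below are invariant
  under changes on null sets.
\<close>

subsection \<open>Banach spaces\<close>

definition reflexive :: "'a::banach itself \<Rightarrow> bool" where
  "reflexive _ \<longleftrightarrow>
     (\<forall>\<Phi> :: ('a \<Rightarrow>\<^sub>L real) \<Rightarrow>\<^sub>L real. \<exists>x::'a. \<forall>\<xi>. blinfun_apply \<Phi> \<xi> = blinfun_apply \<xi> x)"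

definition dense_embedding :: "('a::real_normed_vector \<Rightarrow>\<^sub>L 'b::real_normed_vector) \<Rightarrow> bool" where
  "dense_embedding i \<longleftrightarrow> inj (blinfun_apply i) \<and> closure (range (blinfun_apply i)) = UNIV"

text \<open>
  For a Gelfand triple with embedding \<open>i\<close> of \<open>V\<close> into \<open>H\<close> and an embedding \<open>j\<close> of \<open>Z\<close> into \<open>V\<close>, the
  embedding of \<open>V\<close> into the dual of \<open>Z\<close> through the Riesz identification of \<open>H\<close> with its dual:
  \<open>v\<close> is sent to the functional \<open>z \<mapsto> i v \<bullet> i (j z)\<close>.
\<close>
definition dual_embedding ::
  "('v::real_normed_vector \<Rightarrow>\<^sub>L 'h::real_inner) \<Rightarrow> ('z::real_normed_vector \<Rightarrow>\<^sub>L 'v) \<Rightarrow> 'v \<Rightarrow> 'z \<Rightarrow>\<^sub>L real" where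
  "dual_embedding i j v = blinfun_inner_right (blinfun_apply i v) o\<^sub>L (i o\<^sub>L j)"

definition self_adjoint_projection :: "('h::real_inner \<Rightarrow>\<^sub>L 'h) \<Rightarrow> bool" where
  "self_adjoint_projection P \<longleftrightarrow>
     P o\<^sub>L P = P \<and> (\<forall>x y. blinfun_apply P x \<bullet> y = x \<bullet> blinfun_apply P y)"

definition finite_dim_subspace :: "'a::real_vector set \<Rightarrow> bool" where
  "finite_dim_subspace S \<longleftrightarrow> (\<exists>B. finite B \<and> S = span B)"

definition weakly_converges :: "(nat \<Rightarrow> 'a::real_normed_vector) \<Rightarrow> 'a \<Rightarrow> bool" where
  "weakly_converges x x0 \<longleftrightarrow>
     (\<forall>\<xi> :: 'a \<Rightarrow>\<^sub>L real. (\<lambda>n. blinfun_apply \<xi> (x n)) \<longlonglongrightarrow> blinfun_apply \<xi> x0)"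

definition pseudo_monotone :: "('v::real_normed_vector \<Rightarrow> 'v \<Rightarrow>\<^sub>L real) \<Rightarrow> bool" where
  "pseudo_monotone A \<longleftrightarrow>
     (\<forall>x x0. weakly_converges x x0 \<longrightarrow>
        limsup (\<lambda>n. ereal (blinfun_apply (A (x n)) (x n - x0))) \<le> 0 \<longrightarrow>
        (\<forall>y. ereal (blinfun_apply (A x0) (x0 - y))
               \<le> liminf (\<lambda>n. ereal (blinfun_apply (A (x n)) (x n - y)))))"

subsection \<open>Bochner measurability and the Bochner integral\<close>

text \<open>
  The library's Bochner integral requires a second countable target type, and the dual types
  \<open>'a \<Rightarrow>\<^sub>L real\<close> are not an instance of that class. The usual definitions through simple functions are
  therefore restated without it.
\<close>

definition bochner_measurable :: "'a measure \<Rightarrow> ('a \<Rightarrow> 'b::real_normed_vector) \<Rightarrow> bool" where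
  "bochner_measurable M f \<longleftrightarrow>
     (\<exists>s. (\<forall>k::nat. simple_function M (s k)) \<and> (AE x in M. (\<lambda>k. s k x) \<longlonglongrightarrow> f x))"

definition has_bochner_int ::
  "'a measure \<Rightarrow> ('a \<Rightarrow> 'b::real_normed_vector) \<Rightarrow> 'b \<Rightarrow> bool" where
  "has_bochner_int M f I \<longleftrightarrow>
     bochner_measurable M f \<and>
     (\<exists>s. (\<forall>k::nat. Bochner_Integration.simple_bochner_integrable M (s k)) \<and>
          (\<lambda>k. \<integral>\<^sup>+x. ennreal (norm (f x - s k x)) \<partial>M) \<longlonglongrightarrow> 0 \<and>
          (\<lambda>k. Bochner_Integration.simple_bochner_integral M (s k)) \<longlonglongrightarrow> I)"

subsection \<open>Lebesgue spaces on \<open>(0,T)\<close>\<close>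

definition Lp :: "real \<Rightarrow> real \<Rightarrow> (real \<Rightarrow> 'b::real_normed_vector) set" where
  "Lp T p = {f. bochner_measurable (lebesgue_on {0..T}) f \<and>
                integrable (lebesgue_on {0..T}) (\<lambda>t. norm (f t) powr p)}"

definition Lp_norm :: "real \<Rightarrow> real \<Rightarrow> (real \<Rightarrow> 'b::real_normed_vector) \<Rightarrow> real" where
  "Lp_norm T p f = (LINT t|lebesgue_on {0..T}. norm (f t) powr p) powr (1 / p)"

definition Linf :: "real \<Rightarrow> (real \<Rightarrow> 'b::real_normed_vector) set" where
  "Linf T = {f. bochner_measurable (lebesgue_on {0..T}) f \<and>
                (\<exists>C. AE t in lebesgue_on {0..T}. norm (f t) \<le> C)}"

definition Linf_norm :: "real \<Rightarrow> (real \<Rightarrow> 'b::real_normed_vector) \<Rightarrow> real" where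
  "Linf_norm T f = Inf {C. 0 \<le> C \<and> (AE t in lebesgue_on {0..T}. norm (f t) \<le> C)}"

definition pairing :: "real \<Rightarrow> (real \<Rightarrow> 'v::real_normed_vector \<Rightarrow>\<^sub>L real) \<Rightarrow> (real \<Rightarrow> 'v) \<Rightarrow> real" where
  "pairing T g u = (LINT t|lebesgue_on {0..T}. blinfun_apply (g t) (u t))"

definition induced_operator ::
  "(real \<Rightarrow> 'v \<Rightarrow> 'v::real_normed_vector \<Rightarrow>\<^sub>L real) \<Rightarrow> (real \<Rightarrow> 'v) \<Rightarrow> real \<Rightarrow> 'v \<Rightarrow>\<^sub>L real" where
  "induced_operator A u = (\<lambda>t. A t (u t))"

subsection \<open>Generalized derivatives\<close>

definition test_function :: "real \<Rightarrow> (real \<Rightarrow> real) \<Rightarrow> bool" where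
  "test_function T \<phi> \<longleftrightarrow>
     (\<forall>k t. ((deriv ^^ k) \<phi>) field_differentiable (at t)) \<and>
     (\<exists>K. compact K \<and> K \<subseteq> {0<..<T} \<and> (\<forall>t. t \<notin> K \<longrightarrow> \<phi> t = 0))"

text \<open>
  \<open>e\<close> is the embedding of the values of \<open>u\<close> into the space \<open>'w\<close>, where the integral identity holds.
\<close>
definition has_gen_deriv ::
  "('v::real_normed_vector \<Rightarrow> 'w::real_normed_vector) \<Rightarrow> real \<Rightarrow> (real \<Rightarrow> 'v) \<Rightarrow> (real \<Rightarrow> 'w) \<Rightarrow> bool" where
  "has_gen_deriv e T u g \<longleftrightarrow>
     (\<forall>\<phi>. test_function T \<phi> \<longrightarrow>
        (\<exists>I J. has_bochner_int (lebesgue_on {0..T}) (\<lambda>t. deriv \<phi> t *\<^sub>R u t) I \<and>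
               has_bochner_int (lebesgue_on {0..T}) (\<lambda>t. \<phi> t *\<^sub>R g t) J \<and>
               e I = - J))"

definition W1 ::
  "('v::real_normed_vector \<Rightarrow> 'w::real_normed_vector) \<Rightarrow> real \<Rightarrow> real \<Rightarrow> real \<Rightarrow> (real \<Rightarrow> 'v) set" where
  "W1 e T p q = {u \<in> Lp T p. \<exists>g \<in> Lp T q. has_gen_deriv e T u g}"

text \<open>The generalized derivative is unique up to null sets; a representative is chosen.\<close>
definition gen_deriv ::
  "('v::real_normed_vector \<Rightarrow> 'w::real_normed_vector) \<Rightarrow> real \<Rightarrow> real \<Rightarrow> (real \<Rightarrow> 'v) \<Rightarrow> real \<Rightarrow> 'w" where
  "gen_deriv e T q u = (SOME g. g \<in> Lp T q \<and> has_gen_deriv e T u g)"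

definition W1_norm ::
  "('v::real_normed_vector \<Rightarrow> 'w::real_normed_vector) \<Rightarrow> real \<Rightarrow> real \<Rightarrow> real \<Rightarrow> (real \<Rightarrow> 'v) \<Rightarrow> real" where
  "W1_norm e T p q u = Lp_norm T p u + Lp_norm T q (gen_deriv e T q u)"

subsection \<open>Weak convergence in spaces of functions\<close>

text \<open>
  \<open>S\<close> is a space of functions with (semi)norm \<open>N\<close>. Boundedness with respect to \<open>N\<close> makes a linear
  functional independent of the representative, so these are the elements of the dual of the
  quotient by null functions.
\<close>
definition bounded_functional_on ::
  "(real \<Rightarrow> 'b::real_normed_vector) set \<Rightarrow> ((real \<Rightarrow> 'b) \<Rightarrow> real) \<Rightarrow> ((real \<Rightarrow> 'b) \<Rightarrow> real) \<Rightarrow> bool" where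
  "bounded_functional_on S N F \<longleftrightarrow>
     (\<forall>f\<in>S. \<forall>g\<in>S. F (\<lambda>t. f t + g t) = F f + F g) \<and>
     (\<forall>a. \<forall>f\<in>S. F (\<lambda>t. a *\<^sub>R f t) = a * F f) \<and>
     (\<exists>C. \<forall>f\<in>S. \<bar>F f\<bar> \<le> C * N f)"

definition weakly_converges_in ::
  "(real \<Rightarrow> 'b::real_normed_vector) set \<Rightarrow> ((real \<Rightarrow> 'b) \<Rightarrow> real)
     \<Rightarrow> (nat \<Rightarrow> real \<Rightarrow> 'b) \<Rightarrow> (real \<Rightarrow> 'b) \<Rightarrow> bool" where
  "weakly_converges_in S N f f0 \<longleftrightarrow>
     (\<forall>n. f n \<in> S) \<and> f0 \<in> S \<and>
     (\<forall>F. bounded_functional_on S N F \<longrightarrow> (\<lambda>n. F (f n)) \<longlonglongrightarrow> F f0)"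

end

theory Submission
  imports Defs "HOL-Computational_Algebra.Polynomial"
begin

text \<open>
  Put \<open>h\<^sub>n(t) = \<langle>A(t)v\<^sub>n(t), v\<^sub>n(t) - v\<^sub>0(t)\<rangle>\<close>. Testing with \<open>z \<in> Z\<close>, evaluation at a time \<open>s\<close> is a bounded
  functional on the space \<open>W\<close>, so \<open>v\<^sub>n(t)\<close> converges to \<open>v\<^sub>0(t)\<close> almost everywhere when tested against
  the functionals \<open>i \<cdot> \<bullet> i (j z)\<close>, which are dense in \<open>V\<^sup>*\<close> by reflexivity. Coercivity and growth give
  \<open>h\<^sub>n \<ge> c \<parallel>v\<^sub>n\<parallel>\<^sup>p - \<kappa>\<close> with an integrable \<open>\<kappa>\<close>. Hence a subsequence along which \<open>h\<^sub>n(t)\<close> stays bounded above is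
  bounded in \<open>V\<close> and converges weakly to \<open>v\<^sub>0(t)\<close>, and pseudo-monotonicity of \<open>A(t)\<close> forces
  \<open>h\<^sub>n\<^sup>- \<longrightarrow> 0\<close> almost everywhere. Together with the limsup condition this gives \<open>h\<^sub>n \<longrightarrow> 0\<close> in \<open>L\<^sup>1\<close>, so almost
  everywhere along a subsequence; pseudo-monotonicity once more and Fatou's lemma yield the inequality.
  It implies convergence of \<open>\<A>v\<^sub>n\<close> against every \<open>x \<in> L\<^sup>p(0,T;V)\<close>, and these are all functionals on
  \<open>L\<^sup>p\<^sup>'(0,T;V\<^sup>*)\<close> because \<open>V\<close> is reflexive and separable.
\<close>

section \<open>Hahn--Banach extension\<close>

text \<open>Pseudo-monotonicity of \<open>A t\<close> can only be applied at a fixed time to a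
  sequence that converges weakly in \<open>V\<close>, whereas the \<open>V\<close>-norms of
  \<open>v n\<close> are controlled only through integrals over time: for fixed \<open>t\<close> the
  sequence \<open>v n t\<close> may be unbounded. Bounds are therefore extracted along subsequences,
  and these may depend on \<open>t\<close>. For the negative part of h this is harmless, since each
  \<open>t\<close> is treated alone by contradiction. Fatou's lemma needs one subsequence for almost
  all \<open>t\<close>, and this is what the convergence in mean supplies. The bound
  \<open>K\<close> has two tasks: it turns the factor with exponent \<open>q\<close> in the growth
  condition into a constant, and, inherited by \<open>v0\<close>, it puts the image of
  \<open>v0\<close> into the dual space. Half of the coercivity constant absorbs the pairing with
  the test element, the other half retains the \<open>V\<close>-norm. Evaluation at a time is
  meaningless for classes modulo null sets; an integral formula defines it for every time as a
  bounded functional that agrees with the value almost everywhere.\<close>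

text \<open>Extending to \<open>x0\<close> by a value \<open>a\<close> is possible exactly if
  \<open>a\<close> lies between the numbers \<open>s - M * norm (y - x0)\<close> and the numbers
  \<open>M * norm (x + x0) - r\<close>. The triangle inequality separates the two families, so the
  supremum of the lower one serves; other multiples \<open>t\<close> follow by scaling.\<close>

lemma hahn_banach_extension_step:
  fixes G :: "('a::real_normed_vector \<times> real) set"
  assumes G: "subspace G" and le: "\<And>x r. (x, r) \<in> G \<Longrightarrow> r \<le> M * norm x" and M: "0 \<le> M"
  obtains a where "\<And>x r t. (x, r) \<in> G \<Longrightarrow> r + t * a \<le> M * norm (x + t *\<^sub>R x0)"
proof -
  define S where "S = {s - M * norm (y - x0) | y s. (y, s) \<in> G}"
  have zero: "(0, 0) \<in> G"
    using subspace_0[OF G] by (simp add: zero_prod_def)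
  have key: "s - M * norm (y - x0) \<le> M * norm (x + x0) - r" if "(y, s) \<in> G" "(x, r) \<in> G" for x y r s
  proof -
    have "(x + y, r + s) \<in> G"
      using subspace_add[OF G that(2,1)] by simp
    then have "r + s \<le> M * norm (x + y)" by (rule le)
    also have "\<dots> \<le> M * (norm (x + x0) + norm (y - x0))"
      using norm_triangle_ineq[of "x + x0" "y - x0"] M by (intro mult_left_mono) auto
    finally show ?thesis by (simp add: algebra_simps)
  qed
  define a where "a = Sup S"
  have ne: "S \<noteq> {}" and bdd: "bdd_above S"
    using zero key[OF _ zero] by (auto simp: S_def bdd_above_def)
  have lower: "s - M * norm (y - x0) \<le> a" if "(y, s) \<in> G" for y s
    unfolding a_def by (rule cSup_upper[OF _ bdd]) (use that in \<open>auto simp: S_def\<close>)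
  have upper: "a \<le> M * norm (x + x0) - r" if "(x, r) \<in> G" for x r
    unfolding a_def by (rule cSup_least[OF ne]) (use that key in \<open>auto simp: S_def\<close>)
  show thesis
  proof (rule that[of a])
    fix x r and t :: real assume xr: "(x, r) \<in> G"
    consider "t = 0" | "t > 0" | "t < 0" by linarith
    then show "r + t * a \<le> M * norm (x + t *\<^sub>R x0)"
    proof cases
      case 1 then show ?thesis using le[OF xr] by simp
    next
      case 2
      have "((1 / t) *\<^sub>R x, r / t) \<in> G"
        using subspace_scale[OF G xr, of "1 / t"] by simp
      from upper[OF this] have "t * a \<le> t * (M * norm ((1 / t) *\<^sub>R x + x0) - r / t)"
        using 2 by (intro mult_left_mono) auto
      also have "\<dots> = M * (\<bar>t\<bar> * norm ((1 / t) *\<^sub>R x + x0)) - r"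
        using 2 by (simp add: field_simps)
      also have "\<dots> = M * norm (x + t *\<^sub>R x0) - r"
        using 2 by (subst norm_scaleR[symmetric]) (simp add: scaleR_add_right)
      finally show ?thesis by simp
    next
      case 3
      have "((- 1 / t) *\<^sub>R x, - r / t) \<in> G"
        using subspace_scale[OF G xr, of "- 1 / t"] by simp
      from lower[OF this] have "- t * (- r / t - M * norm ((- 1 / t) *\<^sub>R x - x0)) \<le> - t * a"
        using 3 by (intro mult_left_mono) auto
      moreover have "- t * (- r / t - M * norm ((- 1 / t) *\<^sub>R x - x0))
          = r - M * (\<bar>t\<bar> * norm ((- 1 / t) *\<^sub>R x - x0))"
        using 3 by (simp add: field_simps)
      moreover have "\<bar>t\<bar> * norm ((- 1 / t) *\<^sub>R x - x0) = norm (x + t *\<^sub>R x0)"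
      proof -
        have "t *\<^sub>R ((- 1 / t) *\<^sub>R x - x0) = - (x + t *\<^sub>R x0)"
          using 3 by (simp add: scaleR_diff_right)
        then show ?thesis by (metis norm_minus_cancel norm_scaleR)
      qed
      ultimately show ?thesis by simp
    qed
  qed
qed

text \<open>
  Partial extensions are represented by their graphs: subspaces of \<open>'a \<times> real\<close> on which \<open>r \<le> M * norm x\<close>.
  The bound at \<open>x = 0\<close> makes such a subspace single-valued.
\<close>
theorem hahn_banach_norm:
  fixes f :: "'a::real_normed_vector \<Rightarrow> real"
  assumes Y: "subspace Y"
    and add: "\<And>x y. x \<in> Y \<Longrightarrow> y \<in> Y \<Longrightarrow> f (x + y) = f x + f y"
    and scale: "\<And>r x. x \<in> Y \<Longrightarrow> f (r *\<^sub>R x) = r * f x"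
    and bound: "\<And>x. x \<in> Y \<Longrightarrow> f x \<le> M * norm x" and M: "0 \<le> M"
  obtains \<xi> :: "'a \<Rightarrow>\<^sub>L real" where "\<And>x. x \<in> Y \<Longrightarrow> blinfun_apply \<xi> x = f x" "norm \<xi> \<le> M"
proof -
  define \<G> where "\<G> = {G :: ('a \<times> real) set. subspace G \<and> (\<lambda>x. (x, f x)) ` Y \<subseteq> G \<and>
                          (\<forall>(x, r) \<in> G. r \<le> M * norm x)}"
  have f0: "f 0 = 0"
    using scale[of 0 0] subspace_0[OF Y] by simp
  have "(\<lambda>x. (x, f x)) ` Y \<in> \<G>"
    using subspace_0[OF Y] subspace_add[OF Y] subspace_scale[OF Y] bound f0
    by (auto simp: \<G>_def subspace_def zero_prod_def add[symmetric] scale[symmetric])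
  moreover have "\<Union>\<C> \<in> \<G>" if "subset.chain \<G> \<C>" "\<C> \<noteq> {}" for \<C>
  proof -
    have mem: "G \<in> \<G>" if "G \<in> \<C>" for G
      using that \<open>subset.chain \<G> \<C>\<close> by (auto simp: subset.chain_def)
    have sub: "subspace G" if "G \<in> \<C>" for G
      using mem[OF that] by (simp add: \<G>_def)
    have total: "G \<subseteq> G' \<or> G' \<subseteq> G" if "G \<in> \<C>" "G' \<in> \<C>" for G G'
      using that \<open>subset.chain \<G> \<C>\<close> by (auto simp: subset.chain_def)
    have "subspace (\<Union>\<C>)"
      unfolding subspace_def
    proof (intro conjI ballI allI)
      show "0 \<in> \<Union>\<C>" using \<open>\<C> \<noteq> {}\<close> sub by (auto dest: subspace_0)
      show "c *\<^sub>R x \<in> \<Union>\<C>" if "x \<in> \<Union>\<C>" for c x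
        using that sub by (auto dest: subspace_scale)
      show "x + y \<in> \<Union>\<C>" if "x \<in> \<Union>\<C>" "y \<in> \<Union>\<C>" for x y
      proof -
        from that obtain G G' where G: "x \<in> G" "y \<in> G'" "G \<in> \<C>" "G' \<in> \<C>" by auto
        with total[OF G(3,4)] have "\<exists>G\<in>\<C>. x \<in> G \<and> y \<in> G" by auto
        then show ?thesis using sub subspace_add by blast
      qed
    qed
    moreover have "(\<lambda>x. (x, f x)) ` Y \<subseteq> \<Union>\<C>"
      using \<open>\<C> \<noteq> {}\<close> mem by (fastforce simp: \<G>_def)
    moreover have "\<forall>(x, r) \<in> \<Union>\<C>. r \<le> M * norm x"
      using mem by (fastforce simp: \<G>_def)
    ultimately show ?thesis by (simp add: \<G>_def)
  qed
  ultimately have "\<exists>G\<in>\<G>. \<forall>X\<in>\<G>. G \<subseteq> X \<longrightarrow> X = G"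
    by (intro subset_Zorn_nonempty) auto
  then obtain G where G: "G \<in> \<G>" and max: "\<And>X. X \<in> \<G> \<Longrightarrow> G \<subseteq> X \<Longrightarrow> X = G"
    by blast
  have sub: "subspace G" and graph: "\<And>x. x \<in> Y \<Longrightarrow> (x, f x) \<in> G"
    and le: "\<And>x r. (x, r) \<in> G \<Longrightarrow> r \<le> M * norm x"
    using G by (auto simp: \<G>_def)
  \<comment> \<open>Adjoining the line through \<open>(x0, a)\<close> to the maximal graph stays
    inside the admissible graphs, so by maximality the line already belongs to it.\<close>
  have total: "\<exists>r. (x0, r) \<in> G" for x0
  proof -
    obtain a where a: "\<And>x r t. (x, r) \<in> G \<Longrightarrow> r + t * a \<le> M * norm (x + t *\<^sub>R x0)"
      using hahn_banach_extension_step[OF sub le M] by blast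
    let ?G = "{u + v | u v. u \<in> G \<and> v \<in> span {(x0, a)}}"
    have "?G \<in> \<G>"
      unfolding \<G>_def
    proof (intro CollectI conjI)
      show "subspace ?G" by (rule subspace_sums[OF sub subspace_span])
      show "(\<lambda>x. (x, f x)) ` Y \<subseteq> ?G"
      proof (rule image_subsetI)
        fix x assume "x \<in> Y"
        moreover have "(x, f x) = (x, f x) + 0" by simp
        ultimately show "(x, f x) \<in> ?G" using graph span_zero by blast
      qed
      show "\<forall>(x, r)\<in>?G. r \<le> M * norm x"
        using a by (auto simp: span_singleton)
    qed
    moreover have "G \<subseteq> ?G"
    proof
      fix u assume "u \<in> G"
      moreover have "u = u + 0" by simp
      ultimately show "u \<in> ?G" using span_zero by blast
    qed
    ultimately have "?G = G" by (rule max)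
    moreover have "(x0, a) = 0 + (x0, a)" by simp
    then have "(x0, a) \<in> ?G"
      using subspace_0[OF sub] span_base[of "(x0, a)" "{(x0, a)}"] by blast
    ultimately show ?thesis by blast
  qed
  have unique: "r = s" if "(x, r) \<in> G" "(x, s) \<in> G" for x r s
    using le[of 0 "r - s"] le[of 0 "s - r"] subspace_diff[OF sub that] subspace_diff[OF sub that(2,1)]
    by simp
  define F where "F x = (THE r. (x, r) \<in> G)" for x
  have F: "F x = r \<longleftrightarrow> (x, r) \<in> G" for x r
    unfolding F_def using total[of x] unique the_equality[of "\<lambda>r. (x, r) \<in> G"] by metis
  have mem: "(x, F x) \<in> G" for x using F by blast
  have bd: "\<bar>F x\<bar> \<le> M * norm x" for x
    using le[OF mem, of x] le[of "- x" "- F x"] subspace_neg[OF sub mem, of x] by simp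
  have "bounded_linear F"
  proof (rule bounded_linear_intro[of _ M])
    show "F (x + y) = F x + F y" for x y
      using subspace_add[OF sub mem mem, of x y] by (simp add: F)
    show "F (r *\<^sub>R x) = r *\<^sub>R F x" for r x
      using subspace_scale[OF sub mem, of r x] by (simp add: F)
    show "norm (F x) \<le> norm x * M" for x
      using bd[of x] by (simp add: mult.commute)
  qed
  show thesis
  proof (rule that[of "Blinfun F"])
    show "blinfun_apply (Blinfun F) x = f x" if "x \<in> Y" for x
      using graph[OF that] \<open>bounded_linear F\<close> by (simp add: bounded_linear_Blinfun_apply F)
    show "norm (Blinfun F) \<le> M"
      using bd M \<open>bounded_linear F\<close> by (intro norm_blinfun_bound) (auto simp: bounded_linear_Blinfun_apply)
  qed
qed

text \<open>On the sum of \<open>Y\<close> and the line through \<open>x\<close>, the functional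
  sending \<open>y + r *\<^sub>R x\<close> to \<open>r\<close> has norm at most
  \<open>1 / d\<close>, because \<open>norm (y + r *\<^sub>R x)\<close> is
  \<open>\<bar>r\<bar>\<close> times the distance from \<open>x\<close> to a point of
  \<open>Y\<close>. Hahn-Banach extends it.\<close>

lemma hahn_banach_distance:
  fixes Y :: "'a::real_normed_vector set"
  assumes Y: "subspace Y" and d: "0 < d" "\<And>y. y \<in> Y \<Longrightarrow> d \<le> dist y x"
  obtains \<xi> :: "'a \<Rightarrow>\<^sub>L real" where "blinfun_apply \<xi> x = 1" "norm \<xi> \<le> 1 / d"
    "\<And>y. y \<in> Y \<Longrightarrow> blinfun_apply \<xi> y = 0"
proof -
  have xY: "x \<notin> Y" using d(1) d(2)[of x] by auto
  let ?S = "{u + v | u v. u \<in> Y \<and> v \<in> span {x}}"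
  define f where "f w = (THE r. \<exists>y\<in>Y. w = y + r *\<^sub>R x)" for w
  have f: "f (y + r *\<^sub>R x) = r" if "y \<in> Y" for y r
    unfolding f_def
  proof (rule the_equality)
    show "\<exists>y'\<in>Y. y + r *\<^sub>R x = y' + r *\<^sub>R x" using that by blast
    fix r' assume "\<exists>y'\<in>Y. y + r *\<^sub>R x = y' + r' *\<^sub>R x"
    then obtain y' where y': "y' \<in> Y" "y + r *\<^sub>R x = y' + r' *\<^sub>R x" by blast
    then have "(r - r') *\<^sub>R x = y' - y" by (simp add: algebra_simps)
    then have *: "(r - r') *\<^sub>R x \<in> Y" using subspace_diff[OF Y y'(1) that] by simp
    show "r' = r"
    proof (rule ccontr)
      assume "r' \<noteq> r"
      then have "(1 / (r - r')) *\<^sub>R ((r - r') *\<^sub>R x) = x" by simp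
      then show False using subspace_scale[OF Y *] xY by metis
    qed
  qed
  obtain \<xi> :: "'a \<Rightarrow>\<^sub>L real" where \<xi>: "\<And>y. y \<in> ?S \<Longrightarrow> blinfun_apply \<xi> y = f y" "norm \<xi> \<le> 1 / d"
  proof (rule hahn_banach_norm[of ?S f "1 / d"])
    show "subspace ?S" by (rule subspace_sums[OF Y subspace_span])
    show "f (u + v) = f u + f v" if uv: "u \<in> ?S" "v \<in> ?S" for u v
    proof -
      from uv obtain y r y' r' where *: "u = y + r *\<^sub>R x" "v = y' + r' *\<^sub>R x" "y \<in> Y" "y' \<in> Y"
        by (auto simp: span_singleton)
      then have "u + v = (y + y') + (r + r') *\<^sub>R x" by (simp add: algebra_simps)
      then show ?thesis using * f subspace_add[OF Y *(3,4)] by metis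
    qed
    show "f (c *\<^sub>R u) = c * f u" if u: "u \<in> ?S" for c u
    proof -
      from u obtain y r where *: "u = y + r *\<^sub>R x" "y \<in> Y"
        by (auto simp: span_singleton)
      then have "c *\<^sub>R u = c *\<^sub>R y + (c * r) *\<^sub>R x" by (simp add: algebra_simps)
      then show ?thesis using * f subspace_scale[OF Y *(2)] by metis
    qed
    show "f u \<le> 1 / d * norm u" if u: "u \<in> ?S" for u
    proof -
      from u obtain y r where *: "u = y + r *\<^sub>R x" "y \<in> Y"
        by (auto simp: span_singleton)
      show ?thesis
      proof (cases "r = 0")
        case True then show ?thesis using * f[of y 0] d(1) by simp
      next
        case False
        have "d \<le> dist ((- 1 / r) *\<^sub>R y) x"
          by (intro d(2) subspace_scale[OF Y] *)
        then have "\<bar>r\<bar> * d \<le> \<bar>r\<bar> * norm ((- 1 / r) *\<^sub>R y - x)"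
          by (intro mult_left_mono) (auto simp: dist_norm)
        also have "\<dots> = norm (r *\<^sub>R ((- 1 / r) *\<^sub>R y - x))" by simp
        also have "r *\<^sub>R ((- 1 / r) *\<^sub>R y - x) = - u"
          using False * by (simp add: algebra_simps)
        finally have "\<bar>r\<bar> * d \<le> norm u" by simp
        then have "\<bar>r\<bar> \<le> norm u / d" using d(1) by (simp add: field_simps)
        then show ?thesis using * f by auto
      qed
    qed
  qed (use d(1) in auto)
  have "blinfun_apply \<xi> x = 1"
    using \<xi>(1)[of x] f[OF subspace_0[OF Y], of 1] subspace_0[OF Y] span_base[of x "{x}"] by force
  moreover have "blinfun_apply \<xi> y = 0" if "y \<in> Y" for y
    using \<xi>(1)[of y] f[OF that, of 0] that span_zero[of "{x}"] by force
  ultimately show thesis using that \<xi>(2) by blast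
qed

lemma exists_norming_functional:
  fixes x :: "'a::real_normed_vector"
  obtains \<xi> :: "'a \<Rightarrow>\<^sub>L real" where "norm \<xi> \<le> 1" "blinfun_apply \<xi> x = norm x"
proof (cases "x = 0")
  case True
  then show ?thesis using that[of 0] by simp
next
  case False
  then obtain \<xi> :: "'a \<Rightarrow>\<^sub>L real" where \<xi>: "blinfun_apply \<xi> x = 1" "norm \<xi> \<le> 1 / norm x"
    using hahn_banach_distance[of "{0}" "norm x" x] by auto
  show ?thesis
    using that[of "norm x *\<^sub>R \<xi>"] \<xi> False by (simp add: blinfun.scaleR_left pos_le_divide_eq mult.commute)
qed

text \<open>Density is later proved by annihilators: in a reflexive space a functional on the dual
  is a point, and showing that this point is zero is elementary.\<close>

lemma subspace_not_dense_annihilator: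
  fixes Y :: "'a::real_normed_vector set"
  assumes Y: "subspace Y" and nd: "closure Y \<noteq> UNIV"
  obtains \<xi> :: "'a \<Rightarrow>\<^sub>L real" where "\<xi> \<noteq> 0" "\<And>y. y \<in> Y \<Longrightarrow> blinfun_apply \<xi> y = 0"
proof -
  from nd obtain x where "x \<notin> closure Y" by auto
  then obtain d where "d > 0" "\<And>y. y \<in> Y \<Longrightarrow> d \<le> dist y x"
    unfolding closure_approachable by (auto simp: not_less)
  from hahn_banach_distance[OF Y this] obtain \<xi> :: "'a \<Rightarrow>\<^sub>L real"
    where "blinfun_apply \<xi> x = 1" "\<And>y. y \<in> Y \<Longrightarrow> blinfun_apply \<xi> y = 0" by blast
  then show thesis using that[of \<xi>] by (metis zero_blinfun.rep_eq zero_neq_one)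
qed

section \<open>Bochner measurability\<close>

lemma complete_measure_lebesgue_on:
  assumes "S \<in> sets lebesgue"
  shows "complete_measure (lebesgue_on S)"
proof
  fix A B assume "B \<subseteq> A" "A \<in> null_sets (lebesgue_on S)"
  then have "A \<in> null_sets lebesgue" "B \<subseteq> S"
    using assms by (auto simp: null_sets_restrict_space)
  then show "B \<in> sets (lebesgue_on S)"
    using \<open>B \<subseteq> A\<close> assms completion.complete2[of B A lborel]
    by (auto simp: sets_restrict_space_iff dest: null_setsD2)
qed

text \<open>Overwriting all functions by a constant on the exceptional null set gives a genuine
  pointwise limit. The discarded part of a preimage lies in a null set and is measurable by
  completeness.\<close>

lemma (in complete_measure) borel_measurable_AE_LIMSEQ:
  fixes f :: "'a \<Rightarrow> 'b::metric_space"
  assumes s: "\<And>k. s k \<in> borel_measurable M" and lim: "AE x in M. (\<lambda>k. s k x) \<longlonglongrightarrow> f x"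
  shows "f \<in> borel_measurable M"
proof -
  from lim obtain N where N: "N \<in> null_sets M" "\<And>x. x \<in> space M - N \<Longrightarrow> (\<lambda>k. s k x) \<longlonglongrightarrow> f x"
    by (rule AE_E3) blast
  define c :: 'b where "c = undefined"
  define f' where "f' x = (if x \<in> N then c else f x)" for x
  have [measurable]: "N \<in> sets M" "\<And>k. s k \<in> borel_measurable M" using N s by auto
  have "f' \<in> borel_measurable M"
  proof (rule borel_measurable_LIMSEQ_metric)
    show "(\<lambda>x. if x \<in> N then c else s k x) \<in> borel_measurable M" for k by measurable
    show "(\<lambda>k. if x \<in> N then c else s k x) \<longlonglongrightarrow> f' x" if "x \<in> space M" for x
      using N(2) that by (auto simp: f'_def)
  qed
  show ?thesis
  proof (rule measurableI)
    fix A :: "'b set" assume "A \<in> sets borel"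
    have "f -` A \<inter> space M = ((f' -` A \<inter> space M) - N) \<union> (f -` A \<inter> space M \<inter> N)"
      by (auto simp: f'_def)
    moreover have "f -` A \<inter> space M \<inter> N \<in> sets M"
      using complete2[OF _ N(1)] by blast
    moreover have "f' -` A \<inter> space M \<in> sets M"
      using \<open>f' \<in> borel_measurable M\<close> \<open>A \<in> sets borel\<close> by (rule measurable_sets)
    ultimately show "f -` A \<inter> space M \<in> sets M"
      using \<open>N \<in> sets M\<close> by (metis sets.Diff sets.Un)
  qed simp
qed

lemma bochner_measurableI:
  assumes "\<And>k. simple_function M (s k)" "AE x in M. (\<lambda>k. s k x) \<longlonglongrightarrow> f x"
  shows "bochner_measurable M f"
  using assms unfolding bochner_measurable_def by blast

lemma bochner_measurable_borel:
  fixes f :: "'a \<Rightarrow> 'b::{real_normed_vector, second_countable_topology}"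
  assumes "f \<in> borel_measurable M"
  shows "bochner_measurable M f"
proof -
  from borel_measurable_implies_sequence_metric[OF assms, of 0] obtain s
    where s: "\<And>k. simple_function M (s k)" "\<And>x. x \<in> space M \<Longrightarrow> (\<lambda>k. s k x) \<longlonglongrightarrow> f x"
    by blast
  show ?thesis
    by (rule bochner_measurableI[OF s(1) AE_I2[OF s(2)]])
qed

lemma (in complete_measure) bochner_measurable_imp_borel:
  assumes "bochner_measurable M f"
  shows "f \<in> borel_measurable M"
proof -
  from assms obtain s where s: "\<And>k. simple_function M (s k)" "AE x in M. (\<lambda>k. s k x) \<longlonglongrightarrow> f x"
    unfolding bochner_measurable_def by blast
  show ?thesis
    by (rule borel_measurable_AE_LIMSEQ[OF borel_measurable_simple_function[OF s(1)] s(2)])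
qed

lemma bochner_measurable_simple: "simple_function M f \<Longrightarrow> bochner_measurable M f"
  by (rule bochner_measurableI[of M "\<lambda>_. f"]) auto

lemma bochner_measurable_const: "bochner_measurable M (\<lambda>_. c)"
  by (simp add: bochner_measurable_simple)

text \<open>Combining the approximating simple functions works for non-separable values too, where
  the Borel sets of a product may exceed the product sigma-algebra.\<close>

lemma bochner_measurable_continuous2:
  assumes "bochner_measurable M f" "bochner_measurable M g"
    and H: "continuous_on UNIV (\<lambda>p. H (fst p) (snd p))"
  shows "bochner_measurable M (\<lambda>x. H (f x) (g x))"
proof -
  from assms obtain s s' where s: "\<And>k. simple_function M (s k)" "AE x in M. (\<lambda>k. s k x) \<longlonglongrightarrow> f x"
    and s': "\<And>k. simple_function M (s' k)" "AE x in M. (\<lambda>k. s' k x) \<longlonglongrightarrow> g x"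
    unfolding bochner_measurable_def by blast
  have lim: "AE x in M. (\<lambda>k. H (s k x) (s' k x)) \<longlonglongrightarrow> H (f x) (g x)"
    using s(2) s'(2)
  proof eventually_elim
    case (elim x)
    have "isCont (\<lambda>p. H (fst p) (snd p)) (f x, g x)"
      using H by (simp add: continuous_on_eq_continuous_at)
    from isCont_tendsto_compose[OF this tendsto_Pair[OF elim]] show ?case by simp
  qed
  have sf: "simple_function M (\<lambda>x. H (s k x) (s' k x))" for k
    using s(1)[of k] s'(1)[of k] by (rule simple_function_compose2[where h = H])
  show ?thesis
    by (rule bochner_measurableI[where s = "\<lambda>k x. H (s k x) (s' k x)", OF sf lim])
qed

lemma bochner_measurable_continuous:
  assumes "bochner_measurable M f" "continuous_on UNIV h"
  shows "bochner_measurable M (\<lambda>x. h (f x))"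
proof -
  from assms obtain s where s: "\<And>k. simple_function M (s k)" "AE x in M. (\<lambda>k. s k x) \<longlonglongrightarrow> f x"
    unfolding bochner_measurable_def by blast
  have lim: "AE x in M. (\<lambda>k. h (s k x)) \<longlonglongrightarrow> h (f x)"
    using s(2)
  proof eventually_elim
    case (elim x)
    have "isCont h (f x)"
      using assms(2) by (simp add: continuous_on_eq_continuous_at)
    from isCont_tendsto_compose[OF this elim] show ?case .
  qed
  have sf: "simple_function M (\<lambda>x. h (s k x))" for k
    using s(1)[of k] by (rule simple_function_compose1[where g = h])
  show ?thesis
    by (rule bochner_measurableI[where s = "\<lambda>k x. h (s k x)", OF sf lim])
qed

lemma bochner_measurable_add:
  "bochner_measurable M f \<Longrightarrow> bochner_measurable M g \<Longrightarrow> bochner_measurable M (\<lambda>x. f x + g x)"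
  by (rule bochner_measurable_continuous2[where H = "(+)",
        OF _ _ continuous_on_add[OF continuous_on_fst[OF continuous_on_id] continuous_on_snd[OF continuous_on_id]]])

lemma bochner_measurable_diff:
  "bochner_measurable M f \<Longrightarrow> bochner_measurable M g \<Longrightarrow> bochner_measurable M (\<lambda>x. f x - g x)"
  by (rule bochner_measurable_continuous2[where H = "(-)",
        OF _ _ continuous_on_diff[OF continuous_on_fst[OF continuous_on_id] continuous_on_snd[OF continuous_on_id]]])

lemma bochner_measurable_scaleR:
  fixes a :: "'a \<Rightarrow> real"
  assumes "a \<in> borel_measurable M" "bochner_measurable M f"
  shows "bochner_measurable M (\<lambda>x. a x *\<^sub>R f x)"
  using bochner_measurable_borel[OF assms(1)] assms(2)
  by (rule bochner_measurable_continuous2[where H = "(*\<^sub>R)",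
        OF _ _ continuous_on_scaleR[OF continuous_on_fst[OF continuous_on_id] continuous_on_snd[OF continuous_on_id]]])

lemma bochner_measurable_blinfun_apply:
  assumes "bochner_measurable M g" "bochner_measurable M u"
  shows "bochner_measurable M (\<lambda>x. blinfun_apply (g x) (u x))"
  using assms by (rule bochner_measurable_continuous2[where H = "blinfun_apply",
        OF _ _ bounded_bilinear.continuous_on[OF bounded_bilinear_blinfun_apply continuous_on_fst[OF continuous_on_id] continuous_on_snd[OF continuous_on_id]]])

lemma (in complete_measure) borel_measurable_norm_bochner:
  assumes "bochner_measurable M f"
  shows "(\<lambda>x. norm (f x)) \<in> borel_measurable M"
  by (intro bochner_measurable_imp_borel bochner_measurable_continuous[OF assms] continuous_intros)

lemma (in complete_measure) borel_measurable_pairing: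
  fixes g :: "'a \<Rightarrow> 'b::real_normed_vector \<Rightarrow>\<^sub>L real"
  assumes "bochner_measurable M g" "bochner_measurable M u"
  shows "(\<lambda>x. blinfun_apply (g x) (u x)) \<in> borel_measurable M"
  by (intro bochner_measurable_imp_borel bochner_measurable_blinfun_apply assms)

text \<open>Functionals pass through the approximating simple functions. This lets a vector identity
  such as the one in \<open>has_gen_deriv\<close> be tested by scalars.\<close>

lemma (in finite_measure) has_bochner_int_blinfun:
  fixes \<xi> :: "'b::real_normed_vector \<Rightarrow>\<^sub>L real"
  assumes f: "has_bochner_int M f I" and cm: "complete_measure M"
  shows "has_bochner_integral M (\<lambda>x. blinfun_apply \<xi> (f x)) (blinfun_apply \<xi> I)"
proof -
  interpret complete_measure M by fact
  from f obtain s where f: "bochner_measurable M f"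
    and s: "\<And>k. Bochner_Integration.simple_bochner_integrable M (s k)"
    and 0: "(\<lambda>k. \<integral>\<^sup>+x. ennreal (norm (f x - s k x)) \<partial>M) \<longlonglongrightarrow> 0"
    and I: "(\<lambda>k. Bochner_Integration.simple_bochner_integral M (s k)) \<longlonglongrightarrow> I"
    unfolding has_bochner_int_def by blast
  show ?thesis
  proof (rule has_bochner_integral.intros)
    show "(\<lambda>x. blinfun_apply \<xi> (f x)) \<in> borel_measurable M"
      by (intro borel_measurable_pairing bochner_measurable_const f)
    show "Bochner_Integration.simple_bochner_integrable M (\<lambda>x. blinfun_apply \<xi> (s k x))" for k
      using simple_bochner_integrable_compose2[of "\<lambda>x y. blinfun_apply \<xi> x", OF _ s s] by simp
    have "(\<lambda>k. Bochner_Integration.simple_bochner_integral M (\<lambda>x. blinfun_apply \<xi> (s k x)))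
        = (\<lambda>k. blinfun_apply \<xi> (Bochner_Integration.simple_bochner_integral M (s k)))"
      using s by (intro ext simple_bochner_integral_linear) (simp_all add: blinfun.bounded_linear_right bounded_linear.linear)
    then show "(\<lambda>k. Bochner_Integration.simple_bochner_integral M (\<lambda>x. blinfun_apply \<xi> (s k x))) \<longlonglongrightarrow> blinfun_apply \<xi> I"
      using blinfun.tendsto[OF tendsto_const[of \<xi>] I] by simp
    have *: "(\<integral>\<^sup>+x. ennreal (norm (blinfun_apply \<xi> (f x) - blinfun_apply \<xi> (s k x))) \<partial>M)
        \<le> ennreal (norm \<xi>) * (\<integral>\<^sup>+x. ennreal (norm (f x - s k x)) \<partial>M)" for k
    proof -
      have [measurable]: "(\<lambda>x. norm (f x - s k x)) \<in> borel_measurable M"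
        using s[of k]
        by (intro borel_measurable_norm_bochner bochner_measurable_diff f bochner_measurable_simple)
           (auto elim: Bochner_Integration.simple_bochner_integrable.cases)
      have "(\<integral>\<^sup>+x. ennreal (norm (blinfun_apply \<xi> (f x) - blinfun_apply \<xi> (s k x))) \<partial>M)
          \<le> (\<integral>\<^sup>+x. ennreal (norm \<xi>) * ennreal (norm (f x - s k x)) \<partial>M)"
      proof (rule nn_integral_mono)
        fix x
        have "norm (blinfun_apply \<xi> (f x) - blinfun_apply \<xi> (s k x)) \<le> norm \<xi> * norm (f x - s k x)"
          using norm_blinfun[of \<xi> "f x - s k x"] by (simp only: blinfun.diff_right)
        then show "ennreal (norm (blinfun_apply \<xi> (f x) - blinfun_apply \<xi> (s k x)))
            \<le> ennreal (norm \<xi>) * ennreal (norm (f x - s k x))"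
          by (metis ennreal_leI ennreal_mult' norm_ge_zero)
      qed
      also have "\<dots> = ennreal (norm \<xi>) * (\<integral>\<^sup>+x. ennreal (norm (f x - s k x)) \<partial>M)"
        by (rule nn_integral_cmult) simp
      finally show ?thesis .
    qed
    have "(\<lambda>k. ennreal (norm \<xi>) * (\<integral>\<^sup>+x. ennreal (norm (f x - s k x)) \<partial>M)) \<longlonglongrightarrow> ennreal (norm \<xi>) * 0"
      by (rule ennreal_tendsto_cmult[OF _ 0]) simp
    then have lim: "(\<lambda>k. ennreal (norm \<xi>) * (\<integral>\<^sup>+x. ennreal (norm (f x - s k x)) \<partial>M)) \<longlonglongrightarrow> 0"
      by simp
    show "(\<lambda>k. \<integral>\<^sup>+x. ennreal (norm (blinfun_apply \<xi> (f x) - blinfun_apply \<xi> (s k x))) \<partial>M) \<longlonglongrightarrow> 0"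
      by (rule tendsto_sandwich[OF _ _ tendsto_const lim])
         (rule always_eventually, rule allI, simp, rule always_eventually, rule allI, rule * )
  qed
qed

text \<open>Young's inequality for the factors divided by their norms integrates to
  \<open>1 / p + 1 / q = 1\<close>. If one norm is zero, the product vanishes almost everywhere, and
  this case is treated separately.\<close>

lemma Holder_inequality:
  fixes a b :: "'a \<Rightarrow> real"
  assumes pq: "1 < p" "1 / p + 1 / q = 1"
    and [measurable]: "a \<in> borel_measurable M" "b \<in> borel_measurable M"
    and a: "integrable M (\<lambda>x. \<bar>a x\<bar> powr p)" and b: "integrable M (\<lambda>x. \<bar>b x\<bar> powr q)"
  shows "integrable M (\<lambda>x. a x * b x)"
    and "(LINT x|M. \<bar>a x * b x\<bar>) \<le> (LINT x|M. \<bar>a x\<bar> powr p) powr (1 / p) * (LINT x|M. \<bar>b x\<bar> powr q) powr (1 / q)"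
proof -
  have q: "1 < q"
  proof -
    have "1 / p < 1" "1 / p > 0" using pq by simp_all
    then have 1: "1 / q < 1" "0 < 1 / q" using pq(2) by linarith+
    then have "0 < q" by simp
    then show ?thesis using 1 by (simp add: divide_less_eq_1)
  qed
  have young: "\<bar>x * y\<bar> \<le> \<bar>x\<bar> powr p / p + \<bar>y\<bar> powr q / q" for x y :: real
    using Youngs_inequality[of p q "\<bar>x\<bar>" "\<bar>y\<bar>"] pq q by (simp add: abs_mult)
  show int: "integrable M (\<lambda>x. a x * b x)"
  proof (rule Bochner_Integration.integrable_bound)
    show "integrable M (\<lambda>x. \<bar>a x\<bar> powr p / p + \<bar>b x\<bar> powr q / q)" using a b by simp
    show "AE x in M. norm (a x * b x) \<le> norm (\<bar>a x\<bar> powr p / p + \<bar>b x\<bar> powr q / q)"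
      using young pq q by (intro AE_I2) (simp add: order.trans[OF young])
  qed measurable
  define A B where "A = (LINT x|M. \<bar>a x\<bar> powr p)" and "B = (LINT x|M. \<bar>b x\<bar> powr q)"
  have nn: "0 \<le> A" "0 \<le> B" by (auto simp: A_def B_def)
  have zero: "(LINT x|M. \<bar>a x * b x\<bar>) = 0" if "A = 0 \<or> B = 0"
  proof -
    have "AE x in M. a x * b x = 0"
      using that
    proof
      assume "A = 0"
      then have "AE x in M. \<bar>a x\<bar> powr p = 0"
        using integral_nonneg_eq_0_iff_AE[OF a] by (simp add: A_def)
      then show ?thesis by eventually_elim auto
    next
      assume "B = 0"
      then have "AE x in M. \<bar>b x\<bar> powr q = 0"
        using integral_nonneg_eq_0_iff_AE[OF b] by (simp add: B_def)
      then show ?thesis by eventually_elim auto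
    qed
    then show ?thesis by (intro integral_eq_zero_AE) auto
  qed
  show "(LINT x|M. \<bar>a x * b x\<bar>) \<le> A powr (1 / p) * B powr (1 / q)"
  proof (cases "A = 0 \<or> B = 0")
    case True then show ?thesis using zero[OF True] by auto
  next
    case False
    then have pos: "0 < A" "0 < B" using nn by auto
    let ?\<alpha> = "A powr (1 / p)" and ?\<beta> = "B powr (1 / q)"
    have pos': "0 < ?\<alpha>" "0 < ?\<beta>" using pos by auto
    have pow: "?\<alpha> powr p = A" "?\<beta> powr q = B"
      using pos pq q by (auto simp: powr_powr)
    have "(LINT x|M. \<bar>a x * b x\<bar>) / (?\<alpha> * ?\<beta>) = (LINT x|M. \<bar>(a x / ?\<alpha>) * (b x / ?\<beta>)\<bar>)"
      using pos' by (simp add: abs_mult)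
    also have "\<dots> \<le> (LINT x|M. \<bar>a x\<bar> powr p / (A * p) + \<bar>b x\<bar> powr q / (B * q))"
    proof (rule integral_mono)
      show "integrable M (\<lambda>x. \<bar>(a x / ?\<alpha>) * (b x / ?\<beta>)\<bar>)"
        using int by (auto simp: times_divide_times_eq)
      show "integrable M (\<lambda>x. \<bar>a x\<bar> powr p / (A * p) + \<bar>b x\<bar> powr q / (B * q))"
        using a b by auto
      show "\<bar>(a x / ?\<alpha>) * (b x / ?\<beta>)\<bar> \<le> \<bar>a x\<bar> powr p / (A * p) + \<bar>b x\<bar> powr q / (B * q)" for x
        using young[of "a x / ?\<alpha>" "b x / ?\<beta>"] pow pos' by (simp add: powr_divide)
    qed
    also have "\<dots> = A / (A * p) + B / (B * q)"
      using a b by (simp add: A_def B_def)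
    also have "\<dots> = 1" using pos pq q by (simp add: field_simps)
    finally show ?thesis using pos' by (simp add: divide_le_eq)
  qed
qed

lemma integrable_mult_bounded:
  fixes f w :: "'a \<Rightarrow> real"
  assumes f: "f \<in> borel_measurable M" and w: "integrable M w" and le: "\<And>t. t \<in> space M \<Longrightarrow> \<bar>f t\<bar> \<le> B"
  shows "integrable M (\<lambda>t. f t * w t)" "\<bar>LINT t|M. f t * w t\<bar> \<le> B * (LINT t|M. \<bar>w t\<bar>)"
proof -
  have le': "\<bar>f t * w t\<bar> \<le> B * \<bar>w t\<bar>" if "t \<in> space M" for t
    unfolding abs_mult by (intro mult_right_mono le that) simp
  have Bw: "integrable M (\<lambda>t. B * \<bar>w t\<bar>)" using w by simp
  show int: "integrable M (\<lambda>t. f t * w t)"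
  proof (rule Bochner_Integration.integrable_bound[OF Bw])
    show "(\<lambda>t. f t * w t) \<in> borel_measurable M" using f w by auto
    show "AE t in M. norm (f t * w t) \<le> norm (B * \<bar>w t\<bar>)"
      using le' order.trans[OF _ abs_ge_self] by (intro AE_I2) (simp only: real_norm_def, blast)
  qed
  have "\<bar>LINT t|M. f t * w t\<bar> \<le> (LINT t|M. B * \<bar>w t\<bar>)"
    by (rule order.trans[OF integral_abs_bound integral_mono[OF integrable_abs[OF int] Bw le']])
  then show "\<bar>LINT t|M. f t * w t\<bar> \<le> B * (LINT t|M. \<bar>w t\<bar>)" by simp
qed

section \<open>Lebesgue--Bochner spaces\<close>

lemma finite_measure_interval: "finite_measure (lebesgue_on {0..T::real})"
  by (rule finite_measure_lebesgue_on) simp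

lemma complete_measure_interval: "complete_measure (lebesgue_on {0..T::real})"
  by (rule complete_measure_lebesgue_on) simp

lemma LpD:
  assumes "f \<in> Lp T p"
  shows "bochner_measurable (lebesgue_on {0..T}) f"
    and "integrable (lebesgue_on {0..T}) (\<lambda>t. norm (f t) powr p)"
    and "(\<lambda>t. norm (f t)) \<in> borel_measurable (lebesgue_on {0..T})"
  using assms complete_measure.borel_measurable_norm_bochner[OF complete_measure_interval]
  by (auto simp: Lp_def)

lemma Lp_dominated:
  assumes f: "bochner_measurable (lebesgue_on {0..T}) f" and p: "0 \<le> p"
    and b: "integrable (lebesgue_on {0..T}) b"
    and le: "AE t in lebesgue_on {0..T}. norm (f t) powr p \<le> b t"
  shows "f \<in> Lp T p"
proof -
  have [measurable]: "(\<lambda>t. norm (f t)) \<in> borel_measurable (lebesgue_on {0..T})"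
    by (rule complete_measure.borel_measurable_norm_bochner[OF complete_measure_interval f])
  have "integrable (lebesgue_on {0..T}) (\<lambda>t. norm (f t) powr p)"
    by (rule Bochner_Integration.integrable_bound[OF b]) (use le in auto)
  with f show ?thesis by (simp add: Lp_def)
qed

lemma Lp_norm_dominated:
  assumes f: "bochner_measurable (lebesgue_on {0..T}) f" and p: "0 < p"
    and g: "g \<in> Lp T p" and le: "AE t in lebesgue_on {0..T}. norm (f t) \<le> norm (g t)"
  shows "f \<in> Lp T p" "Lp_norm T p f \<le> Lp_norm T p g"
proof -
  have le': "AE t in lebesgue_on {0..T}. norm (f t) powr p \<le> norm (g t) powr p"
    using le by eventually_elim (use p in \<open>auto intro: powr_mono2\<close>)
  show "f \<in> Lp T p"
    by (rule Lp_dominated[OF f _ LpD(2)[OF g] le']) (use p in simp)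
  then show "Lp_norm T p f \<le> Lp_norm T p g"
    unfolding Lp_norm_def using p g le'
    by (intro powr_mono2 integral_mono_AE LpD(2)) auto
qed

lemma Lp_add:
  assumes f: "f \<in> Lp T p" and g: "g \<in> Lp T p" and p: "0 < p"
  shows "(\<lambda>t. f t + g t) \<in> Lp T p"
proof (rule Lp_dominated)
  show "integrable (lebesgue_on {0..T}) (\<lambda>t. 2 powr p * (norm (f t) powr p + norm (g t) powr p))"
    using LpD(2)[OF f] LpD(2)[OF g] by simp
  show "AE t in lebesgue_on {0..T}. norm (f t + g t) powr p \<le> 2 powr p * (norm (f t) powr p + norm (g t) powr p)"
  proof (intro AE_I2)
    fix t
    let ?m = "max (norm (f t)) (norm (g t))"
    have "norm (f t + g t) \<le> 2 * ?m" using norm_triangle_ineq[of "f t" "g t"] by linarith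
    then have "norm (f t + g t) powr p \<le> (2 * ?m) powr p" using p by (intro powr_mono2) auto
    also have "\<dots> = 2 powr p * ?m powr p" by (rule powr_mult)
    also have "?m powr p \<le> norm (f t) powr p + norm (g t) powr p" by (simp add: max_def)
    finally show "norm (f t + g t) powr p \<le> 2 powr p * (norm (f t) powr p + norm (g t) powr p)" by simp
  qed
qed (use p LpD(1)[OF f] LpD(1)[OF g] in \<open>auto intro: bochner_measurable_add\<close>)

lemma Lp_scaleR:
  assumes f: "f \<in> Lp T p" and p: "0 < p"
  shows "(\<lambda>t. a *\<^sub>R f t) \<in> Lp T p"
proof -
  have "bochner_measurable (lebesgue_on {0..T}) (\<lambda>t. a *\<^sub>R f t)"
    by (rule bochner_measurable_scaleR[OF _ LpD(1)[OF f]]) simp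
  moreover have "integrable (lebesgue_on {0..T}) (\<lambda>t. norm (a *\<^sub>R f t) powr p)"
    using LpD(2)[OF f] by (simp add: powr_mult)
  ultimately show ?thesis by (simp add: Lp_def)
qed

lemma Lp_diff:
  assumes f: "f \<in> Lp T p" and g: "g \<in> Lp T p" and p: "0 < p"
  shows "(\<lambda>t. f t - g t) \<in> Lp T p"
  using Lp_add[OF f Lp_scaleR[OF g p, of "-1"] p] by simp

lemma Lp_bounded:
  assumes f: "bochner_measurable (lebesgue_on {0..T}) f" and p: "0 < p"
    and le: "AE t in lebesgue_on {0..T}. norm (f t) \<le> C"
  shows "f \<in> Lp T p"
proof (rule Lp_dominated[OF f])
  interpret finite_measure "lebesgue_on {0..T}" by (rule finite_measure_interval)
  show "integrable (lebesgue_on {0..T}) (\<lambda>t. C powr p)" by simp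
  show "AE t in lebesgue_on {0..T}. norm (f t) powr p \<le> C powr p"
    using le by eventually_elim (use p in \<open>auto intro: powr_mono2\<close>)
qed (use p in simp)

lemma Lp_integrable:
  assumes f: "f \<in> Lp T p" and p: "1 < p"
  shows "integrable (lebesgue_on {0..T}) (\<lambda>t. norm (f t))"
    and "(LINT t|lebesgue_on {0..T}. norm (f t)) \<le> (LINT t|lebesgue_on {0..T}. 1) powr (1 - 1 / p) * Lp_norm T p f"
proof -
  interpret finite_measure "lebesgue_on {0..T}" by (rule finite_measure_interval)
  define q where "q = 1 / (1 - 1 / p)"
  have q: "1 / p + 1 / q = 1" using p by (simp add: q_def)
  note H = Holder_inequality[OF p q LpD(3)[OF f], of "\<lambda>_. 1"]
  from H(1) show "integrable (lebesgue_on {0..T}) (\<lambda>t. norm (f t))"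
    using LpD(2)[OF f] by simp
  from H(2) show "(LINT t|lebesgue_on {0..T}. norm (f t)) \<le> (LINT t|lebesgue_on {0..T}. 1) powr (1 - 1 / p) * Lp_norm T p f"
    using LpD(2)[OF f] by (simp add: Lp_norm_def q_def mult.commute)
qed

text \<open>The identity \<open>q * (p - 1) = p\<close> is what places the power
  \<open>p - 1\<close> of a function in \<open>L^p\<close> into \<open>L^q\<close>.\<close>

lemma conjugate_exponent:
  fixes p q :: real
  assumes "1 < p" "1 / p + 1 / q = 1"
  shows "1 < q" "p * (q - 1) = q" "q * (p - 1) = p"
proof -
  have "1 / p < 1" "1 / p > 0" using assms by simp_all
  then have 1: "1 / q < 1" "0 < 1 / q" using assms(2) by linarith+
  then have q: "0 < q" by simp
  then show "1 < q" using 1 by (simp add: divide_less_eq_1)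
  have "q + p = p * q" using assms q by (simp add: field_simps)
  then show "p * (q - 1) = q" "q * (p - 1) = p" by (simp_all add: algebra_simps)
qed

lemma pairing_Holder:
  fixes g :: "real \<Rightarrow> 'b::real_normed_vector \<Rightarrow>\<^sub>L real"
  assumes p: "1 < p" "1 / p + 1 / q = 1" and g: "g \<in> Lp T q" and u: "u \<in> Lp T p"
  shows "integrable (lebesgue_on {0..T}) (\<lambda>t. norm (u t) * norm (g t))"
    and "integrable (lebesgue_on {0..T}) (\<lambda>t. blinfun_apply (g t) (u t))"
    and "\<bar>pairing T g u\<bar> \<le> Lp_norm T p u * Lp_norm T q g"
proof -
  have [measurable]: "(\<lambda>t. blinfun_apply (g t) (u t)) \<in> borel_measurable (lebesgue_on {0..T})"
    by (intro complete_measure.borel_measurable_pairing complete_measure_interval LpD(1)[OF g] LpD(1)[OF u])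
  note H = Holder_inequality[OF p LpD(3)[OF u] LpD(3)[OF g]]
  from H(1) show prod: "integrable (lebesgue_on {0..T}) (\<lambda>t. norm (u t) * norm (g t))"
    using LpD(2)[OF g] LpD(2)[OF u] by simp
  have le: "\<bar>blinfun_apply (g t) (u t)\<bar> \<le> norm (u t) * norm (g t)" for t
    using norm_blinfun[of "g t" "u t"] by (simp add: mult.commute)
  show int: "integrable (lebesgue_on {0..T}) (\<lambda>t. blinfun_apply (g t) (u t))"
    by (rule Bochner_Integration.integrable_bound[OF prod]) (use le in auto)
  have "\<bar>pairing T g u\<bar> \<le> (LINT t|lebesgue_on {0..T}. norm (u t) * norm (g t))"
    unfolding pairing_def by (intro integral_abs_bound_integral int prod le)
  also have "\<dots> \<le> Lp_norm T p u * Lp_norm T q g"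
    using H(2) LpD(2)[OF g] LpD(2)[OF u] by (simp add: Lp_norm_def)
  finally show "\<bar>pairing T g u\<bar> \<le> Lp_norm T p u * Lp_norm T q g" .
qed

lemma Lp_norm_tendsto_0:
  fixes f :: "real \<Rightarrow> 'b::real_normed_vector"
  assumes p: "0 < p" and f: "f \<in> Lp T p" and s: "\<And>k. bochner_measurable (lebesgue_on {0..T}) (s k)"
    and lim: "AE t in lebesgue_on {0..T}. (\<lambda>k. s k t) \<longlonglongrightarrow> 0"
    and le: "\<And>k. AE t in lebesgue_on {0..T}. norm (s k t) \<le> norm (f t)"
  shows "(\<lambda>k. Lp_norm T p (s k)) \<longlonglongrightarrow> 0"
proof -
  have [measurable]: "(\<lambda>t. norm (s k t)) \<in> borel_measurable (lebesgue_on {0..T})" for k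
    by (rule complete_measure.borel_measurable_norm_bochner[OF complete_measure_interval s])
  have "(\<lambda>k. LINT t|lebesgue_on {0..T}. norm (s k t) powr p) \<longlonglongrightarrow> (LINT t|lebesgue_on {0..T}. 0)"
  proof (rule integral_dominated_convergence[OF _ _ LpD(2)[OF f]])
    show "AE t in lebesgue_on {0..T}. (\<lambda>k. norm (s k t) powr p) \<longlonglongrightarrow> 0"
      using lim
    proof eventually_elim
      case (elim t)
      have "(\<lambda>k. norm (s k t) powr p) \<longlonglongrightarrow> 0 powr p"
        using p by (intro tendsto_powr2 tendsto_norm_zero elim tendsto_const) auto
      then show ?case by simp
    qed
    show "AE t in lebesgue_on {0..T}. norm (norm (s k t) powr p) \<le> norm (f t) powr p" for k
      using le[of k] by eventually_elim (use p in \<open>auto intro: powr_mono2\<close>)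
  qed auto
  then have "(\<lambda>k. LINT t|lebesgue_on {0..T}. norm (s k t) powr p) \<longlonglongrightarrow> 0" by simp
  then have "(\<lambda>k. (LINT t|lebesgue_on {0..T}. norm (s k t) powr p) powr (1 / p)) \<longlonglongrightarrow> 0 powr (1 / p)"
    using p by (intro tendsto_powr2 tendsto_const) auto
  then show ?thesis by (simp add: Lp_norm_def)
qed

text \<open>Simple functions converging almost everywhere need not be dominated, so each is cut off
  to the set where it is at most \<open>2 * norm (f t)\<close>. Where \<open>f\<close> is nonzero
  the cut-off is eventually inactive; where \<open>f\<close> is zero it forces the value zero. The
  differences are then dominated by \<open>3 * norm (f t)\<close>.\<close>

lemma Lp_simple_approximation:
  fixes f :: "real \<Rightarrow> 'b::real_normed_vector"
  assumes p: "0 < p" and f: "f \<in> Lp T p"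
  obtains s where "\<And>k::nat. simple_function (lebesgue_on {0..T}) (s k)" "\<And>k. s k \<in> Lp T p"
    "(\<lambda>k. Lp_norm T p (\<lambda>t. s k t - f t)) \<longlonglongrightarrow> 0"
proof -
  let ?M = "lebesgue_on {0..T}"
  from LpD(1)[OF f] obtain s where s: "\<And>k. simple_function ?M (s k)" and lim: "AE t in ?M. (\<lambda>k. s k t) \<longlonglongrightarrow> f t"
    unfolding bochner_measurable_def by blast
  have sb: "bochner_measurable ?M (s k)" for k by (rule bochner_measurable_simple[OF s])
  define A where "A k = {t \<in> space ?M. norm (s k t) \<le> 2 * norm (f t)}" for k
  have [measurable]: "(\<lambda>t. norm (s k t)) \<in> borel_measurable ?M" "(\<lambda>t. norm (f t)) \<in> borel_measurable ?M" for k
    using complete_measure.borel_measurable_norm_bochner[OF complete_measure_interval sb] LpD(3)[OF f] by auto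
  have A: "A k \<in> sets ?M" for k unfolding A_def by measurable
  define u where "u k t = (indicator (A k) t :: real) *\<^sub>R s k t" for k t
  have u: "simple_function ?M (u k)" for k
    unfolding u_def[abs_def]
    using simple_function_indicator[OF A[of k]] s[of k] by (rule simple_function_compose2[where h = "(*\<^sub>R)"])
  have le: "AE t in ?M. norm (u k t) \<le> norm (2 *\<^sub>R f t)" for k
    by (intro AE_I2) (auto simp: u_def A_def indicator_def)
  have ub: "bochner_measurable ?M (u k)" for k by (rule bochner_measurable_simple[OF u])
  have uL: "u k \<in> Lp T p" for k
    by (rule Lp_norm_dominated[OF ub p Lp_scaleR[OF f p] le])
  have ulim: "AE t in ?M. (\<lambda>k. u k t - f t) \<longlonglongrightarrow> 0"
    using lim AE_space
  proof eventually_elim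
    case (elim t)
    have "(\<lambda>k. u k t) \<longlonglongrightarrow> f t"
    proof (cases "f t = 0")
      case True
      then have "u k t = 0" for k by (auto simp: u_def A_def indicator_def)
      then show ?thesis using True by simp
    next
      case False
      then have "norm (f t) < 2 * norm (f t)" by simp
      from order_tendstoD(2)[OF tendsto_norm[OF elim(1)] this]
      have "\<forall>\<^sub>F k in sequentially. s k t = u k t"
        by eventually_elim (use elim(2) in \<open>auto simp: u_def A_def indicator_def\<close>)
      with elim(1) show ?thesis by (rule Lim_transform_eventually)
    qed
    then show ?case by (rule LIM_zero)
  qed
  have "(\<lambda>k. Lp_norm T p (\<lambda>t. u k t - f t)) \<longlonglongrightarrow> 0"
  proof (rule Lp_norm_tendsto_0[OF p Lp_scaleR[OF f p, of 3] _ ulim])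
    show "bochner_measurable ?M (\<lambda>t. u k t - f t)" for k
      by (intro bochner_measurable_diff ub LpD(1)[OF f])
    show "AE t in ?M. norm (u k t - f t) \<le> norm (3 *\<^sub>R f t)" for k
      using le[of k]
    proof eventually_elim
      case (elim t)
      then show ?case using norm_triangle_ineq4[of "u k t" "f t"] by simp
    qed
  qed
  then show thesis using that[of u] u uL by blast
qed

lemma simple_function_sum_indicator:
  fixes s :: "'a \<Rightarrow> 'b::real_vector"
  assumes "simple_function M s" "t \<in> space M"
  shows "s t = (\<Sum>y\<in>s ` space M. (indicator (s -` {y} \<inter> space M) t :: real) *\<^sub>R y)"
proof -
  have "(\<Sum>y\<in>s ` space M. (indicator (s -` {y} \<inter> space M) t :: real) *\<^sub>R y) = (\<Sum>y\<in>s ` space M. if y = s t then y else 0)"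
    using assms(2) by (intro sum.cong) (auto simp: indicator_def)
  also have "\<dots> = s t"
    using assms by (simp add: simple_functionD(1))
  finally show ?thesis ..
qed

text \<open>The bound by a positive power of the measure does double duty: it gives continuity at
  the empty set, which upgrades finite to countable additivity, and it gives absolute continuity.
  Radon-Nikodym then yields \<open>D\<close>.\<close>

lemma additive_set_function_density:
  fixes \<nu> :: "'a set \<Rightarrow> real"
  assumes fin: "finite_measure M" and nonneg: "\<And>A. A \<in> sets M \<Longrightarrow> 0 \<le> \<nu> A"
    and add: "\<And>A B. A \<in> sets M \<Longrightarrow> B \<in> sets M \<Longrightarrow> A \<inter> B = {} \<Longrightarrow> \<nu> (A \<union> B) = \<nu> A + \<nu> B"
    and cont: "\<And>A. A \<in> sets M \<Longrightarrow> \<nu> A \<le> C * measure M A powr \<alpha>" and \<alpha>: "0 < \<alpha>"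
  obtains D where "integrable M D" "\<And>x. 0 \<le> D x" "\<And>A. A \<in> sets M \<Longrightarrow> \<nu> A = (LINT x|M. indicator A x * D x)"
proof -
  interpret finite_measure M by fact
  have empty: "\<nu> {} = 0" using add[of "{}" "{}"] by simp
  define N where "N = measure_of (space M) (sets M) (\<lambda>A. ennreal (\<nu> A))"
  have "countably_additive (sets M) (\<lambda>A. ennreal (\<nu> A))"
  proof (rule sets.empty_continuous_imp_countably_additive)
    show "positive (sets M) (\<lambda>A. ennreal (\<nu> A))" by (simp add: positive_def empty)
    show "additive (sets M) (\<lambda>A. ennreal (\<nu> A))" by (simp add: additive_def add nonneg)
    show "\<forall>A\<in>sets M. ennreal (\<nu> A) \<noteq> \<infinity>" by simp
    fix A :: "nat \<Rightarrow> 'a set" assume A: "range A \<subseteq> sets M" "decseq A" "(\<Inter>i. A i) = {}"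
    have "(\<lambda>i. measure M (A i)) \<longlonglongrightarrow> measure M (\<Inter>i. A i)"
      using A by (intro finite_Lim_measure_decseq)
    then have "(\<lambda>i. measure M (A i)) \<longlonglongrightarrow> 0" using A by simp
    then have "(\<lambda>i. measure M (A i) powr \<alpha>) \<longlonglongrightarrow> 0 powr \<alpha>"
      using \<alpha> by (intro tendsto_powr2 tendsto_const) auto
    then have lim: "(\<lambda>i. C * measure M (A i) powr \<alpha>) \<longlonglongrightarrow> 0"
      using tendsto_mult[OF tendsto_const[of C]] by fastforce
    have "(\<lambda>i. \<nu> (A i)) \<longlonglongrightarrow> 0"
      by (rule tendsto_sandwich[OF _ _ tendsto_const lim]) (use A nonneg cont in \<open>auto intro!: always_eventually\<close>)
    then show "(\<lambda>i. ennreal (\<nu> (A i))) \<longlonglongrightarrow> 0"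
      using tendsto_ennrealI by fastforce
  qed
  then have N: "emeasure N A = ennreal (\<nu> A)" if "A \<in> sets M" for A
    unfolding N_def using that sets.sigma_algebra_axioms
    by (intro emeasure_measure_of_sigma) (auto simp: positive_def empty)
  have setsN: "sets N = sets M" by (simp add: N_def)
  then have spaceN: "space N = space M" by (rule sets_eq_imp_space_eq)
  interpret N: finite_measure N
    by (rule finite_measureI) (simp add: spaceN N)
  have ac: "absolutely_continuous M N"
    unfolding absolutely_continuous_def
  proof
    fix A assume "A \<in> null_sets M"
    then have A: "A \<in> sets M" "measure M A = 0" by (auto simp: measure_def)
    then have "\<nu> A = 0" using cont[OF A(1)] nonneg[OF A(1)] \<alpha> by simp
    then show "A \<in> null_sets N" using A by (simp add: null_sets_def N setsN)
  qed
  obtain D where D: "D \<in> borel_measurable M" "AE x in M. RN_deriv M N x = ennreal (D x)" "\<And>x. 0 \<le> D x"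
    using real_RN_deriv[OF N.finite_measure_axioms ac setsN] by blast
  have nn: "ennreal (\<nu> A) = (\<integral>\<^sup>+x. ennreal (indicator A x * D x) \<partial>M)" if A: "A \<in> sets M" for A
  proof -
    have "ennreal (\<nu> A) = emeasure (density M (RN_deriv M N)) A"
      using density_RN_deriv[OF ac setsN] N[OF A] by simp
    also have "\<dots> = (\<integral>\<^sup>+x. RN_deriv M N x * indicator A x \<partial>M)"
      using A by (intro emeasure_density) auto
    also have "\<dots> = (\<integral>\<^sup>+x. ennreal (indicator A x * D x) \<partial>M)"
      using D(2) by (intro nn_integral_cong_AE) (auto elim!: eventually_mono simp: indicator_def)
    finally show ?thesis .
  qed
  show thesis
  proof (rule that[of D])
    have "(\<integral>\<^sup>+x. ennreal (D x) \<partial>M) = ennreal (\<nu> (space M))"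
      unfolding nn[OF sets.top] by (intro nn_integral_cong) simp
    then show "integrable M D"
      using D by (intro integrableI_nonneg) auto
    show "\<nu> A = (LINT x|M. indicator A x * D x)" if A: "A \<in> sets M" for A
    proof -
      have "(LINT x|M. indicator A x * D x) = enn2real (\<integral>\<^sup>+x. ennreal (indicator A x * D x) \<partial>M)"
        using D A by (intro integral_eq_nn_integral) auto
      then show ?thesis by (simp add: nn[OF A, symmetric] nonneg[OF A])
    qed
  qed (rule D(3))
qed

text \<open>Testing with the set where \<open>g x < f x\<close> makes the integral of a nonnegative
  function at most zero.\<close>

lemma AE_le_of_set_integrals:
  fixes f g :: "'a \<Rightarrow> real"
  assumes f: "integrable M f" and g: "integrable M g"
    and le: "\<And>A. A \<in> sets M \<Longrightarrow> (LINT x|M. indicator A x * f x) \<le> (LINT x|M. indicator A x * g x)"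
  shows "AE x in M. f x \<le> g x"
proof -
  have [measurable]: "f \<in> borel_measurable M" "g \<in> borel_measurable M" using f g by auto
  define A where "A = {x \<in> space M. g x < f x}"
  have A: "A \<in> sets M" unfolding A_def by measurable
  have int: "integrable M (\<lambda>x. indicator A x * f x)" "integrable M (\<lambda>x. indicator A x * g x)"
    using integrable_mult_indicator[OF A f] integrable_mult_indicator[OF A g] by auto
  have diff: "integrable M (\<lambda>x. indicator A x * (f x - g x))"
    using int by (simp add: right_diff_distrib)
  have nn: "AE x in M. 0 \<le> indicator A x * (f x - g x)"
    by (intro AE_I2) (auto simp: A_def indicator_def)
  have "(LINT x|M. indicator A x * (f x - g x)) \<le> 0"
    using le[OF A] int by (simp add: right_diff_distrib)
  moreover have "0 \<le> (LINT x|M. indicator A x * (f x - g x))"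
    by (rule integral_nonneg_AE[OF nn])
  ultimately have "(LINT x|M. indicator A x * (f x - g x)) = 0" by simp
  then have "AE x in M. indicator A x * (f x - g x) = 0"
    using integral_nonneg_eq_0_iff_AE[OF diff nn] by simp
  then show ?thesis
    using AE_space by eventually_elim (auto simp: A_def indicator_def split: if_splits)
qed

lemma AE_eq_of_set_integrals:
  fixes f g :: "'a \<Rightarrow> real"
  assumes "integrable M f" "integrable M g"
    and "\<And>A. A \<in> sets M \<Longrightarrow> (LINT x|M. indicator A x * f x) = (LINT x|M. indicator A x * g x)"
  shows "AE x in M. f x = g x"
  using AE_le_of_set_integrals[of M f g] AE_le_of_set_integrals[of M g f] assms
  by (auto elim: eventually_elim2)

section \<open>Smooth bump functions\<close>

text \<open>The polynomial factor in \<open>1 / u\<close> makes the family closed under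
  differentiation, so smoothness of the classical function exp(-1/u), extended by zero, needs no
  formula for higher derivatives.\<close>

definition flat :: "real poly \<Rightarrow> real \<Rightarrow> real" where
  "flat q u = (if 0 < u then poly q (1 / u) * exp (- 1 / u) else 0)"

lemma poly_exp_decay: "((\<lambda>y. poly q y * exp (- y)) \<longlongrightarrow> (0::real)) at_top"
proof -
  have "((\<lambda>y. \<Sum>n\<le>degree q. coeff q n * (y ^ n / exp y)) \<longlongrightarrow> (\<Sum>n\<le>degree q. coeff q n * 0)) at_top"
    by (intro tendsto_sum tendsto_mult tendsto_const tendsto_power_div_exp_0)
  then show ?thesis
    by (simp add: poly_altdef sum_distrib_right exp_minus divide_inverse mult.assoc)
qed

text \<open>For positive \<open>u\<close> the chain rule produces the factor
  \<open>1 / u\<^sup>2\<close> and the difference \<open>q - pderiv q\<close>, both evaluated at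
  \<open>1 / u\<close>; the factor is the polynomial \<open>[:0, 0, 1:]\<close>.\<close>

lemma flat_has_derivative:
  "(flat q has_real_derivative flat (([:0, 0, 1:] * (q - pderiv q))) u) (at u)"
proof -
  consider "u < 0" | "u = 0" | "u > 0" by linarith
  then show ?thesis
  proof cases
    case 1
    have "((\<lambda>_. 0) has_real_derivative 0) (at u)" by simp
    then have "(flat q has_real_derivative 0) (at u)"
      by (rule has_field_derivative_transform_within_open[of _ _ _ "{..<0}"]) (use 1 in \<open>auto simp: flat_def\<close>)
    then show ?thesis using 1 by (simp add: flat_def)
  next
    case 3
    have "((\<lambda>u. poly q (1 / u) * exp (- 1 / u)) has_real_derivative
        poly ([:0, 0, 1:] * (q - pderiv q)) (1 / u) * exp (- 1 / u)) (at u)"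
      using 3 by (auto intro!: derivative_eq_intros simp: field_simps power2_eq_square)
    then have "(flat q has_real_derivative poly ([:0, 0, 1:] * (q - pderiv q)) (1 / u) * exp (- 1 / u)) (at u)"
      by (rule has_field_derivative_transform_within_open[of _ _ _ "{0<..}"]) (use 3 in \<open>auto simp: flat_def\<close>)
    then show ?thesis using 3 by (simp add: flat_def)
  next
    case 2
    \<comment> \<open>At the origin the difference quotient divides by \<open>h\<close>, which means
      multiplying the polynomial by its variable; exponential decay beats this too.\<close>
    have "((\<lambda>h. poly (pCons 0 q) (1 / h) * exp (- (1 / h))) \<longlongrightarrow> 0) (at_right (0::real))"
      using filterlim_compose[OF poly_exp_decay filterlim_inverse_at_top_right, of "pCons 0 q"]
      by (simp add: inverse_eq_divide)
    then have "((\<lambda>h. flat q h / h) \<longlongrightarrow> 0) (at_right 0)"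
      by (rule Lim_transform_eventually) (auto simp: eventually_at_right_less flat_def eventually_at_filter)
    moreover have "((\<lambda>h. flat q h / h) \<longlongrightarrow> 0) (at_left 0)"
      by (rule Lim_transform_eventually[OF tendsto_const]) (auto simp: flat_def eventually_at_filter)
    ultimately have "((\<lambda>h. flat q h / h) \<longlongrightarrow> 0) (at 0)"
      by (simp add: filterlim_split_at)
    then show ?thesis using 2 by (simp add: DERIV_def flat_def)
  qed
qed

text \<open>Closure under sums and products makes the product rule stay inside the set, so every
  iterated derivative exists by a plain induction.\<close>

inductive_set flat_algebra :: "(real \<Rightarrow> real) set" where
  base: "(\<lambda>x. flat q (a * x + b)) \<in> flat_algebra"
| add: "f \<in> flat_algebra \<Longrightarrow> g \<in> flat_algebra \<Longrightarrow> (\<lambda>x. f x + g x) \<in> flat_algebra"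
| mult: "f \<in> flat_algebra \<Longrightarrow> g \<in> flat_algebra \<Longrightarrow> (\<lambda>x. f x * g x) \<in> flat_algebra"

lemma flat_smult: "flat (smult c q) u = c * flat q u"
  by (simp add: flat_def)

lemma flat_algebra_cmult: "f \<in> flat_algebra \<Longrightarrow> (\<lambda>x. c * f x) \<in> flat_algebra"
proof (induction rule: flat_algebra.induct)
  case (base q a b)
  show ?case using flat_algebra.base[of "smult c q" a b] by (simp add: flat_smult)
next
  case (add f g) then show ?case using flat_algebra.add by (fastforce simp: distrib_left)
next
  case (mult f g)
  then show ?case using flat_algebra.mult[of "\<lambda>x. c * f x" g] by (simp add: mult.assoc)
qed

lemma flat_algebra_deriv:
  assumes "f \<in> flat_algebra"
  shows "\<exists>f' \<in> flat_algebra. \<forall>x. (f has_real_derivative f' x) (at x)"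
  using assms
proof (induction rule: flat_algebra.induct)
  case (base q a b)
  let ?q = "[:0, 0, 1:] * (q - pderiv q)"
  have "((\<lambda>x. flat q (a * x + b)) has_real_derivative a * flat ?q (a * x + b)) (at x)" for x
  proof -
    have "((\<lambda>x. a * x + b) has_real_derivative a) (at x)"
      by (auto intro!: derivative_eq_intros)
    from DERIV_chain2[OF flat_has_derivative this] show ?thesis by (simp add: mult.commute)
  qed
  then show ?case
    using flat_algebra_cmult[OF flat_algebra.base[of ?q a b], of a]
    by (intro bexI[of _ "\<lambda>x. a * flat ?q (a * x + b)"]) auto
next
  case (add f g)
  then obtain f' g' where "f' \<in> flat_algebra" "g' \<in> flat_algebra"
    "\<And>x. (f has_real_derivative f' x) (at x)" "\<And>x. (g has_real_derivative g' x) (at x)" by blast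
  then show ?case
    by (intro bexI[of _ "\<lambda>x. f' x + g' x"] allI DERIV_add flat_algebra.add) auto
next
  case (mult f g)
  then obtain f' g' where "f' \<in> flat_algebra" "g' \<in> flat_algebra"
    "\<And>x. (f has_real_derivative f' x) (at x)" "\<And>x. (g has_real_derivative g' x) (at x)" by blast
  then show ?case
    using mult.hyps
    by (intro bexI[of _ "\<lambda>x. f' x * g x + g' x * f x"] allI DERIV_mult flat_algebra.intros) auto
qed

lemma flat_algebra_deriv_in:
  assumes "f \<in> flat_algebra"
  shows "f field_differentiable (at x)" "deriv f \<in> flat_algebra"
proof -
  from flat_algebra_deriv[OF assms] obtain f' where f': "f' \<in> flat_algebra" "\<And>x. (f has_real_derivative f' x) (at x)"
    by blast
  then have "deriv f = f'" by (intro ext DERIV_imp_deriv)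
  with f' show "f field_differentiable (at x)" "deriv f \<in> flat_algebra"
    by (auto simp: field_differentiable_def)
qed

lemma flat_algebra_smooth:
  assumes "f \<in> flat_algebra"
  shows "((deriv ^^ k) f) field_differentiable (at x)"
proof -
  have "(deriv ^^ k) f \<in> flat_algebra"
    by (induction k) (simp_all add: assms flat_algebra_deriv_in)
  then show ?thesis by (rule flat_algebra_deriv_in)
qed

lemma flat_algebra_continuous: "f \<in> flat_algebra \<Longrightarrow> continuous_on S f"
  using flat_algebra_deriv_in(1) by (meson continuous_at_imp_continuous_on field_differentiable_imp_continuous_at)

text \<open>
  Since \<open>flat 1 u = exp (- 1 / u)\<close> for \<open>u > 0\<close>, \<open>flat 1 (k * u)\<close> tends to the indicator of \<open>u > 0\<close> as \<open>k\<close> grows.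
\<close>
definition bump :: "real \<Rightarrow> real \<Rightarrow> nat \<Rightarrow> real \<Rightarrow> real" where
  "bump a b k x = flat 1 (real k * x + (- real k * a)) * flat 1 (- real k * x + real k * b)"

lemma bump_flat_algebra: "bump a b k \<in> flat_algebra"
  using flat_algebra.mult[OF flat_algebra.base flat_algebra.base, of 1 "real k" "- real k * a" 1 "- real k" "real k * b"]
  by (simp add: bump_def[abs_def])

lemma flat_1_bounds: "0 \<le> flat 1 u" "flat 1 u \<le> 1"
  by (auto simp: flat_def)

lemma bump_bounds: "0 \<le> bump a b k x" "bump a b k x \<le> 1"
  using flat_1_bounds by (auto simp: bump_def intro!: mult_le_one)

lemma bump_support: "x \<notin> {a<..<b} \<Longrightarrow> bump a b k x = 0"
proof -
  assume "x \<notin> {a<..<b}"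
  then have "real k * x + (- real k * a) \<le> 0 \<or> - real k * x + real k * b \<le> 0"
    using mult_left_mono[of x a "real k"] mult_left_mono[of b x "real k"] by auto
  then show ?thesis by (auto simp: bump_def flat_def)
qed

lemma flat_1_tendsto:
  assumes "0 < u"
  shows "(\<lambda>k. flat 1 (real k * u)) \<longlonglongrightarrow> 1"
proof -
  have "(\<lambda>k. exp (- (1 / u) * inverse (real k))) \<longlonglongrightarrow> exp (- (1 / u) * 0)"
    by (intro tendsto_exp tendsto_mult tendsto_const LIMSEQ_inverse_real_of_nat[THEN filterlim_sequentially_Suc[THEN iffD1]])
  then have "(\<lambda>k. exp (- (1 / u) * inverse (real k))) \<longlonglongrightarrow> 1" by simp
  then show ?thesis
  proof (rule Lim_transform_eventually)
    show "\<forall>\<^sub>F k in sequentially. exp (- (1 / u) * inverse (real k)) = flat 1 (real k * u)"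
      using eventually_gt_at_top[of 0] by eventually_elim (use assms in \<open>simp add: flat_def divide_simps\<close>)
  qed
qed

lemma bump_tendsto: "(\<lambda>k. bump a b k x) \<longlonglongrightarrow> indicator {a<..<b} x"
proof (cases "x \<in> {a<..<b}")
  case True
  then have "(\<lambda>k. flat 1 (real k * (x - a)) * flat 1 (real k * (b - x))) \<longlonglongrightarrow> 1 * 1"
    by (intro tendsto_mult flat_1_tendsto) auto
  then show ?thesis using True by (simp add: bump_def algebra_simps)
next
  case False
  then show ?thesis by (simp add: bump_support)
qed

text \<open>Zero mean makes the primitive vanish to the right of \<open>b\<close> as it does to the
  left of \<open>a\<close>, which gives compact support. The base point \<open>-1\<close> lies to
  the left of the support, so that the points where \<open>f\<close> may be nonzero are interior to
  the interval of integration.\<close>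

lemma primitive_test_function:
  assumes f: "f \<in> flat_algebra" and ab: "0 < a" "b < T" and supp: "\<And>x. x \<notin> {a<..<b} \<Longrightarrow> f x = 0"
    and mean: "integral {0..T} f = 0" and T: "0 < T"
  defines "\<phi> \<equiv> \<lambda>t. integral {-1..t} f"
  shows "test_function T \<phi>" "deriv \<phi> = f"
proof -
  have int: "f integrable_on {c..d}" for c d
    by (intro integrable_continuous_real flat_algebra_continuous f)
  have low: "\<phi> t = 0" if "t \<le> a" for t
    unfolding \<phi>_def using that supp by (intro integral_unique has_integral_is_0) auto
  have high: "\<phi> t = 0" if "b \<le> t" for t
  proof (cases "t \<le> a")
    case True then show ?thesis by (rule low)
  next
    case False
    then have "\<phi> t = integral {-1..0} f + integral {0..t} f"
      unfolding \<phi>_def using ab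
      by (intro Henstock_Kurzweil_Integration.integral_combine[symmetric] int) auto
    also have "integral {-1..0} f = 0"
      using low[of 0] ab by (simp add: \<phi>_def)
    also have "integral {0..t} f = integral {0..T} f"
    proof (cases "t \<le> T")
      case True
      have "integral {0..T} f = integral {0..t} f + integral {t..T} f"
        using True False ab by (intro Henstock_Kurzweil_Integration.integral_combine[symmetric] int) auto
      moreover have "integral {t..T} f = 0"
        using that supp by (intro integral_unique has_integral_is_0) auto
      ultimately show ?thesis by simp
    next
      case False
      have "integral {0..t} f = integral {0..T} f + integral {T..t} f"
        using False T by (intro Henstock_Kurzweil_Integration.integral_combine[symmetric] int) auto
      moreover have "integral {T..t} f = 0"
        using ab supp by (intro integral_unique has_integral_is_0) auto
      ultimately show ?thesis by simp
    qed
    finally show ?thesis using mean by simp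
  qed
  have deriv: "(\<phi> has_real_derivative f t) (at t)" for t
  proof (cases "t < a")
    case True
    have "((\<lambda>_. 0) has_real_derivative 0) (at t)" by simp
    then have "(\<phi> has_real_derivative 0) (at t)"
      by (rule has_field_derivative_transform_within_open[of _ _ _ "{..<a}"]) (use True low in auto)
    then show ?thesis using True supp by simp
  next
    case False
    have "(\<phi> has_real_derivative f t) (at t within {-1..t+1})"
      unfolding \<phi>_def using False ab
      by (intro integral_has_real_derivative flat_algebra_continuous f) auto
    moreover have "at t within {-1..t+1} = at t"
      using False ab by (intro at_within_interior) auto
    ultimately show ?thesis by simp
  qed
  then show eq: "deriv \<phi> = f" by (intro ext DERIV_imp_deriv)
  show "test_function T \<phi>"
    unfolding test_function_def
  proof (intro conjI allI)
    fix k t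
    show "((deriv ^^ k) \<phi>) field_differentiable (at t)"
    proof (cases k)
      case 0 then show ?thesis using deriv by (auto simp: field_differentiable_def)
    next
      case (Suc m)
      then have "(deriv ^^ k) \<phi> = (deriv ^^ m) f"
        using eq by (simp add: funpow_swap1)
      then show ?thesis using flat_algebra_smooth[OF f] by simp
    qed
  next
    show "\<exists>K. compact K \<and> K \<subseteq> {0<..<T} \<and> (\<forall>t. t \<notin> K \<longrightarrow> \<phi> t = 0)"
      using ab low high by (intro exI[of _ "{a..b}"]) force
  qed
qed

section \<open>Weak derivatives on an interval\<close>

text \<open>Half-lines determine a finite Borel measure: the positive and negative parts of a Borel
  version have equal integrals over every \<open>{x<..}\<close>, hence equal densities. Only
  intervals compactly inside \<open>(0, T)\<close> are assumed, since these are the ones that test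
  functions reach.\<close>

lemma AE_zero_of_interval_integrals:
  fixes f :: "real \<Rightarrow> real"
  assumes T: "0 < T" and f: "integrable (lebesgue_on {0..T}) f"
    and zero: "\<And>a b. 0 < a \<Longrightarrow> a < b \<Longrightarrow> b < T \<Longrightarrow>
      (LINT s|lebesgue_on {0..T}. indicator {a<..<b} s * f s) = 0"
  shows "AE s in lebesgue_on {0..T}. f s = 0"
proof -
  define F where "F s = indicator {0..T} s * f s" for s
  have F: "integrable lebesgue F"
    using f by (subst (asm) integrable_restrict_space) (auto simp: F_def[abs_def])
  \<comment> \<open>The comparison of measures below takes place on Borel sets, so \<open>F\<close>
    is replaced by a Borel function.\<close>
  then obtain h where h[measurable]: "h \<in> borel_measurable borel" and Fh: "AE s in lborel. F s = h s"
    using completion_ex_borel_measurable_real[of F lborel] by auto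
  have Fh': "AE s in lebesgue. F s = h s" using Fh by (rule AE_completion)
  have F': "F \<in> borel_measurable lebesgue" using F by auto
  have "h \<in> borel_measurable lborel" by simp
  then have h': "h \<in> borel_measurable lebesgue" by (rule measurable_completion)
  have "integrable lebesgue h"
    using integrable_cong_AE_imp[OF F h'] Fh' by (auto simp: eq_commute)
  then have hint: "integrable lborel h"
    using integrable_completion[of h lborel] by simp
  have interval: "(LINT s|lborel. indicator {a<..<b} s * h s) = 0" if "0 < a" "a < b" "b < T" for a b
  proof -
    have "(LINT s|lborel. indicator {a<..<b} s * h s) = (LINT s|lebesgue. indicator {a<..<b} s * h s)"
      by (rule integral_completion[symmetric]) measurable
    also have "\<dots> = (LINT s|lebesgue. indicator {0..T} s *\<^sub>R (indicator {a<..<b} s * f s))"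
    proof (rule integral_cong_AE)
      have "(\<lambda>s. indicator {a<..<b} s * h s) \<in> borel_measurable lborel" by measurable
      then show "(\<lambda>s. indicator {a<..<b} s * h s) \<in> borel_measurable lebesgue"
        by (rule measurable_completion)
      have "(\<lambda>s. indicator {a<..<b} s * F s) \<in> borel_measurable lebesgue"
        by (intro borel_measurable_times F' measurable_completion) simp
      then show "(\<lambda>s. indicator {0..T} s *\<^sub>R (indicator {a<..<b} s * f s)) \<in> borel_measurable lebesgue"
        by (simp add: F_def mult.left_commute)
      show "AE s in lebesgue. indicator {a<..<b} s * h s = indicator {0..T} s *\<^sub>R (indicator {a<..<b} s * f s)"
        using Fh' by eventually_elim (simp add: F_def mult.left_commute)
    qed
    also have "\<dots> = (LINT s|lebesgue_on {0..T}. indicator {a<..<b} s * f s)"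
      by (rule integral_restrict_space[symmetric]) simp
    finally show ?thesis using zero that by simp
  qed
  have halfline: "(LINT s|lborel. indicator {x<..} s * h s) = 0" for x
  proof -
    \<comment> \<open>These intervals exhaust the part of \<open>{x<..}\<close> inside
      \<open>(0, T)\<close>. The margin \<open>T / (n + 1)\<close> keeps both endpoints strictly
      inside, where the hypothesis applies.\<close>
    let ?a = "\<lambda>n::nat. max x (T * inverse (real (Suc n)))" and ?b = "\<lambda>n::nat. T - T * inverse (real (Suc n))"
    have inv: "(\<lambda>n. T * inverse (real (Suc n))) \<longlonglongrightarrow> 0"
      using tendsto_mult[OF tendsto_const[of T] LIMSEQ_inverse_real_of_nat] by simp
    have "(\<lambda>n. LINT s|lborel. indicator {?a n<..<?b n} s * h s) \<longlonglongrightarrow> (LINT s|lborel. indicator {x<..} s * h s)"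
    proof (rule integral_dominated_convergence[where w = "\<lambda>s. \<bar>h s\<bar>"])
      show "integrable lborel (\<lambda>s. \<bar>h s\<bar>)" using hint by simp
      show "AE s in lborel. norm (indicator {?a n<..<?b n} s * h s) \<le> \<bar>h s\<bar>" for n
        by (auto simp: indicator_def)
      have "AE s in lborel. s \<noteq> 0" "AE s in lborel. s \<noteq> T" by (rule AE_lborel_singleton)+
      then show "AE s in lborel. (\<lambda>n. indicator {?a n<..<?b n} s * h s) \<longlonglongrightarrow> indicator {x<..} s * h s"
        using Fh
      proof eventually_elim
        case (elim s)
        show ?case
        proof (cases "s \<in> {0<..<T} \<and> x < s")
          case True
          have "\<forall>\<^sub>F n in sequentially. T * inverse (real (Suc n)) < min s (T - s)"
            using order_tendstoD(2)[OF inv, of "min s (T - s)"] True by simp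
          then have "\<forall>\<^sub>F n in sequentially. indicator {x<..} s * h s = indicator {?a n<..<?b n} s * h s"
            by eventually_elim (use True in \<open>auto simp: indicator_def\<close>)
          then show ?thesis by (rule Lim_transform_eventually[OF tendsto_const])
        next
          case False
          have "T * inverse (real (Suc n)) > 0" for n using T by simp
          then have "indicator {?a n<..<?b n} s * h s = 0" for n
            using False by (auto simp: indicator_def intro: less_trans)
          moreover have "indicator {x<..} s * h s = 0"
            using False elim by (auto simp: F_def indicator_def)
          ultimately show ?thesis by (simp only: tendsto_const)
        qed
      qed
    qed measurable
    moreover have "(LINT s|lborel. indicator {?a n<..<?b n} s * h s) = 0" for n
    proof (cases "?a n < ?b n")
      case True
      moreover have "0 < T * inverse (real (Suc n))" using T by simp
      then have "0 < ?a n" "?b n < T" by (auto simp del: of_nat_Suc intro: less_max_iff_disj[THEN iffD2])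
      ultimately show ?thesis by (intro interval)
    next
      case False
      then have "{?a n<..<?b n} = {}" by auto
      then show ?thesis by simp
    qed
    ultimately show ?thesis using LIMSEQ_unique[OF tendsto_const] by fastforce
  qed
  define hp hn where "hp s = max 0 (h s)" and "hn s = max 0 (- h s)" for s
  have [measurable]: "hp \<in> borel_measurable borel" "hn \<in> borel_measurable borel"
    by (auto simp: hp_def[abs_def] hn_def[abs_def])
  have hpi: "integrable lborel hp" "integrable lborel hn"
    using hint by (auto simp: hp_def[abs_def] hn_def[abs_def])
  have ii: "integrable lborel (\<lambda>s. indicator {x<..} s * hp s)" "integrable lborel (\<lambda>s. indicator {x<..} s * hn s)" for x
    using integrable_real_mult_indicator[OF _ hpi(1), of "{x<..}"] integrable_real_mult_indicator[OF _ hpi(2), of "{x<..}"]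
    by (auto simp: mult.commute)
  have em: "emeasure (density lborel (\<lambda>s. ennreal (hp s))) {x<..} = ennreal (LINT s|lborel. indicator {x<..} s * hp s)"
    "emeasure (density lborel (\<lambda>s. ennreal (hn s))) {x<..} = ennreal (LINT s|lborel. indicator {x<..} s * hn s)" for x
    using ii[of x] by (auto simp: emeasure_density nn_integral_eq_integral[symmetric] hp_def hn_def
      intro!: nn_integral_cong split: split_indicator)
  \<comment> \<open>The vanishing of the half-line integrals of \<open>h = hp - hn\<close> says that
    both densities give each half-line the same measure.\<close>
  have "density lborel (\<lambda>s. ennreal (hp s)) = density lborel (\<lambda>s. ennreal (hn s))"
  proof (rule measure_eqI_lessThan)
    fix x
    have "(LINT s|lborel. indicator {x<..} s * hp s) - (LINT s|lborel. indicator {x<..} s * hn s)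
        = (LINT s|lborel. indicator {x<..} s * hp s - indicator {x<..} s * hn s)"
      using ii by simp
    also have "\<dots> = (LINT s|lborel. indicator {x<..} s * h s)"
      by (intro Bochner_Integration.integral_cong) (auto simp: hp_def hn_def indicator_def)
    finally show "emeasure (density lborel (\<lambda>s. ennreal (hp s))) {x<..} = emeasure (density lborel (\<lambda>s. ennreal (hn s))) {x<..}"
      using halfline em by simp
  qed (use em in auto)
  then have "AE s in lborel. ennreal (hp s) = ennreal (hn s)"
    by (subst (asm) sigma_finite_measure.density_unique_iff[OF sigma_finite_lborel]) auto
  then have "AE s in lborel. h s = 0"
    by eventually_elim (auto simp: hp_def hn_def max_def split: if_splits)
  with Fh have "AE s in lborel. F s = 0" by eventually_elim auto
  then have "AE s in lebesgue. F s = 0" by (rule AE_completion)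
  then show ?thesis
    by (simp add: AE_restrict_space_iff F_def) (auto elim: eventually_mono)
qed

lemma borel_measurable_id_interval: "(\<lambda>x. x) \<in> borel_measurable (lebesgue_on {0..T::real})"
  by (simp add: measurable_restrict_space1 measurable_completion)

lemma borel_measurable_flat_algebra:
  assumes "f \<in> flat_algebra"
  shows "f \<in> borel_measurable (lebesgue_on {0..T})"
  using measurable_compose[OF borel_measurable_id_interval
      borel_measurable_continuous_onI[OF flat_algebra_continuous[OF assms]]] by simp

lemma integral_bump:
  assumes h: "integrable (lebesgue_on {0..T}) h"
  shows "integrable (lebesgue_on {0..T}) (\<lambda>t. bump a b k t * h t)"
    and "(\<lambda>k. LINT t|lebesgue_on {0..T}. bump a b k t * h t) \<longlonglongrightarrow> (LINT t|lebesgue_on {0..T}. indicator {a<..<b} t * h t)"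
proof -
  let ?M = "lebesgue_on {0..T}"
  note borel_measurable_id_interval[measurable]
  have [measurable]: "bump a b k \<in> borel_measurable ?M" "h \<in> borel_measurable ?M" for k
    using h by (auto intro: borel_measurable_flat_algebra bump_flat_algebra)
  have le: "\<bar>bump a b k t\<bar> \<le> 1" for k t using bump_bounds[of a b k t] by simp
  show "integrable ?M (\<lambda>t. bump a b k t * h t)" by (rule integrable_mult_bounded(1)[OF _ h le]) measurable
  show "(\<lambda>k. LINT t|?M. bump a b k t * h t) \<longlonglongrightarrow> (LINT t|?M. indicator {a<..<b} t * h t)"
  proof (rule integral_dominated_convergence[where w = "\<lambda>t. \<bar>h t\<bar>"])
    show "AE t in ?M. (\<lambda>k. bump a b k t * h t) \<longlonglongrightarrow> indicator {a<..<b} t * h t"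
      by (intro AE_I2 tendsto_mult bump_tendsto tendsto_const)
    show "AE t in ?M. norm (bump a b k t * h t) \<le> \<bar>h t\<bar>" for k
      using mult_right_mono[OF le abs_ge_zero] by (simp add: abs_mult)
  qed (use h in auto)
qed

text \<open>
  With \<open>H s = \<integral>\<^sub>s\<^sup>T g\<close>, Fubini's theorem turns the weak derivative identity into \<open>\<integral> \<psi> (w + H) = 0\<close> for all smooth
  \<open>\<psi>\<close> of mean zero. Hence \<open>w + H\<close> is the constant \<open>\<integral> \<rho> (w + H)\<close> for a fixed bump \<open>\<rho>\<close> of integral \<open>1\<close>, and
  \<open>R\<close> is the primitive of \<open>\<rho>\<close>.
\<close>
theorem weak_derivative_representation:
  assumes T: "0 < T"
  obtains \<rho> R :: "real \<Rightarrow> real" and B where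
    "\<rho> \<in> borel_measurable (lebesgue_on {0..T})" "R \<in> borel_measurable (lebesgue_on {0..T})"
    "\<And>t. \<bar>\<rho> t\<bar> \<le> B" "\<And>t. t \<in> {0..T} \<Longrightarrow> \<bar>R t\<bar> \<le> 1"
    "\<And>w g. integrable (lebesgue_on {0..T}) w \<Longrightarrow> integrable (lebesgue_on {0..T}) g \<Longrightarrow>
      (\<And>\<phi>. test_function T \<phi> \<Longrightarrow> (LINT t|lebesgue_on {0..T}. deriv \<phi> t * w t) = - (LINT t|lebesgue_on {0..T}. \<phi> t * g t)) \<Longrightarrow>
      AE s in lebesgue_on {0..T}. w s = (LINT t|lebesgue_on {0..T}. \<rho> t * w t)
         + (LINT t|lebesgue_on {0..T}. (R t - (if s \<le> t then 1 else 0)) * g t)"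
proof -
  let ?M = "lebesgue_on {0..T}"
  interpret finite_measure ?M by (rule finite_measure_lebesgue_on) simp
  interpret pair_sigma_finite ?M ?M ..
  note borel_measurable_id_interval[measurable]
  \<comment> \<open>Writing the primitive with the kernel of \<open>s \<le> t\<close> over the fixed
    interval prepares it for Fubini's theorem.\<close>
  have prim: "integral {-1..t} f = (LINT s|?M. (if s \<le> t then 1 else 0) * f s)"
    if t: "t \<in> {0..T}" and f: "f \<in> flat_algebra" and supp: "\<And>s. s \<le> 0 \<Longrightarrow> f s = 0" for t f
  proof -
    have int: "f integrable_on {c..d}" for c d
      by (intro integrable_continuous_real flat_algebra_continuous f)
    have "integral {-1..t} f = integral {-1..0} f + integral {0..t} f"
      using t by (intro Henstock_Kurzweil_Integration.integral_combine[symmetric] int) auto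
    also have "integral {-1..0} f = 0"
      using supp by (intro integral_unique has_integral_is_0) auto
    also have "integral {0..t} f = (LINT s|lebesgue_on {0..t}. f s)"
      by (intro lebesgue_integral_eq_integral[symmetric] continuous_imp_integrable_real flat_algebra_continuous f) auto
    also have "\<dots> = (LINT s|lebesgue. indicator {0..t} s *\<^sub>R f s)"
      by (rule integral_restrict_space) simp
    also have "\<dots> = (LINT s|lebesgue. indicator {0..T} s *\<^sub>R ((if s \<le> t then 1 else 0) * f s))"
      using t by (intro Bochner_Integration.integral_cong) (auto simp: indicator_def)
    also have "\<dots> = (LINT s|?M. (if s \<le> t then 1 else 0) * f s)"
      by (rule integral_restrict_space[symmetric]) simp
    finally show ?thesis by simp
  qed
  define m where "m a b k = (LINT s|?M. bump a b k s)" for a b k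
  have ind_integral: "(LINT s|?M. indicator {a<..<b} s) = b - a" if "0 < a" "a < b" "b < T" for a b
  proof -
    have sub: "{a<..<b} \<inter> {0..T} = {a<..<b}" using that by auto
    then have "(LINT s|?M. indicator {a<..<b} s) = measure ?M {a<..<b}"
      by (simp add: space_restrict_space)
    also have "\<dots> = b - a"
      using that by (subst measure_restrict_space) auto
    finally show ?thesis .
  qed
  have m_lim: "m a b \<longlonglongrightarrow> b - a" if "0 < a" "a < b" "b < T" for a b
  proof -
    have "(\<lambda>k. LINT s|?M. bump a b k s) \<longlonglongrightarrow> (LINT s|?M. indicator {a<..<b} s)"
      using integral_bump(2)[of T "\<lambda>_. 1" a b] by simp
    then show ?thesis by (simp only: m_def[abs_def] ind_integral[OF that])
  qed
  \<comment> \<open>The integrals of the bumps on the middle third tend to \<open>T / 3\<close>, so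
    some bump has positive integral and can be normalised.\<close>
  obtain k0 where k0: "m (T/3) (2*T/3) k0 > 0"
    using order_tendstoD(1)[OF m_lim[of "T/3" "2*T/3"], of 0] T
    by (auto simp: eventually_sequentially)
  let ?c = "m (T/3) (2*T/3) k0"
  define \<rho> where "\<rho> t = (1 / ?c) * bump (T/3) (2*T/3) k0 t" for t
  have \<rho>: "\<rho> \<in> flat_algebra"
    unfolding \<rho>_def[abs_def] by (intro flat_algebra_cmult bump_flat_algebra)
  have \<rho>_bounds: "0 \<le> \<rho> t" "\<rho> t \<le> 1 / ?c" for t
    using k0 bump_bounds[of "T/3" "2*T/3" k0 t] by (auto simp: \<rho>_def divide_simps)
  have \<rho>_supp: "\<rho> t = 0" if "t \<notin> {T/3<..<2*T/3}" for t
    using bump_support[OF that] by (simp add: \<rho>_def)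
  have \<rho>M[measurable]: "\<rho> \<in> borel_measurable ?M" by (intro borel_measurable_flat_algebra \<rho>)
  have \<rho>_int: "integrable ?M \<rho>"
    using \<rho>_bounds by (intro integrable_const_bound[of _ "1/?c"]) (auto intro!: AE_I2)
  have \<rho>_one: "(LINT t|?M. \<rho> t) = 1"
    using k0 by (simp add: \<rho>_def m_def)
  define R where "R t = (LINT s|?M. (if s \<le> t then 1 else 0) * \<rho> s)" for t
  have RM[measurable]: "R \<in> borel_measurable ?M"
    unfolding R_def[abs_def] by measurable
  have R_bound: "\<bar>R t\<bar> \<le> 1" for t
    using integrable_mult_bounded(2)[OF _ \<rho>_int, of "\<lambda>s. if s \<le> t then 1 else 0" 1] \<rho>_bounds(1) \<rho>_one
    by (simp add: R_def)
  show thesis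
  proof (rule that[of \<rho> R "1 / ?c"])
    show "\<rho> \<in> borel_measurable ?M" "R \<in> borel_measurable ?M" by (rule \<rho>M, rule RM)
    show "\<bar>\<rho> t\<bar> \<le> 1 / ?c" for t using \<rho>_bounds[of t] by simp
    show "\<bar>R t\<bar> \<le> 1" for t by (rule R_bound)
    fix w g :: "real \<Rightarrow> real"
    assume w: "integrable ?M w" and g: "integrable ?M g"
      and weak: "\<And>\<phi>. test_function T \<phi> \<Longrightarrow> (LINT t|?M. deriv \<phi> t * w t) = - (LINT t|?M. \<phi> t * g t)"
    have [measurable]: "w \<in> borel_measurable ?M" "g \<in> borel_measurable ?M" using w g by auto
    let ?\<chi> = "\<lambda>s t :: real. if s \<le> t then 1 else 0 :: real"
    define H where "H s = (LINT t|?M. ?\<chi> s t * g t)" for s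
    have \<chi>g: "integrable ?M (\<lambda>t. ?\<chi> s t * g t)" "\<bar>H s\<bar> \<le> (LINT t|?M. \<bar>g t\<bar>)" for s
      using integrable_mult_bounded[OF _ g, of "?\<chi> s" 1] by (auto simp: H_def)
    have HM[measurable]: "H \<in> borel_measurable ?M" unfolding H_def[abs_def] by measurable
    have H: "integrable ?M H" using \<chi>g(2) by (intro integrable_const_bound) (auto intro!: AE_I2)
    \<comment> \<open>Exchanging the integrals trades the tail integral of \<open>g\<close> for the
      primitive of \<open>f\<close>. Boundedness of \<open>f\<close> is enough for integrability on
      the product.\<close>
    have swap: "(LINT s|?M. f s * H s) = (LINT t|?M. (LINT s|?M. ?\<chi> s t * f s) * g t)"
      if f[measurable]: "f \<in> borel_measurable ?M" and fB: "\<And>s. \<bar>f s\<bar> \<le> B" for f B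
    proof -
      have bound: "\<bar>f s * (?\<chi> s t * g t)\<bar> \<le> B * \<bar>g t\<bar>" for s t
        unfolding abs_mult using fB[of s] by (intro mult_mono) (auto intro: order.trans[OF abs_ge_zero])
      have int: "integrable ?M (\<lambda>t. \<bar>f s * (?\<chi> s t * g t)\<bar>)" for s
        using \<chi>g(1)[of s] by (intro integrable_abs integrable_mult_right)
      have "(LINT s|?M. f s * H s) = (LINT s|?M. LINT t|?M. f s * (?\<chi> s t * g t))"
        unfolding H_def by (simp only: integral_mult_right_zero)
      also have "\<dots> = (LINT t|?M. LINT s|?M. f s * (?\<chi> s t * g t))"
      proof (rule Fubini_integral[symmetric], rule Fubini_integrable)
        show "(\<lambda>(s, t). f s * (?\<chi> s t * g t)) \<in> borel_measurable (?M \<Otimes>\<^sub>M ?M)" by measurable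
        show "AE s in ?M. integrable ?M (\<lambda>t. case (s, t) of (s, t) \<Rightarrow> f s * (?\<chi> s t * g t))"
          using \<chi>g(1) by simp
        have "(LINT t|?M. \<bar>f s * (?\<chi> s t * g t)\<bar>) \<le> (LINT t|?M. B * \<bar>g t\<bar>)" for s
          using g by (intro integral_mono int bound) simp
        then show "integrable ?M (\<lambda>s. LINT t|?M. norm (case (s, t) of (s, t) \<Rightarrow> f s * (?\<chi> s t * g t)))"
          unfolding prod.case real_norm_def by (intro integrable_const_bound[of _ "LINT t|?M. B * \<bar>g t\<bar>"] AE_I2) simp_all
      qed
      also have "\<dots> = (LINT t|?M. (LINT s|?M. ?\<chi> s t * f s) * g t)"
        unfolding mult.assoc[symmetric] mult.commute[of "f _"] integral_mult_left_zero ..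
      finally show ?thesis .
    qed
    define D where "D s = w s + H s" for s
    have D: "integrable ?M D" unfolding D_def using w H by simp
    define \<kappa> where "\<kappa> = (LINT t|?M. \<rho> t * D t)"
    have \<rho>i: "integrable ?M (\<lambda>t. \<rho> t * f t)" if "integrable ?M f" for f
      using \<rho>_bounds by (intro integrable_mult_bounded(1)[OF \<rho>M that, of "1 / ?c"]) simp
    have D\<kappa>: "AE s in ?M. D s - \<kappa> = 0"
    proof (rule AE_zero_of_interval_integrals[OF T])
      show "integrable ?M (\<lambda>s. D s - \<kappa>)" using D by simp
      fix a b assume ab: "0 < a" "a < b" "b < T"
      have "(LINT t|?M. bump a b k t * D t) = m a b k * \<kappa>" for k
      proof -
        \<comment> \<open>The bump is corrected by the multiple of \<open>\<rho>\<close> with the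
          same integral. The mean becomes zero, so the primitive is an admissible test
          function.\<close>
        define \<psi> where "\<psi> x = bump a b k x + (- m a b k) * \<rho> x" for x
        define \<phi> where "\<phi> t = integral {-1..t} \<psi>" for t
        have \<psi>: "\<psi> \<in> flat_algebra"
          unfolding \<psi>_def[abs_def] by (intro flat_algebra.add flat_algebra_cmult bump_flat_algebra \<rho>)
        have \<psi>_supp: "\<psi> x = 0" if "x \<notin> {min a (T/3)<..<max b (2*T/3)}" for x
        proof -
          from that have "x \<notin> {a<..<b}" "x \<notin> {T/3<..<2*T/3}" by auto
          then show ?thesis by (simp add: \<psi>_def bump_support \<rho>_supp)
        qed
        have bump_int: "integrable ?M (bump a b k)" using integral_bump(1)[of T "\<lambda>_. 1"] by simp
        have "integral {0..T} \<psi> = (LINT s|?M. \<psi> s)"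
          by (intro lebesgue_integral_eq_integral[symmetric] continuous_imp_integrable_real flat_algebra_continuous \<psi>) auto
        also have "\<dots> = 0" using bump_int \<rho>_int \<rho>_one by (simp add: \<psi>_def m_def)
        finally have mean: "integral {0..T} \<psi> = 0" .
        have supp: "0 < min a (T/3)" "max b (2*T/3) < T" using ab T by auto
        note test = primitive_test_function[OF \<psi> supp \<psi>_supp mean T, folded \<phi>_def]
        have \<psi>_bound: "\<bar>\<psi> x\<bar> \<le> 1 + \<bar>m a b k\<bar> * (1 / ?c)" for x
        proof -
          have "\<bar>\<psi> x\<bar> \<le> \<bar>bump a b k x\<bar> + \<bar>m a b k\<bar> * \<bar>\<rho> x\<bar>"
            unfolding \<psi>_def by (rule order.trans[OF abs_triangle_ineq]) (simp add: abs_mult)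
          also have "\<dots> \<le> 1 + \<bar>m a b k\<bar> * (1 / ?c)"
            using bump_bounds[of a b k x] \<rho>_bounds[of x] by (intro add_mono mult_left_mono) simp_all
          finally show ?thesis .
        qed
        have "(LINT t|?M. \<psi> t * w t) = - (LINT t|?M. \<phi> t * g t)"
          using weak[OF test(1)] test(2) by simp
        also have "(LINT t|?M. \<phi> t * g t) = (LINT t|?M. (LINT s|?M. ?\<chi> s t * \<psi> s) * g t)"
        proof (rule Bochner_Integration.integral_cong[OF refl])
          fix t assume "t \<in> space ?M"
          then have "\<phi> t = (LINT s|?M. ?\<chi> s t * \<psi> s)"
            unfolding \<phi>_def using ab T \<psi>_supp by (intro prim \<psi>) (auto simp: space_restrict_space)
          then show "\<phi> t * g t = (LINT s|?M. ?\<chi> s t * \<psi> s) * g t" by simp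
        qed
        also have "\<dots> = (LINT t|?M. \<psi> t * H t)"
          by (rule swap[OF borel_measurable_flat_algebra[OF \<psi>] \<psi>_bound, symmetric])
        finally have eq: "(LINT t|?M. \<psi> t * w t) = - (LINT t|?M. \<psi> t * H t)" .
        have split: "integrable ?M (\<lambda>t. \<psi> t * f t)"
          "(LINT t|?M. \<psi> t * f t) = (LINT t|?M. bump a b k t * f t) - m a b k * (LINT t|?M. \<rho> t * f t)"
          if f: "integrable ?M f" for f
        proof -
          have "(\<lambda>t. \<psi> t * f t) = (\<lambda>t. bump a b k t * f t - m a b k * (\<rho> t * f t))"
            by (simp add: \<psi>_def fun_eq_iff algebra_simps)
          then show "integrable ?M (\<lambda>t. \<psi> t * f t)"
            "(LINT t|?M. \<psi> t * f t) = (LINT t|?M. bump a b k t * f t) - m a b k * (LINT t|?M. \<rho> t * f t)"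
            using integral_bump(1)[OF f] \<rho>i[OF f] by simp_all
        qed
        have "(LINT t|?M. \<psi> t * D t) = 0"
          unfolding D_def distrib_left using split(1)[OF w] split(1)[OF H] eq by simp
        then show ?thesis using split(2)[OF D] by (simp add: \<kappa>_def)
      qed
      then have "(\<lambda>k. m a b k * \<kappa>) \<longlonglongrightarrow> (LINT t|?M. indicator {a<..<b} t * D t)"
        using integral_bump(2)[OF D, of a b] by simp
      then have "(LINT t|?M. indicator {a<..<b} t * D t) = (b - a) * \<kappa>"
        by (rule LIMSEQ_unique) (intro tendsto_mult m_lim ab tendsto_const)
      moreover have i: "integrable ?M (\<lambda>t. indicator {a<..<b} t * f t)" if "integrable ?M f" for f :: "real \<Rightarrow> real"
        by (rule integrable_mult_bounded(1)[OF _ that, of _ 1]) (auto simp: indicator_def)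
      have "(LINT t|?M. indicator {a<..<b} t * (D t - \<kappa>))
          = (LINT t|?M. indicator {a<..<b} t * D t) - (LINT t|?M. indicator {a<..<b} t) * \<kappa>"
        unfolding right_diff_distrib integral_mult_left_zero[symmetric]
        by (intro Bochner_Integration.integral_diff i D integrable_const)
      ultimately show "(LINT t|?M. indicator {a<..<b} t * (D t - \<kappa>)) = 0"
        by (simp only: ind_integral[OF ab])
    qed
    \<comment> \<open>By \<open>swap\<close> with \<open>\<rho>\<close>, the contribution of
      \<open>H\<close> to the constant \<open>\<kappa>\<close> is the integral of
      \<open>R t * g t\<close>. It merges with \<open>H s\<close> into one bounded kernel.\<close>
    have rep: "\<kappa> - H s = (LINT t|?M. \<rho> t * w t) + (LINT t|?M. (R t - ?\<chi> s t) * g t)" for s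
    proof -
      have "integrable ?M (\<lambda>t. R t * g t)"
        using R_bound by (intro integrable_mult_bounded(1)[OF RM g])
      then have "(LINT t|?M. (R t - ?\<chi> s t) * g t) = (LINT t|?M. R t * g t) - H s"
        unfolding left_diff_distrib H_def using \<chi>g(1) by (rule Bochner_Integration.integral_diff)
      moreover have "(LINT t|?M. R t * g t) = (LINT t|?M. \<rho> t * H t)"
        unfolding R_def using \<rho>_bounds by (intro swap[OF \<rho>M, of "1 / ?c", symmetric]) simp
      moreover have "\<kappa> = (LINT t|?M. \<rho> t * w t) + (LINT t|?M. \<rho> t * H t)"
        unfolding \<kappa>_def D_def distrib_left by (intro Bochner_Integration.integral_add \<rho>i w H)
      ultimately show ?thesis by simp
    qed
    show "AE s in ?M. w s = (LINT t|?M. \<rho> t * w t) + (LINT t|?M. (R t - ?\<chi> s t) * g t)"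
      using D\<kappa> unfolding rep[symmetric] by eventually_elim (simp add: D_def)
  qed
qed

section \<open>The dual of a Lebesgue--Bochner space\<close>

text \<open>Second countability makes each open set a countable union of balls, and preimages of
  balls are sublevel sets of the distances.\<close>

lemma borel_measurable_if_norm_distances:
  fixes x :: "'a \<Rightarrow> 'b::{real_normed_vector, second_countable_topology}"
  assumes "\<And>a. (\<lambda>t. norm (x t - a)) \<in> borel_measurable M"
  shows "x \<in> borel_measurable M"
proof (rule borel_measurableI)
  fix U :: "'b set" assume U: "open U"
  define \<F> where "\<F> = {ball u e | u e. ball u e \<subseteq> U}"
  obtain \<F>' where F': "\<F>' \<subseteq> \<F>" "countable \<F>'" "\<Union>\<F>' = \<Union>\<F>"
    using Lindelof[of \<F>] by (auto simp: \<F>_def)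
  have "\<Union>\<F> = U"
  proof
    show "\<Union>\<F> \<subseteq> U" by (auto simp: \<F>_def)
    show "U \<subseteq> \<Union>\<F>"
    proof
      fix u assume "u \<in> U"
      with U obtain e where "e > 0" "ball u e \<subseteq> U" by (meson open_contains_ball)
      then show "u \<in> \<Union>\<F>" by (auto simp: \<F>_def intro!: exI[of _ "ball u e"])
    qed
  qed
  with F'(3) have "U = \<Union>\<F>'" by simp
  then have "x -` U \<inter> space M = (\<Union>B\<in>\<F>'. x -` B \<inter> space M)" by auto
  also have "\<dots> \<in> sets M"
  proof (rule sets.countable_UN''[OF F'(2)])
    fix B assume "B \<in> \<F>'"
    then obtain u e where B: "B = ball u e" using F'(1) by (auto simp: \<F>_def)
    have [measurable]: "(\<lambda>t. norm (x t - u)) \<in> borel_measurable M" by (rule assms)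
    have "x -` B \<inter> space M = {t \<in> space M. norm (x t - u) < e}"
      by (auto simp: B dist_norm norm_minus_commute)
    also have "\<dots> \<in> sets M" by measurable
    finally show "x -` B \<inter> space M \<in> sets M" .
  qed
  finally show "x -` U \<inter> space M \<in> sets M" .
qed

text \<open>A norming functional detects the norm, and the inequality is a closed condition on the
  functional, so it extends from a dense sequence. The factor \<open>norm (\<xi> k)\<close> spares
  any normalisation of that sequence.\<close>

lemma norm_le_iff_dense_functionals:
  fixes \<xi> :: "nat \<Rightarrow> 'b::real_normed_vector \<Rightarrow>\<^sub>L real"
  assumes dense: "closure (range \<xi>) = UNIV"
  shows "norm y \<le> r \<longleftrightarrow> 0 \<le> r \<and> (\<forall>k. blinfun_apply (\<xi> k) y \<le> r * norm (\<xi> k))"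
proof
  assume le: "norm y \<le> r"
  have "blinfun_apply (\<xi> k) y \<le> r * norm (\<xi> k)" for k
  proof -
    have "blinfun_apply (\<xi> k) y \<le> norm (\<xi> k) * norm y" using norm_blinfun[of "\<xi> k" y] by simp
    also have "\<dots> \<le> norm (\<xi> k) * r" using le by (intro mult_left_mono) auto
    finally show ?thesis by (simp add: mult.commute)
  qed
  then show "0 \<le> r \<and> (\<forall>k. blinfun_apply (\<xi> k) y \<le> r * norm (\<xi> k))"
    using le order.trans[OF norm_ge_zero[of y]] by blast
next
  assume r: "0 \<le> r \<and> (\<forall>k. blinfun_apply (\<xi> k) y \<le> r * norm (\<xi> k))"
  obtain \<eta> :: "'b \<Rightarrow>\<^sub>L real" where \<eta>: "norm \<eta> \<le> 1" "blinfun_apply \<eta> y = norm y"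
    by (rule exists_norming_functional)
  have "closed {\<zeta> :: 'b \<Rightarrow>\<^sub>L real. blinfun_apply \<zeta> y \<le> r * norm \<zeta>}"
    by (intro closed_Collect_le continuous_intros)
  moreover have "range \<xi> \<subseteq> {\<zeta>. blinfun_apply \<zeta> y \<le> r * norm \<zeta>}" using r by auto
  ultimately have "closure (range \<xi>) \<subseteq> {\<zeta>. blinfun_apply \<zeta> y \<le> r * norm \<zeta>}"
    by (rule closure_minimal[rotated])
  then have "\<eta> \<in> {\<zeta>. blinfun_apply \<zeta> y \<le> r * norm \<zeta>}" using dense by blast
  then have "norm y \<le> r * norm \<eta>" using \<eta>(2) by simp
  also have "\<dots> \<le> r * 1" using r \<eta>(1) by (intro mult_left_mono) auto
  finally show "norm y \<le> r" by simp
qed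

text \<open>Closed balls are countable intersections of sets described by the functionals
  \<open>\<xi> k\<close>, so measurability against these controls all distances.\<close>

lemma pettis_measurability:
  fixes x :: "'a \<Rightarrow> 'b::{real_normed_vector, second_countable_topology}"
    and \<xi> :: "nat \<Rightarrow> 'b \<Rightarrow>\<^sub>L real"
  assumes dense: "closure (range \<xi>) = UNIV"
    and weak: "\<And>k. (\<lambda>t. blinfun_apply (\<xi> k) (x t)) \<in> borel_measurable M"
  shows "x \<in> borel_measurable M"
proof (rule borel_measurable_if_norm_distances)
  fix a
  note weak[measurable]
  show "(\<lambda>t. norm (x t - a)) \<in> borel_measurable M"
    unfolding borel_measurable_iff_le
  proof
    fix r
    have "{t \<in> space M. norm (x t - a) \<le> r} =
      {t \<in> space M. 0 \<le> r \<and> (\<forall>k. blinfun_apply (\<xi> k) (x t) - blinfun_apply (\<xi> k) a \<le> r * norm (\<xi> k))}"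
      by (simp add: norm_le_iff_dense_functionals[OF dense] blinfun.diff_right)
    also have "\<dots> \<in> sets M" by measurable
    finally show "{t \<in> space M. norm (x t - a) \<le> r} \<in> sets M" .
  qed
qed

text \<open>Lists of coefficient-index pairs form a countable type, so the range is countable;
  addition becomes concatenation, and rational scaling acts on the coefficients.\<close>

definition rat_comb :: "(nat \<Rightarrow> 'a::real_vector) \<Rightarrow> (rat \<times> nat) list \<Rightarrow> 'a" where
  "rat_comb \<xi> l = (\<Sum>(s, k)\<leftarrow>l. (of_rat s :: real) *\<^sub>R \<xi> k)"

lemma rat_comb_add: "rat_comb \<xi> l + rat_comb \<xi> l' = rat_comb \<xi> (l @ l')"
  by (simp add: rat_comb_def)

lemma rat_comb_scale: "(of_rat s :: real) *\<^sub>R rat_comb \<xi> l = rat_comb \<xi> (map (\<lambda>(s', k). (s * s', k)) l)"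
  by (induction l) (auto simp: rat_comb_def scaleR_add_right of_rat_mult)

lemma rat_comb_dense:
  fixes \<xi> :: "nat \<Rightarrow> 'a::real_normed_vector"
  assumes "closure (range \<xi>) = UNIV"
  shows "closure (range (rat_comb \<xi>)) = UNIV"
proof -
  have "\<xi> k = rat_comb \<xi> [(1, k)]" for k by (simp add: rat_comb_def)
  then have "range \<xi> \<subseteq> range (rat_comb \<xi>)" by blast
  from closure_mono[OF this] assms show ?thesis by auto
qed

text \<open>Additivity and the bound make \<open>\<rho>\<close> Lipschitz, hence extendable from the
  dense set. Additivity, homogeneity and the bound are closed conditions and persist; density of the
  rationals turns rational into real homogeneity.\<close>

lemma rational_linear_extension:
  fixes D :: "'a::real_normed_vector set" and \<rho> :: "'a \<Rightarrow> real"
  assumes dense: "closure D = UNIV"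
    and Dadd: "\<And>x y. x \<in> D \<Longrightarrow> y \<in> D \<Longrightarrow> x + y \<in> D"
    and Dscale: "\<And>(s::rat) x. x \<in> D \<Longrightarrow> (of_rat s :: real) *\<^sub>R x \<in> D"
    and add: "\<And>x y. x \<in> D \<Longrightarrow> y \<in> D \<Longrightarrow> \<rho> (x + y) = \<rho> x + \<rho> y"
    and scale: "\<And>(s::rat) x. x \<in> D \<Longrightarrow> \<rho> ((of_rat s :: real) *\<^sub>R x) = of_rat s * \<rho> x"
    and bound: "\<And>x. x \<in> D \<Longrightarrow> \<bar>\<rho> x\<bar> \<le> c * norm x" and c: "0 \<le> c"
  obtains \<Phi> :: "'a \<Rightarrow>\<^sub>L real" where "\<And>x. x \<in> D \<Longrightarrow> blinfun_apply \<Phi> x = \<rho> x" "norm \<Phi> \<le> c"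
proof -
  have "c-lipschitz_on D \<rho>"
  proof (rule lipschitz_onI[OF _ c])
    fix x y assume xy: "x \<in> D" "y \<in> D"
    have neg: "(-1) *\<^sub>R y \<in> D" "\<rho> ((-1) *\<^sub>R y) = - \<rho> y"
      using Dscale[OF xy(2), of "-1"] scale[OF xy(2), of "-1"] by auto
    have "\<rho> x - \<rho> y = \<rho> (x + (-1) *\<^sub>R y)" using add[OF xy(1) neg(1)] neg(2) by simp
    also have "\<bar>\<dots>\<bar> \<le> c * norm (x + (-1) *\<^sub>R y)" by (intro bound Dadd xy neg)
    finally show "dist (\<rho> x) (\<rho> y) \<le> c * dist x y" by (simp add: dist_norm)
  qed
  then have "uniformly_continuous_on D \<rho>" by (rule lipschitz_on_uniformly_continuous)
  then obtain g where g: "uniformly_continuous_on (closure D) g" "\<And>x. x \<in> D \<Longrightarrow> \<rho> x = g x"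
    by (rule uniformly_continuous_on_extension_on_closure) blast
  then have cont: "continuous_on UNIV g"
    using dense uniformly_continuous_imp_continuous by metis
  note [continuous_intros] = continuous_on_compose2[OF cont _ subset_UNIV]
  have gU: "{p. g (fst p + snd p) = g (fst p) + g (snd p)} = UNIV"
  proof -
    have "closed {p. g (fst p + snd p) = g (fst p) + g (snd p)}"
      by (intro closed_Collect_eq continuous_intros)
    moreover have "D \<times> D \<subseteq> {p. g (fst p + snd p) = g (fst p) + g (snd p)}"
      using add Dadd g(2) by auto
    ultimately have "closure (D \<times> D) \<subseteq> {p. g (fst p + snd p) = g (fst p) + g (snd p)}"
      by (rule closure_minimal[rotated])
    then show ?thesis using dense by (auto simp: closure_Times)
  qed
  have gadd: "g (x + y) = g x + g y" for x y
  proof -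
    have "(x, y) \<in> {p. g (fst p + snd p) = g (fst p) + g (snd p)}" unfolding gU by (rule UNIV_I)
    then show ?thesis by simp
  qed
  have gU': "{p. g (fst p *\<^sub>R snd p) = fst p * g (snd p)} = UNIV"
  proof -
    have "closed {p. g (fst p *\<^sub>R snd p) = fst p * g (snd p)}"
      by (intro closed_Collect_eq continuous_intros)
    moreover have "\<rat> \<times> D \<subseteq> {p. g (fst p *\<^sub>R snd p) = fst p * g (snd p)}"
      using scale Dscale g(2) by (auto elim!: Rats_cases)
    ultimately have "closure (\<rat> \<times> D) \<subseteq> {p. g (fst p *\<^sub>R snd p) = fst p * g (snd p)}"
      by (rule closure_minimal[rotated])
    moreover have "closure (\<rat> :: real set) = UNIV"
    proof -
      have "\<exists>y\<in>\<rat>. dist y x < e" if "0 < e" for x e :: real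
        using Rats_dense_in_real[of x "x + e"] that by (force simp: dist_real_def)
      then show ?thesis by (auto simp: closure_approachable)
    qed
    ultimately show ?thesis using dense by (auto simp: closure_Times)
  qed
  have gscale: "g (a *\<^sub>R x) = a * g x" for a x
  proof -
    have "(a, x) \<in> {p. g (fst p *\<^sub>R snd p) = fst p * g (snd p)}" unfolding gU' by (rule UNIV_I)
    then show ?thesis by simp
  qed
  have gbound: "\<bar>g x\<bar> \<le> c * norm x" for x
  proof -
    have "closed {x. \<bar>g x\<bar> \<le> c * norm x}"
      by (intro closed_Collect_le continuous_intros cont)
    moreover have "D \<subseteq> {x. \<bar>g x\<bar> \<le> c * norm x}" using bound g(2) by auto
    ultimately have "closure D \<subseteq> {x. \<bar>g x\<bar> \<le> c * norm x}"
      by (rule closure_minimal[rotated])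
    then show ?thesis using dense by auto
  qed
  have bl: "bounded_linear g"
    by (rule bounded_linear_intro[of _ c]) (use gadd gscale gbound in \<open>auto simp: mult.commute\<close>)
  show thesis
  proof (rule that[of "Blinfun g"])
    show "blinfun_apply (Blinfun g) x = \<rho> x" if "x \<in> D" for x
      using that g(2) bl by (simp add: bounded_linear_Blinfun_apply)
    show "norm (Blinfun g) \<le> c"
      using gbound c bl by (intro norm_blinfun_bound) (auto simp: bounded_linear_Blinfun_apply)
  qed
qed

lemma Lp_norm_nonneg: "0 \<le> Lp_norm T p f"
  by (simp add: Lp_norm_def)

lemma Lp_zero: "0 < p \<Longrightarrow> (\<lambda>_. 0) \<in> Lp T p"
  by (rule Lp_bounded[of _ _ _ 0]) (auto simp: bochner_measurable_const)

lemma Lp_norm_AE_zero: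
  assumes "AE t in lebesgue_on {0..T}. f t = 0"
  shows "Lp_norm T p f = 0"
proof -
  have "(LINT t|lebesgue_on {0..T}. norm (f t) powr p) = 0"
    by (rule integral_eq_zero_AE) (use assms in \<open>auto elim: eventually_mono\<close>)
  then show ?thesis by (simp add: Lp_norm_def)
qed

context
  fixes F :: "(real \<Rightarrow> 'b::real_normed_vector) \<Rightarrow> real" and T q :: real
  assumes F: "bounded_functional_on (Lp T q) (Lp_norm T q) F" and q: "0 < q"
begin

lemma functional_add: "f \<in> Lp T q \<Longrightarrow> g \<in> Lp T q \<Longrightarrow> F (\<lambda>t. f t + g t) = F f + F g"
  using F by (auto simp: bounded_functional_on_def)

lemma functional_scale: "f \<in> Lp T q \<Longrightarrow> F (\<lambda>t. a *\<^sub>R f t) = a * F f"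
  using F by (auto simp: bounded_functional_on_def)

lemma functional_diff: "f \<in> Lp T q \<Longrightarrow> g \<in> Lp T q \<Longrightarrow> F (\<lambda>t. f t - g t) = F f - F g"
  using functional_add[of f "\<lambda>t. (-1) *\<^sub>R g t"] functional_scale[of g "-1"] Lp_scaleR[OF _ q, of g T "-1"] by simp

lemma functional_bound:
  obtains C where "0 \<le> C" "\<And>f. f \<in> Lp T q \<Longrightarrow> \<bar>F f\<bar> \<le> C * Lp_norm T q f"
proof -
  obtain C where C: "\<And>f. f \<in> Lp T q \<Longrightarrow> \<bar>F f\<bar> \<le> C * Lp_norm T q f"
    using F unfolding bounded_functional_on_def by blast
  show thesis
  proof (rule that[of "\<bar>C\<bar>"])
    fix f :: "real \<Rightarrow> 'b" assume "f \<in> Lp T q"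
    then have "\<bar>F f\<bar> \<le> C * Lp_norm T q f" by (rule C)
    also have "\<dots> \<le> \<bar>C\<bar> * Lp_norm T q f" by (intro mult_right_mono Lp_norm_nonneg) auto
    finally show "\<bar>F f\<bar> \<le> \<bar>C\<bar> * Lp_norm T q f" .
  qed simp
qed

lemma functional_cong_AE:
  assumes "f \<in> Lp T q" "g \<in> Lp T q" "AE t in lebesgue_on {0..T}. f t = g t"
  shows "F f = F g"
proof -
  obtain C where C: "\<And>f. f \<in> Lp T q \<Longrightarrow> \<bar>F f\<bar> \<le> C * Lp_norm T q f" using functional_bound by blast
  have "Lp_norm T q (\<lambda>t. f t - g t) = 0"
    using assms(3) by (intro Lp_norm_AE_zero) auto
  then have "F (\<lambda>t. f t - g t) = 0"
    using C[OF Lp_diff[OF assms(1,2) q]] by simp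
  then show ?thesis using functional_diff[OF assms(1,2)] by simp
qed

lemma functional_zero: "F (\<lambda>_. 0) = 0"
  using functional_scale[OF Lp_zero[OF q], of 0] by simp

lemma functional_sum:
  assumes "finite Y" "\<And>y. y \<in> Y \<Longrightarrow> f y \<in> Lp T q"
  shows "(\<lambda>t. \<Sum>y\<in>Y. f y t) \<in> Lp T q \<and> F (\<lambda>t. \<Sum>y\<in>Y. f y t) = (\<Sum>y\<in>Y. F (f y))"
  using assms by (induction) (auto simp: functional_zero Lp_zero q Lp_add functional_add)

lemma Lp_indicator: "A \<in> sets (lebesgue_on {0..T}) \<Longrightarrow> (\<lambda>t. (indicator A t :: real) *\<^sub>R (\<eta> :: 'b)) \<in> Lp T q"
  by (rule Lp_bounded[OF _ q, of _ _ "norm \<eta>"])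
     (auto intro!: bochner_measurable_scaleR bochner_measurable_const simp: indicator_def)

text \<open>Three approximations: from vectors in \<open>D\<close> to all vectors on a fixed set, by
  additivity to simple functions, and in norm to all of \<open>Lp T q\<close>.\<close>

lemma functional_vanishing_on_indicators:
  fixes D :: "'b set"
  assumes dense: "closure D = UNIV"
    and zero: "\<And>A \<eta>. A \<in> sets (lebesgue_on {0..T}) \<Longrightarrow> \<eta> \<in> D \<Longrightarrow> F (\<lambda>t. (indicator A t :: real) *\<^sub>R \<eta>) = 0"
    and g: "g \<in> Lp T q"
  shows "F g = 0"
proof -
  let ?M = "lebesgue_on {0..T}"
  interpret finite_measure ?M by (rule finite_measure_interval)
  obtain C where C: "0 \<le> C" "\<And>f. f \<in> Lp T q \<Longrightarrow> \<bar>F f\<bar> \<le> C * Lp_norm T q f" using functional_bound by blast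
  have zero': "F (\<lambda>t. (indicator A t :: real) *\<^sub>R \<eta>) = 0" if A: "A \<in> sets ?M" for A \<eta>
  proof -
    let ?c = "C * ((LINT t|?M. 1) powr (1 / q))"
    have le: "\<bar>F (\<lambda>t. (indicator A t :: real) *\<^sub>R \<eta>)\<bar> \<le> ?c * dist d \<eta>" if d: "d \<in> D" for d
    proof -
      have "F (\<lambda>t. (indicator A t :: real) *\<^sub>R \<eta>) = F (\<lambda>t. (indicator A t :: real) *\<^sub>R \<eta> - (indicator A t :: real) *\<^sub>R d)"
        using functional_diff[OF Lp_indicator[OF A] Lp_indicator[OF A]] zero[OF A d] by simp
      also have "\<dots> = F (\<lambda>t. (indicator A t :: real) *\<^sub>R (\<eta> - d))" by (simp add: scaleR_diff_right)
      also have "\<bar>\<dots>\<bar> \<le> C * Lp_norm T q (\<lambda>t. (indicator A t :: real) *\<^sub>R (\<eta> - d))"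
        by (rule C(2)[OF Lp_indicator[OF A]])
      also have "\<dots> \<le> C * (dist d \<eta> * (LINT t|?M. 1) powr (1 / q))"
      proof (intro mult_left_mono C(1))
        have "(LINT t|?M. norm ((indicator A t :: real) *\<^sub>R (\<eta> - d)) powr q) \<le> (LINT t|?M. norm (\<eta> - d) powr q)"
        proof (rule integral_mono)
          show "integrable ?M (\<lambda>t. norm ((indicator A t :: real) *\<^sub>R (\<eta> - d)) powr q)"
            by (rule LpD(2)[OF Lp_indicator[OF A]])
          show "norm ((indicator A t :: real) *\<^sub>R (\<eta> - d)) powr q \<le> norm (\<eta> - d) powr q" for t
            by (cases "t \<in> A") simp_all
        qed simp
        also have "\<dots> = norm (\<eta> - d) powr q * (LINT t|?M. 1)"
          by (subst integral_mult_right_zero[symmetric]) simp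
        finally have "Lp_norm T q (\<lambda>t. (indicator A t :: real) *\<^sub>R (\<eta> - d)) \<le> (norm (\<eta> - d) powr q * (LINT t|?M. 1)) powr (1 / q)"
          unfolding Lp_norm_def using q by (intro powr_mono2 integral_nonneg) simp_all
        also have "\<dots> = dist d \<eta> * (LINT t|?M. 1) powr (1 / q)"
          using q by (simp add: powr_mult powr_powr dist_norm norm_minus_commute)
        finally show "Lp_norm T q (\<lambda>t. (indicator A t :: real) *\<^sub>R (\<eta> - d)) \<le> dist d \<eta> * (LINT t|?M. 1) powr (1 / q)" .
      qed
      finally show ?thesis by (simp add: mult_ac)
    qed
    have "\<eta> \<in> closure D" using dense by simp
    then obtain d where d: "\<And>n. d n \<in> D" "d \<longlonglongrightarrow> \<eta>" unfolding closure_sequential by blast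
    have "(\<lambda>n. ?c * dist (d n) \<eta>) \<longlonglongrightarrow> ?c * 0"
      by (intro tendsto_mult tendsto_const tendsto_dist_iff[THEN iffD1] d(2))
    then have "\<bar>F (\<lambda>t. (indicator A t :: real) *\<^sub>R \<eta>)\<bar> \<le> ?c * 0"
      by (rule LIMSEQ_le_const) (use le d(1) in blast)
    then show ?thesis by simp
  qed
  have simple: "F s = 0" if s: "simple_function ?M s" and sL: "s \<in> Lp T q" for s
  proof -
    let ?f = "\<lambda>y t. (indicator (s -` {y} \<inter> space ?M) t :: real) *\<^sub>R y"
    have sum: "(\<lambda>t. \<Sum>y\<in>s ` space ?M. ?f y t) \<in> Lp T q \<and> F (\<lambda>t. \<Sum>y\<in>s ` space ?M. ?f y t) = (\<Sum>y\<in>s ` space ?M. F (?f y))"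
      using s by (intro functional_sum Lp_indicator) (auto simp: simple_function_def)
    have "F s = F (\<lambda>t. \<Sum>y\<in>s ` space ?M. ?f y t)"
      using sum by (intro functional_cong_AE sL AE_I2 simple_function_sum_indicator[OF s]) auto
    also have "\<dots> = 0" using sum s by (auto intro!: sum.neutral zero' simp: simple_function_def)
    finally show ?thesis .
  qed
  obtain s where s: "\<And>k::nat. simple_function ?M (s k)" "\<And>k. s k \<in> Lp T q"
    and lim: "(\<lambda>k. Lp_norm T q (\<lambda>t. s k t - g t)) \<longlonglongrightarrow> 0"
    using Lp_simple_approximation[OF q g] by blast
  have "\<bar>F g\<bar> \<le> C * Lp_norm T q (\<lambda>t. s k t - g t)" for k
    using C(2)[OF Lp_diff[OF s(2) g q], of k] functional_diff[OF s(2) g, of k] simple[OF s] by simp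
  moreover have "(\<lambda>k. C * Lp_norm T q (\<lambda>t. s k t - g t)) \<longlonglongrightarrow> C * 0"
    by (intro tendsto_mult tendsto_const lim)
  ultimately have "\<bar>F g\<bar> \<le> C * 0" by (intro LIMSEQ_le_const) auto
  then show ?thesis by simp
qed

end

text \<open>Testing with the power \<open>p - 1\<close> of a truncation of \<open>m\<close> bounds
  the integral \<open>I n\<close> of its \<open>p\<close>-th power by
  \<open>C * I n powr (1 / q)\<close>. Since truncation keeps \<open>I n\<close> finite, division
  gives the uniform bound \<open>C powr p\<close>, and monotone convergence removes the
  truncation.\<close>

lemma integrable_powr_if_bounded_pairing:
  fixes m :: "'a \<Rightarrow> real"
  assumes fin: "finite_measure M" and p: "1 < p" "1 / p + 1 / q = 1"
    and m: "integrable M m" "\<And>t. 0 \<le> m t" and C: "0 \<le> C"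
    and le: "\<And>\<phi>. simple_function M \<phi> \<Longrightarrow> (\<And>t. 0 \<le> \<phi> t) \<Longrightarrow>
      (LINT t|M. \<phi> t * m t) \<le> C * (LINT t|M. \<phi> t powr q) powr (1 / q)"
  shows "integrable M (\<lambda>t. m t powr p)"
proof -
  interpret finite_measure M by fact
  note q = conjugate_exponent[OF p]
  have mM[measurable]: "m \<in> borel_measurable M" using m by auto
  \<comment> \<open>The power of a truncation is bounded but not simple. Absolute values of the
    approximating simple functions are used because the hypothesis concerns nonnegative
    ones.\<close>
  have bounded: "(LINT t|M. \<phi> t * m t) \<le> C * (LINT t|M. \<phi> t powr q) powr (1 / q)"
    if [measurable]: "\<phi> \<in> borel_measurable M" and \<phi>: "\<And>t. 0 \<le> \<phi> t" "\<And>t. \<phi> t \<le> R" for \<phi> R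
  proof -
    from borel_measurable_implies_sequence_metric[OF that(1), of 0] obtain s
      where s: "\<And>i. simple_function M (s i)" "\<And>t. t \<in> space M \<Longrightarrow> (\<lambda>i. s i t) \<longlonglongrightarrow> \<phi> t"
        "\<And>i t. t \<in> space M \<Longrightarrow> \<bar>s i t\<bar> \<le> 2 * \<bar>\<phi> t\<bar>"
      unfolding dist_real_def diff_0_right by blast
    have [measurable]: "s i \<in> borel_measurable M" for i by (rule borel_measurable_simple_function[OF s(1)])
    have s2: "\<bar>s i t\<bar> \<le> 2 * R" if "t \<in> space M" for i t
      using s(3)[OF that, of i] \<phi>(1,2)[of t] by linarith
    have lim: "(\<lambda>i. \<bar>s i t\<bar>) \<longlonglongrightarrow> \<phi> t" if "t \<in> space M" for t
      using tendsto_rabs[OF s(2)[OF that]] \<phi>(1)[of t] by simp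
    have L: "(\<lambda>i. LINT t|M. \<bar>s i t\<bar> * m t) \<longlonglongrightarrow> (LINT t|M. \<phi> t * m t)"
    proof (rule integral_dominated_convergence[where w = "\<lambda>t. 2 * R * m t"])
      show "AE t in M. (\<lambda>i. \<bar>s i t\<bar> * m t) \<longlonglongrightarrow> \<phi> t * m t"
        by (intro AE_I2 tendsto_mult lim tendsto_const)
      show "AE t in M. norm (\<bar>s i t\<bar> * m t) \<le> 2 * R * m t" for i
        using s2 m(2) by (intro AE_I2) (simp add: abs_mult mult_right_mono)
    qed (use m in auto)
    have R: "(\<lambda>i. LINT t|M. \<bar>s i t\<bar> powr q) \<longlonglongrightarrow> (LINT t|M. \<phi> t powr q)"
    proof (rule integral_dominated_convergence[where w = "\<lambda>t. (2 * R) powr q"])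
      show "AE t in M. (\<lambda>i. \<bar>s i t\<bar> powr q) \<longlonglongrightarrow> \<phi> t powr q"
        using q(1) by (intro AE_I2 tendsto_powr2 lim tendsto_const) auto
      show "AE t in M. norm (\<bar>s i t\<bar> powr q) \<le> (2 * R) powr q" for i
        using s2 q(1) by (intro AE_I2) (simp add: powr_mono2)
    qed auto
    have "(\<lambda>i. C * (LINT t|M. \<bar>s i t\<bar> powr q) powr (1 / q)) \<longlonglongrightarrow> C * (LINT t|M. \<phi> t powr q) powr (1 / q)"
      using q(1) by (intro tendsto_mult tendsto_powr2 R tendsto_const) auto
    from LIMSEQ_le[OF L this] show ?thesis
      using le[OF simple_function_compose1[OF s(1), of abs]] by auto
  qed
  define N where "N n t = min (m t) (real n)" for n t
  have NM[measurable]: "N n \<in> borel_measurable M" for n unfolding N_def[abs_def] by measurable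
  have N: "0 \<le> N n t" "N n t \<le> real n" "N n t \<le> m t" for n t
    using m(2)[of t] by (auto simp: N_def)
  have Nint: "integrable M (\<lambda>t. N n t powr p)" for n
    using N p(1) by (intro integrable_const_bound[of _ "real n powr p"] AE_I2) (auto intro: powr_mono2)
  define I where "I n = (LINT t|M. N n t powr p)" for n
  have I_bound: "I n \<le> C powr p" for n
  proof -
    have I0: "0 \<le> I n" unfolding I_def by simp
    have pq: "(N n t powr (p - 1)) powr q = N n t powr p" for t
      using q(3) by (simp add: powr_powr mult.commute)
    have mult: "N n t powr p = N n t powr (p - 1) * N n t" for t
    proof (cases "N n t = 0")
      case False
      then have "N n t powr (p - 1) * N n t powr 1 = N n t powr p" by (subst powr_add[symmetric]) simp
      then show ?thesis using N(1)[of n t] False by simp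
    qed simp
    have pm: "N n t powr (p - 1) \<le> real n powr (p - 1)" for t
      using N[of n t] p(1) by (intro powr_mono2) simp_all
    have "I n \<le> (LINT t|M. N n t powr (p - 1) * m t)"
      unfolding I_def
    proof (rule integral_mono[OF Nint])
      have "norm (N n t powr (p - 1) * m t) \<le> norm (real n powr (p - 1) * m t)" for t
        using mult_right_mono[OF pm m(2)[of t]] m(2)[of t] by (simp add: abs_mult)
      then have ae: "AE t in M. norm (N n t powr (p - 1) * m t) \<le> norm (real n powr (p - 1) * m t)" by (rule AE_I2)
      have "integrable M (\<lambda>t. real n powr (p - 1) * m t)" using m(1) by simp
      from Bochner_Integration.integrable_bound[OF this _ ae]
      show "integrable M (\<lambda>t. N n t powr (p - 1) * m t)" by simp
      show "N n t powr p \<le> N n t powr (p - 1) * m t" for t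
        unfolding mult by (intro mult_left_mono N) simp
    qed
    also have "\<dots> \<le> C * (LINT t|M. (N n t powr (p - 1)) powr q) powr (1 / q)"
      by (rule bounded[OF _ _ pm]) simp_all
    also have "\<dots> = C * I n powr (1 / q)" by (simp add: pq I_def)
    finally have le: "I n \<le> C * I n powr (1 / q)" .
    show ?thesis
    proof (cases "I n = 0")
      case False
      then have pos: "0 < I n" using I0 by simp
      have e: "1 - 1 / q = 1 / p" using p(2) by simp
      have "I n powr (1 / p) = I n / I n powr (1 / q)"
        using pos by (simp add: powr_diff[of _ 1 "1 / q", unfolded e])
      also have "\<dots> \<le> C" using le pos by (simp add: divide_le_eq)
      finally have "(I n powr (1 / p)) powr p \<le> C powr p" using p(1) by (intro powr_mono2) auto
      then show ?thesis using pos p(1) by (simp add: powr_powr)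
    qed simp
  qed
  have mono: "N n t powr p \<le> N k t powr p" if "n \<le> k" for n k t
    using that N p(1) by (intro powr_mono2) (auto simp: N_def)
  have "incseq I"
    unfolding I_def[abs_def] by (intro incseq_def[THEN iffD2] allI impI integral_mono Nint mono)
  then obtain L where L: "I \<longlonglongrightarrow> L" using incseq_convergent[of I "C powr p"] I_bound by blast
  show ?thesis
  proof (rule integrable_monotone_convergence[where f = "\<lambda>n t. N n t powr p"])
    show "AE t in M. mono (\<lambda>n. N n t powr p)" using mono by (intro AE_I2 monoI)
    show "AE t in M. (\<lambda>n. N n t powr p) \<longlonglongrightarrow> m t powr p"
    proof (intro AE_I2)
      fix t
      obtain k :: nat where k: "m t \<le> real k" using real_arch_simple by blast
      have "\<forall>\<^sub>F n in sequentially. m t powr p = N n t powr p"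
        using eventually_ge_at_top[of k] by eventually_elim (use k in \<open>auto simp: N_def\<close>)
      then show "(\<lambda>n. N n t powr p) \<longlonglongrightarrow> m t powr p" by (rule Lim_transform_eventually[OF tendsto_const])
    qed
    show "(\<lambda>n. LINT t|M. N n t powr p) \<longlonglongrightarrow> L" using L by (simp add: I_def[abs_def])
  qed (use Nint mM in auto)
qed

lemma reflexive_representation:
  fixes \<Phi> :: "('v::banach \<Rightarrow>\<^sub>L real) \<Rightarrow>\<^sub>L real"
  assumes "reflexive TYPE('v)"
  obtains x where "\<And>\<xi>. blinfun_apply \<Phi> \<xi> = blinfun_apply \<xi> x" "norm x \<le> norm \<Phi>"
proof -
  obtain x where x: "\<And>\<xi>. blinfun_apply \<Phi> \<xi> = blinfun_apply \<xi> x"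
    using assms unfolding reflexive_def by blast
  obtain \<eta> :: "'v \<Rightarrow>\<^sub>L real" where \<eta>: "norm \<eta> \<le> 1" "blinfun_apply \<eta> x = norm x"
    by (rule exists_norming_functional)
  have "norm x \<le> norm \<Phi> * norm \<eta>"
    using norm_blinfun[of \<Phi> \<eta>] x[of \<eta>] \<eta>(2) by simp
  also have "\<dots> \<le> norm \<Phi> * 1" using \<eta>(1) by (intro mult_left_mono) auto
  finally show thesis using that x by simp
qed

text \<open>
  The variation \<open>\<mu> E\<close>, the supremum of \<open>F\<close> over the functions bounded by the indicator of \<open>E\<close>, has a density
  \<open>m \<in> L\<^sup>p\<close>. It dominates every \<open>E \<mapsto> F (1\<^sub>E \<eta>)\<close>, whose density \<open>r \<eta>\<close> therefore satisfies \<open>\<bar>r \<eta>\<bar> \<le> m * norm \<eta>\<close>.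
  Outside a null set \<open>\<eta> \<mapsto> r \<eta> t\<close> is additive and rational homogeneous on a countable dense set, so it
  extends to an element of the bidual, that is, of \<open>V\<close>.
\<close>
theorem Lp_functional_representation:
  fixes F :: "(real \<Rightarrow> 'v::{banach, second_countable_topology} \<Rightarrow>\<^sub>L real) \<Rightarrow> real"
    and \<xi> :: "nat \<Rightarrow> 'v \<Rightarrow>\<^sub>L real"
  assumes p: "1 < p" "1 / p + 1 / q = 1" and reflex: "reflexive TYPE('v)"
    and dense: "closure (range \<xi>) = UNIV"
    and F: "bounded_functional_on (Lp T q) (Lp_norm T q) F"
  obtains x where "x \<in> Lp T p" "\<And>g. g \<in> Lp T q \<Longrightarrow> F g = pairing T g x"
proof -
  let ?M = "lebesgue_on {0..T}"
  interpret finite_measure ?M by (rule finite_measure_interval)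
  interpret complete_measure ?M by (rule complete_measure_interval)
  note q = conjugate_exponent[OF p]
  have q0: "0 < q" using q(1) by simp
  note Fadd = functional_add[OF F q0] and Fscale = functional_scale[OF F q0]
    and Find = Lp_indicator[OF F q0]
  obtain C where C: "0 \<le> C" "\<And>f. f \<in> Lp T q \<Longrightarrow> \<bar>F f\<bar> \<le> C * Lp_norm T q f"
    using functional_bound[OF F q0] by blast

  \<comment> \<open>The variation of the functional and its density\<close>
  define B :: "real set \<Rightarrow> (real \<Rightarrow> 'v \<Rightarrow>\<^sub>L real) set"
    where "B E = {f. bochner_measurable ?M f \<and> (\<forall>t. norm (f t) \<le> indicator E t)}" for E
  have BL: "f \<in> Lp T q" if "f \<in> B E" for f E
  proof (rule Lp_bounded[OF _ q0, of _ _ 1])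
    show "bochner_measurable ?M f" using that by (simp add: B_def)
    have "norm (f t) \<le> 1" for t
    proof -
      have "norm (f t) \<le> indicator E t" using that by (simp add: B_def)
      also have "\<dots> \<le> 1" by (simp add: indicator_def)
      finally show ?thesis .
    qed
    then show "AE t in ?M. norm (f t) \<le> 1" by simp
  qed
  have B_bound: "F f \<le> C * measure ?M E powr (1 / q)" if E: "E \<in> sets ?M" and f: "f \<in> B E" for E f
  proof -
    have "(LINT t|?M. norm (f t) powr q) \<le> (LINT t|?M. indicator E t)"
    proof (rule integral_mono[OF LpD(2)[OF BL[OF f]]])
      show "integrable ?M (indicator E :: real \<Rightarrow> real)"
        by (rule integrable_const_bound[of _ 1]) (use E in \<open>auto simp: indicator_def\<close>)
      fix t
      have "norm (f t) powr q \<le> indicator E t powr q"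
        using f q0 by (intro powr_mono2) (auto simp: B_def)
      also have "\<dots> = indicator E t" by (simp add: indicator_def)
      finally show "norm (f t) powr q \<le> indicator E t" .
    qed
    also have "\<dots> = measure ?M E"
      using sets.sets_into_space[OF E] by (simp add: Int_absorb2)
    finally have "Lp_norm T q f \<le> measure ?M E powr (1 / q)"
      unfolding Lp_norm_def using q0 by (intro powr_mono2 integral_nonneg) simp_all
    then have "C * Lp_norm T q f \<le> C * measure ?M E powr (1 / q)" using C(1) by (rule mult_left_mono)
    then show ?thesis using C(2)[OF BL[OF f]] by linarith
  qed
  have B0: "(\<lambda>_. 0) \<in> B E" for E by (simp add: B_def bochner_measurable_const)
  define \<mu> where "\<mu> E = Sup (F ` B E)" for E
  have ne: "F ` B E \<noteq> {}" for E using B0 by blast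
  have bdd: "bdd_above (F ` B E)" if "E \<in> sets ?M" for E
    using B_bound[OF that] by (auto simp: bdd_above_def)
  have \<mu>_upper: "F f \<le> \<mu> E" if "E \<in> sets ?M" "f \<in> B E" for E f
    unfolding \<mu>_def by (rule cSup_upper[OF imageI[OF that(2)] bdd[OF that(1)]])
  have \<mu>_least: "\<mu> E \<le> a" if "\<And>f. f \<in> B E \<Longrightarrow> F f \<le> a" for E a
    unfolding \<mu>_def by (rule cSup_least[OF ne]) (use that in auto)
  have \<mu>_nonneg: "0 \<le> \<mu> E" if "E \<in> sets ?M" for E
    using \<mu>_upper[OF that B0] functional_zero[OF F q0] by simp
  have \<mu>_bound: "\<mu> E \<le> C * measure ?M E powr (1 / q)" if "E \<in> sets ?M" for E
    by (rule \<mu>_least) (rule B_bound[OF that])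
  \<comment> \<open>One inequality splits a competitor by restriction to the two disjoint sets, the
    other glues two competitors, whose sum is still bounded by the indicator of the union.\<close>
  have \<mu>_add: "\<mu> (E \<union> E') = \<mu> E + \<mu> E'" if E: "E \<in> sets ?M" "E' \<in> sets ?M" "E \<inter> E' = {}" for E E'
  proof (rule antisym)
    have Un: "E \<union> E' \<in> sets ?M" using E by auto
    have restrict: "(\<lambda>t. (indicator D t :: real) *\<^sub>R f t) \<in> B D" if "D \<in> sets ?M" "f \<in> B E''" for D E'' f
    proof -
      have "norm ((indicator D t :: real) *\<^sub>R f t) \<le> indicator D t" for t
      proof -
        have "norm (f t) \<le> indicator E'' t" using that by (simp add: B_def)
        also have "\<dots> \<le> 1" by (simp add: indicator_def)
        finally show ?thesis by (simp add: indicator_def)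
      qed
      moreover have "bochner_measurable ?M (\<lambda>t. (indicator D t :: real) *\<^sub>R f t)"
        using that by (intro bochner_measurable_scaleR) (auto simp: B_def)
      ultimately show ?thesis by (simp add: B_def)
    qed
    show "\<mu> (E \<union> E') \<le> \<mu> E + \<mu> E'"
    proof (rule \<mu>_least)
      fix f assume f: "f \<in> B (E \<union> E')"
      note r = restrict[OF E(1) f] restrict[OF E(2) f]
      have "f t = (indicator E t :: real) *\<^sub>R f t + (indicator E' t :: real) *\<^sub>R f t" for t
      proof -
        have "norm (f t) \<le> indicator (E \<union> E') t" using f by (simp add: B_def)
        then show ?thesis using E(3) by (cases "t \<in> E"; cases "t \<in> E'") auto
      qed
      then have "F f = F (\<lambda>t. (indicator E t :: real) *\<^sub>R f t) + F (\<lambda>t. (indicator E' t :: real) *\<^sub>R f t)"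
        using Fadd[OF BL[OF r(1)] BL[OF r(2)]] by simp
      also have "\<dots> \<le> \<mu> E + \<mu> E'" by (intro add_mono \<mu>_upper E r)
      finally show "F f \<le> \<mu> E + \<mu> E'" .
    qed
    have sum: "F f + F f' \<le> \<mu> (E \<union> E')" if f: "f \<in> B E" "f' \<in> B E'" for f f'
    proof -
      have "(\<lambda>t. f t + f' t) \<in> B (E \<union> E')"
        unfolding B_def
      proof (intro CollectI conjI allI)
        show "bochner_measurable ?M (\<lambda>t. f t + f' t)"
          using f by (intro bochner_measurable_add) (auto simp: B_def)
        fix t
        have "norm (f t + f' t) \<le> norm (f t) + norm (f' t)" by (rule norm_triangle_ineq)
        also have "\<dots> \<le> indicator E t + indicator E' t"
          using f by (intro add_mono) (auto simp: B_def)
        also have "\<dots> = indicator (E \<union> E') t" using E(3) by (auto simp: indicator_def)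
        finally show "norm (f t + f' t) \<le> indicator (E \<union> E') t" .
      qed
      from \<mu>_upper[OF Un this] show ?thesis using Fadd[OF BL[OF f(1)] BL[OF f(2)]] by simp
    qed
    have "\<mu> E \<le> \<mu> (E \<union> E') - F f'" if "f' \<in> B E'" for f'
      by (rule \<mu>_least) (use sum that in \<open>simp add: le_diff_eq\<close>)
    then have "\<mu> E' \<le> \<mu> (E \<union> E') - \<mu> E"
      by (intro \<mu>_least) (simp add: le_diff_eq add.commute)
    then show "\<mu> E + \<mu> E' \<le> \<mu> (E \<union> E')" by simp
  qed
  have q'0: "0 < 1 / q" using q0 by simp
  obtain m where m: "integrable ?M m" "\<And>t. 0 \<le> m t"
    and \<mu>m: "\<And>E. E \<in> sets ?M \<Longrightarrow> \<mu> E = (LINT t|?M. indicator E t * m t)"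
    using additive_set_function_density[OF finite_measure_axioms \<mu>_nonneg \<mu>_add \<mu>_bound q'0] by blast
  have [measurable]: "m \<in> borel_measurable ?M" using m by auto

  have mp: "integrable ?M (\<lambda>t. m t powr p)"
  proof (rule integrable_powr_if_bounded_pairing[OF finite_measure_axioms p m C(1)])
    fix \<phi> :: "real \<Rightarrow> real" assume \<phi>: "simple_function ?M \<phi>" and \<phi>0: "\<And>t. 0 \<le> \<phi> t"
    let ?Y = "\<phi> ` space ?M" and ?E = "\<lambda>y. \<phi> -` {y} \<inter> space ?M"
    have Y: "finite ?Y" and E: "?E y \<in> sets ?M" for y
      by (rule simple_functionD(1)[OF \<phi>], rule simple_functionD(2)[OF \<phi>])
    have \<phi>_eq: "\<phi> t = (\<Sum>y\<in>?Y. y * indicator (?E y) t)" if "t \<in> space ?M" for t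
      using simple_function_sum_indicator[OF \<phi> that] by (simp only: real_scaleR_def mult.commute)
    have int: "integrable ?M (\<lambda>t. indicator (?E y) t * m t)" for y
      using integrable_mult_indicator[OF E m(1), of y] by simp
    have "(LINT t|?M. \<phi> t * m t) = (LINT t|?M. (\<Sum>y\<in>?Y. y * (indicator (?E y) t * m t)))"
    proof (rule Bochner_Integration.integral_cong[OF refl])
      fix t assume t: "t \<in> space ?M"
      have "\<phi> t * m t = (\<Sum>y\<in>?Y. y * indicator (?E y) t) * m t" using \<phi>_eq[OF t] by (rule arg_cong[where f = "\<lambda>z. z * m t"])
      then show "\<phi> t * m t = (\<Sum>y\<in>?Y. y * (indicator (?E y) t * m t))"
        by (simp only: sum_distrib_right mult.assoc)
    qed
    also have "\<dots> = (\<Sum>y\<in>?Y. y * (LINT t|?M. indicator (?E y) t * m t))"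
      using int by simp
    also have "\<dots> = (\<Sum>y\<in>?Y. y * \<mu> (?E y))"
      by (simp only: \<mu>m[OF E])
    finally have pairing: "(LINT t|?M. \<phi> t * m t) = (\<Sum>y\<in>?Y. y * \<mu> (?E y))" .
    let ?R = "C * (LINT t|?M. \<phi> t powr q) powr (1 / q)"
    \<comment> \<open>On each level set a competitor within \<open>e\<close> of the supremum is
      chosen and weighted by the level. The sum is bounded pointwise by \<open>\<phi>\<close>, so
      the functional is controlled by the norm of \<open>\<phi>\<close>.\<close>
    have eps: "(\<Sum>y\<in>?Y. y * \<mu> (?E y)) \<le> ?R + e * (\<Sum>y\<in>?Y. y)" if e: "0 < e" for e
    proof -
      have "\<exists>f\<in>B (?E y). \<mu> (?E y) - e < F f" for y
        using less_cSupE[OF _ ne, of "\<mu> (?E y) - e" "?E y"] e by (auto simp: \<mu>_def)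
      then obtain f where f: "\<And>y. f y \<in> B (?E y)" "\<And>y. \<mu> (?E y) - e < F (f y)" by metis
      have yf: "(\<lambda>t. y *\<^sub>R f y t) \<in> Lp T q" for y by (rule Lp_scaleR[OF BL[OF f(1)] q0])
      note S = functional_sum[OF F q0 Y, of "\<lambda>y t. y *\<^sub>R f y t", OF yf]
      have "(\<Sum>y\<in>?Y. y * \<mu> (?E y)) \<le> (\<Sum>y\<in>?Y. y * (F (f y) + e))"
      proof (intro sum_mono mult_left_mono)
        fix y assume "y \<in> ?Y"
        then show "0 \<le> y" using \<phi>0 by auto
        show "\<mu> (?E y) \<le> F (f y) + e" using f(2)[of y] by linarith
      qed
      also have "\<dots> = F (\<lambda>t. \<Sum>y\<in>?Y. y *\<^sub>R f y t) + e * (\<Sum>y\<in>?Y. y)"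
        using S[THEN conjunct2]
        by (simp only: Fscale[OF BL[OF f(1)]] distrib_left sum.distrib sum_distrib_left mult.commute)
      finally have 1: "(\<Sum>y\<in>?Y. y * \<mu> (?E y)) \<le> F (\<lambda>t. \<Sum>y\<in>?Y. y *\<^sub>R f y t) + e * (\<Sum>y\<in>?Y. y)" .
      have 2: "F (\<lambda>t. \<Sum>y\<in>?Y. y *\<^sub>R f y t) \<le> C * Lp_norm T q (\<lambda>t. \<Sum>y\<in>?Y. y *\<^sub>R f y t)"
        using C(2)[OF S[THEN conjunct1]] by linarith
      have "Lp_norm T q (\<lambda>t. \<Sum>y\<in>?Y. y *\<^sub>R f y t) \<le> Lp_norm T q \<phi>"
      proof (rule Lp_norm_dominated(2)[OF LpD(1) q0])
        show "(\<lambda>t. \<Sum>y\<in>?Y. y *\<^sub>R f y t) \<in> Lp T q" using S by blast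
        show "\<phi> \<in> Lp T q"
        proof (rule Lp_bounded[OF bochner_measurable_simple[OF \<phi>] q0])
          show "AE t in ?M. norm (\<phi> t) \<le> Max (norm ` ?Y)"
            using Y by (intro AE_I2 Max_ge) auto
        qed
        show "AE t in ?M. norm (\<Sum>y\<in>?Y. y *\<^sub>R f y t) \<le> norm (\<phi> t)"
        proof (intro AE_I2)
          fix t assume t: "t \<in> space ?M"
          have "norm (\<Sum>y\<in>?Y. y *\<^sub>R f y t) \<le> (\<Sum>y\<in>?Y. norm (y *\<^sub>R f y t))" by (rule norm_sum)
          also have "\<dots> \<le> (\<Sum>y\<in>?Y. y * indicator (?E y) t)"
          proof (rule sum_mono)
            fix y assume "y \<in> ?Y"
            then have "0 \<le> y" using \<phi>0 by auto
            then show "norm (y *\<^sub>R f y t) \<le> y * indicator (?E y) t"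
            proof -
              have "norm (f y t) \<le> indicator (?E y) t" using f(1)[of y] unfolding B_def by blast
              from mult_left_mono[OF this \<open>0 \<le> y\<close>] show ?thesis using \<open>0 \<le> y\<close> by (simp only: norm_scaleR abs_of_nonneg)
            qed
          qed
          also have "\<dots> = norm (\<phi> t)" unfolding \<phi>_eq[OF t, symmetric] using \<phi>0[of t] by simp
          finally show "norm (\<Sum>y\<in>?Y. y *\<^sub>R f y t) \<le> norm (\<phi> t)" .
        qed
      qed
      from mult_left_mono[OF this C(1)] have "C * Lp_norm T q (\<lambda>t. \<Sum>y\<in>?Y. y *\<^sub>R f y t) \<le> C * Lp_norm T q \<phi>" .
      moreover have "C * Lp_norm T q \<phi> = ?R" using \<phi>0 by (simp add: Lp_norm_def)
      ultimately show ?thesis using 1 2 by linarith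
    qed
    have "(\<Sum>y\<in>?Y. y * \<mu> (?E y)) \<le> ?R"
    proof (rule field_le_epsilon)
      fix e :: real assume e: "0 < e"
      let ?S = "\<Sum>y\<in>?Y. y"
      have S: "0 \<le> ?S" using \<phi>0 by (intro sum_nonneg) auto
      \<comment> \<open>The summand 1 keeps the divisor positive when \<open>\<phi>\<close>
        vanishes.\<close>
      have "0 < e / (?S + 1)" using e S by (intro divide_pos_pos) linarith+
      from eps[OF this] have "(\<Sum>y\<in>?Y. y * \<mu> (?E y)) \<le> ?R + e / (?S + 1) * ?S" .
      moreover have "e / (?S + 1) * ?S \<le> e / (?S + 1) * (?S + 1)"
        using \<open>0 < e / (?S + 1)\<close> by (intro mult_left_mono) linarith+
      moreover have "e / (?S + 1) * (?S + 1) = e" using S by (intro nonzero_eq_divide_eq[THEN iffD1]) (linarith, rule refl)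
      ultimately show "(\<Sum>y\<in>?Y. y * \<mu> (?E y)) \<le> ?R + e" by linarith
    qed
    with pairing show "(LINT t|?M. \<phi> t * m t) \<le> ?R" by simp
  qed

  \<comment> \<open>Scalar densities for fixed dual vectors\<close>
  have ind_le: "F (\<lambda>t. (indicator E t :: real) *\<^sub>R \<eta>) \<le> norm \<eta> * \<mu> E" if E: "E \<in> sets ?M" for E \<eta>
  proof (cases "\<eta> = 0")
    case True then show ?thesis using functional_zero[OF F q0] by simp
  next
    case False
    let ?u = "(1 / norm \<eta>) *\<^sub>R \<eta>"
    have "(\<lambda>t. (indicator E t :: real) *\<^sub>R ?u) \<in> B E"
      using E False by (auto simp: B_def indicator_def intro!: bochner_measurable_scaleR bochner_measurable_const)
    then have "F (\<lambda>t. (indicator E t :: real) *\<^sub>R ?u) \<le> \<mu> E" by (rule \<mu>_upper[OF E])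
    then have "norm \<eta> * F (\<lambda>t. (indicator E t :: real) *\<^sub>R ?u) \<le> norm \<eta> * \<mu> E" by (rule mult_left_mono) simp
    also have "norm \<eta> * F (\<lambda>t. (indicator E t :: real) *\<^sub>R ?u) = F (\<lambda>t. norm \<eta> *\<^sub>R ((indicator E t :: real) *\<^sub>R ?u))"
      by (rule Fscale[OF Find[OF E], symmetric])
    also have "(\<lambda>t. norm \<eta> *\<^sub>R ((indicator E t :: real) *\<^sub>R ?u)) = (\<lambda>t. (indicator E t :: real) *\<^sub>R \<eta>)"
      using False by (auto simp: mult.commute)
    finally show ?thesis .
  qed
  have ind_neg: "F (\<lambda>t. (indicator E t :: real) *\<^sub>R (- \<eta>)) = - F (\<lambda>t. (indicator E t :: real) *\<^sub>R \<eta>)"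
    if E: "E \<in> sets ?M" for E \<eta>
    using Fscale[OF Find[OF E], of "-1" \<eta>] by simp
  have "\<exists>r. integrable ?M r \<and> (\<forall>E\<in>sets ?M. F (\<lambda>t. (indicator E t :: real) *\<^sub>R \<eta>) = (LINT t|?M. indicator E t * r t))" for \<eta>
  proof -
    \<comment> \<open>Adding \<open>norm \<eta> * \<mu> E\<close> makes the set function
      nonnegative, as the density lemma demands; the same multiple of \<open>m\<close> is subtracted
      from the density afterwards.\<close>
    define \<nu> where "\<nu> E = F (\<lambda>t. (indicator E t :: real) *\<^sub>R \<eta>) + norm \<eta> * \<mu> E" for E
    obtain D where D: "integrable ?M D" "\<And>E. E \<in> sets ?M \<Longrightarrow> \<nu> E = (LINT t|?M. indicator E t * D t)"
    proof (rule additive_set_function_density[OF finite_measure_axioms _ _ _ q'0, of \<nu> "2 * norm \<eta> * C"])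
      show "0 \<le> \<nu> E" if "E \<in> sets ?M" for E
        using ind_le[OF that, of "- \<eta>"] ind_neg[OF that] by (simp add: \<nu>_def)
      show "\<nu> (E \<union> E') = \<nu> E + \<nu> E'" if E: "E \<in> sets ?M" "E' \<in> sets ?M" "E \<inter> E' = {}" for E E'
      proof -
        have "(\<lambda>t. (indicator (E \<union> E') t :: real) *\<^sub>R \<eta>) = (\<lambda>t. (indicator E t :: real) *\<^sub>R \<eta> + (indicator E' t :: real) *\<^sub>R \<eta>)"
          using E(3) by (auto simp: indicator_def fun_eq_iff)
        then show ?thesis
          using Fadd[OF Find[OF E(1)] Find[OF E(2)]] \<mu>_add[OF E] by (simp add: \<nu>_def distrib_left)
      qed
      show "\<nu> E \<le> 2 * norm \<eta> * C * measure ?M E powr (1 / q)" if "E \<in> sets ?M" for E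
      proof -
        have "\<nu> E \<le> 2 * norm \<eta> * \<mu> E" using ind_le[OF that, of \<eta>] by (simp add: \<nu>_def)
        also have "\<dots> \<le> 2 * norm \<eta> * (C * measure ?M E powr (1 / q))"
          by (intro mult_left_mono \<mu>_bound[OF that]) simp
        finally show ?thesis by (simp add: mult.assoc)
      qed
    qed blast
    have "F (\<lambda>t. (indicator E t :: real) *\<^sub>R \<eta>) = (LINT t|?M. indicator E t * (D t - norm \<eta> * m t))"
      if E: "E \<in> sets ?M" for E
    proof -
      have i: "integrable ?M (\<lambda>t. indicator E t * D t)" "integrable ?M (\<lambda>t. indicator E t * m t)"
        using integrable_mult_indicator[OF E D(1)] integrable_mult_indicator[OF E m(1)] by simp_all
      have "(LINT t|?M. indicator E t * (D t - norm \<eta> * m t)) = (LINT t|?M. indicator E t * D t - norm \<eta> * (indicator E t * m t))"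
        by (intro Bochner_Integration.integral_cong) (auto simp: algebra_simps)
      also have "\<dots> = \<nu> E - norm \<eta> * \<mu> E" using i by (simp add: D(2)[OF E] \<mu>m[OF E])
      finally show ?thesis by (simp add: \<nu>_def)
    qed
    then show ?thesis using D(1) m(1) by (intro exI[of _ "\<lambda>t. D t - norm \<eta> * m t"]) auto
  qed
  then obtain r where r: "\<And>\<eta>. integrable ?M (r \<eta>)"
    and Fr: "\<And>\<eta> E. E \<in> sets ?M \<Longrightarrow> F (\<lambda>t. (indicator E t :: real) *\<^sub>R \<eta>) = (LINT t|?M. indicator E t * r \<eta> t)"
    by metis
  have ri: "integrable ?M (\<lambda>t. indicator E t * r \<eta> t)" if "E \<in> sets ?M" for E \<eta>
    using integrable_mult_indicator[OF that r] by simp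
  have r_add: "AE t in ?M. r (\<eta> + \<eta>') t = r \<eta> t + r \<eta>' t" for \<eta> \<eta>'
  proof (rule AE_eq_of_set_integrals)
    fix E assume E: "E \<in> sets ?M"
    have "(LINT t|?M. indicator E t * r (\<eta> + \<eta>') t) = F (\<lambda>t. (indicator E t :: real) *\<^sub>R \<eta> + (indicator E t :: real) *\<^sub>R \<eta>')"
      using Fr[OF E, of "\<eta> + \<eta>'"] by (simp add: scaleR_add_right)
    also have "\<dots> = (LINT t|?M. indicator E t * (r \<eta> t + r \<eta>' t))"
      using Fadd[OF Find[OF E] Find[OF E]] ri[OF E] by (simp add: Fr[OF E] distrib_left)
    finally show "(LINT t|?M. indicator E t * r (\<eta> + \<eta>') t) = (LINT t|?M. indicator E t * (r \<eta> t + r \<eta>' t))" .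
  qed (use r in auto)
  have r_scale: "AE t in ?M. r (a *\<^sub>R \<eta>) t = a * r \<eta> t" for a \<eta>
  proof (rule AE_eq_of_set_integrals)
    fix E assume E: "E \<in> sets ?M"
    have "(LINT t|?M. indicator E t * r (a *\<^sub>R \<eta>) t) = F (\<lambda>t. a *\<^sub>R ((indicator E t :: real) *\<^sub>R \<eta>))"
      using Fr[OF E, of "a *\<^sub>R \<eta>"] by (simp add: mult.commute)
    also have "\<dots> = a * (LINT t|?M. indicator E t * r \<eta> t)"
      by (simp only: Fscale[OF Find[OF E]] Fr[OF E])
    also have "\<dots> = (LINT t|?M. indicator E t * (a * r \<eta> t))"
      by (subst integral_mult_right_zero[symmetric]) (simp add: mult.left_commute)
    finally show "(LINT t|?M. indicator E t * r (a *\<^sub>R \<eta>) t) = (LINT t|?M. indicator E t * (a * r \<eta> t))" .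
  qed (use r in auto)
  have r_le: "AE t in ?M. r \<eta> t \<le> norm \<eta> * m t" for \<eta>
  proof (rule AE_le_of_set_integrals)
    fix E assume E: "E \<in> sets ?M"
    have "(LINT t|?M. indicator E t * r \<eta> t) \<le> norm \<eta> * (LINT t|?M. indicator E t * m t)"
      using ind_le[OF E, of \<eta>] by (simp only: Fr[OF E] \<mu>m[OF E])
    also have "\<dots> = (LINT t|?M. indicator E t * (norm \<eta> * m t))"
      by (subst integral_mult_right_zero[symmetric]) (simp add: mult.left_commute)
    finally show "(LINT t|?M. indicator E t * r \<eta> t) \<le> (LINT t|?M. indicator E t * (norm \<eta> * m t))" .
  qed (use r m in auto)
  have r_bound: "AE t in ?M. \<bar>r \<eta> t\<bar> \<le> m t * norm \<eta>" for \<eta>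
    using r_le[of \<eta>] r_le[of "(-1) *\<^sub>R \<eta>"] r_scale[of "-1" \<eta>] by eventually_elim (auto simp: mult.commute)

  \<comment> \<open>Assembling the scalar densities into a function with values in
    \<open>V\<close>\<close>
  define D where "D = range (rat_comb \<xi>)"
  have D: "countable D" "closure D = UNIV" by (simp_all add: D_def rat_comb_dense[OF dense])
  have Dadd: "x + y \<in> D" if "x \<in> D" "y \<in> D" for x y
    using that rat_comb_add[of \<xi>] by (auto simp: D_def)
  have Dscale: "(of_rat s :: real) *\<^sub>R x \<in> D" if "x \<in> D" for s x
    using that rat_comb_scale[of s \<xi>] by (auto simp: D_def)
  \<comment> \<open>Each relation holds outside a null set depending on the vectors involved.
    Restricting to the countable set \<open>D\<close> leaves a single null set.\<close>
  define good where "good t \<longleftrightarrow> (\<forall>\<eta>\<in>D. \<bar>r \<eta> t\<bar> \<le> m t * norm \<eta>) \<and>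
    (\<forall>\<eta>\<in>D. \<forall>\<eta>'\<in>D. r (\<eta> + \<eta>') t = r \<eta> t + r \<eta>' t) \<and>
    (\<forall>\<eta>\<in>D. \<forall>s::rat. r ((of_rat s :: real) *\<^sub>R \<eta>) t = of_rat s * r \<eta> t)" for t
  have good: "AE t in ?M. good t"
    unfolding good_def
    by (intro AE_conjI AE_ball_countable[OF D(1), THEN iffD2] ballI r_bound r_add AE_all_countable[THEN iffD2] allI r_scale)
  have ex: "\<exists>y. (\<forall>\<eta>\<in>D. blinfun_apply \<eta> y = r \<eta> t) \<and> norm y \<le> m t" if t: "good t" for t
  proof -
    obtain \<Phi> :: "('v \<Rightarrow>\<^sub>L real) \<Rightarrow>\<^sub>L real" where \<Phi>: "\<And>\<eta>. \<eta> \<in> D \<Longrightarrow> blinfun_apply \<Phi> \<eta> = r \<eta> t" "norm \<Phi> \<le> m t"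
      using rational_linear_extension[OF D(2) Dadd Dscale, of "\<lambda>\<eta>. r \<eta> t" "m t"] t m(2)
      unfolding good_def by blast
    obtain y where "\<And>\<eta>. blinfun_apply \<Phi> \<eta> = blinfun_apply \<eta> y" "norm y \<le> norm \<Phi>"
      using reflexive_representation[OF reflex] by blast
    then show ?thesis using \<Phi> by (intro exI[of _ y]) auto
  qed
  define x where "x t = (SOME y. (\<forall>\<eta>\<in>D. blinfun_apply \<eta> y = r \<eta> t) \<and> norm y \<le> m t)" for t
  have x: "(\<forall>\<eta>\<in>D. blinfun_apply \<eta> (x t) = r \<eta> t) \<and> norm (x t) \<le> m t" if "good t" for t
    unfolding x_def by (rule someI_ex[OF ex[OF that]])
  have "x \<in> borel_measurable ?M"
  proof (rule pettis_measurability[OF dense])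
    fix k
    have "\<xi> k = rat_comb \<xi> [(1, k)]" by (simp add: rat_comb_def)
    then have "\<xi> k \<in> D" by (auto simp: D_def)
    \<comment> \<open>The sequence is constant: by completeness, almost everywhere equality with a
      measurable function already gives measurability.\<close>
    then have "AE t in ?M. (\<lambda>_. r (\<xi> k) t) \<longlonglongrightarrow> blinfun_apply (\<xi> k) (x t)"
      using good by (auto elim!: eventually_mono simp: x)
    then show "(\<lambda>t. blinfun_apply (\<xi> k) (x t)) \<in> borel_measurable ?M"
      by (rule borel_measurable_AE_LIMSEQ[rotated]) (use r in auto)
  qed
  then have xb: "bochner_measurable ?M x" by (rule bochner_measurable_borel)
  have xL: "x \<in> Lp T p"
  proof (rule Lp_dominated[OF xb _ mp])
    show "AE t in ?M. norm (x t) powr p \<le> m t powr p"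
      using good by eventually_elim (use x p(1) in \<open>auto intro: powr_mono2\<close>)
  qed (use p in simp)

  \<comment> \<open>Agreement of the functional with the pairing\<close>
  define \<Delta> where "\<Delta> g = F g - pairing T g x" for g
  have \<Delta>: "bounded_functional_on (Lp T q) (Lp_norm T q) \<Delta>"
    unfolding bounded_functional_on_def
  proof (intro conjI ballI allI)
    note pint = pairing_Holder(2)[OF p _ xL]
    show "\<Delta> (\<lambda>t. f t + g t) = \<Delta> f + \<Delta> g" if "f \<in> Lp T q" "g \<in> Lp T q" for f g
      using pint[OF that(1)] pint[OF that(2)] Fadd[OF that]
      by (simp add: \<Delta>_def pairing_def blinfun.add_left)
    show "\<Delta> (\<lambda>t. a *\<^sub>R f t) = a * \<Delta> f" if "f \<in> Lp T q" for a f
      using Fscale[OF that, of a] by (simp add: \<Delta>_def pairing_def blinfun.scaleR_left right_diff_distrib)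
    show "\<exists>K. \<forall>f\<in>Lp T q. \<bar>\<Delta> f\<bar> \<le> K * Lp_norm T q f"
    proof (intro exI ballI)
      fix f :: "real \<Rightarrow> 'v \<Rightarrow>\<^sub>L real" assume f: "f \<in> Lp T q"
      have "\<bar>\<Delta> f\<bar> \<le> \<bar>F f\<bar> + \<bar>pairing T f x\<bar>" by (simp add: \<Delta>_def)
      also have "\<dots> \<le> C * Lp_norm T q f + Lp_norm T p x * Lp_norm T q f"
        by (intro add_mono C(2) pairing_Holder(3)[OF p] f xL)
      finally show "\<bar>\<Delta> f\<bar> \<le> (C + Lp_norm T p x) * Lp_norm T q f" by (simp add: distrib_right)
    qed
  qed
  show thesis
  proof (rule that[OF xL])
    fix g :: "real \<Rightarrow> 'v \<Rightarrow>\<^sub>L real" assume g: "g \<in> Lp T q"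
    have "\<Delta> g = 0"
    proof (rule functional_vanishing_on_indicators[OF \<Delta> q0 D(2) _ g])
      fix E \<eta> assume E: "E \<in> sets ?M" and \<eta>: "\<eta> \<in> D"
      have "pairing T (\<lambda>t. (indicator E t :: real) *\<^sub>R \<eta>) x = (LINT t|?M. indicator E t * r \<eta> t)"
        unfolding pairing_def
      proof (rule integral_cong_AE)
        show "(\<lambda>t. blinfun_apply ((indicator E t :: real) *\<^sub>R \<eta>) (x t)) \<in> borel_measurable ?M"
          by (rule borel_measurable_integrable[OF pairing_Holder(2)[OF p Find[OF E] xL]])
        show "AE t in ?M. blinfun_apply ((indicator E t :: real) *\<^sub>R \<eta>) (x t) = indicator E t * r \<eta> t"
          using good by eventually_elim (use x \<eta> in \<open>simp add: blinfun.scaleR_left\<close>)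
      qed (use ri[OF E] in auto)
      then show "\<Delta> (\<lambda>t. (indicator E t :: real) *\<^sub>R \<eta>) = 0" by (simp add: \<Delta>_def Fr[OF E])
    qed
    then show "F g = pairing T g x" by (simp add: \<Delta>_def)
  qed
qed

section \<open>Pointwise weak convergence\<close>

text \<open>The integral is given only as a relation witnessed by approximating simple functions, so
  linearity is obtained by combining the witnesses.\<close>

lemma has_bochner_int_lincomb:
  assumes f: "has_bochner_int M f I" and g: "has_bochner_int M g J" and cm: "complete_measure M"
  shows "has_bochner_int M (\<lambda>x. a *\<^sub>R f x + b *\<^sub>R g x) (a *\<^sub>R I + b *\<^sub>R J)"
proof -
  interpret complete_measure M by fact
  from f obtain s where f: "bochner_measurable M f"
    and s: "\<And>k. Bochner_Integration.simple_bochner_integrable M (s k)"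
    and s0: "(\<lambda>k. \<integral>\<^sup>+x. ennreal (norm (f x - s k x)) \<partial>M) \<longlonglongrightarrow> 0"
    and sI: "(\<lambda>k. Bochner_Integration.simple_bochner_integral M (s k)) \<longlonglongrightarrow> I"
    unfolding has_bochner_int_def by blast
  from g obtain r where g: "bochner_measurable M g"
    and r: "\<And>k. Bochner_Integration.simple_bochner_integrable M (r k)"
    and r0: "(\<lambda>k. \<integral>\<^sup>+x. ennreal (norm (g x - r k x)) \<partial>M) \<longlonglongrightarrow> 0"
    and rJ: "(\<lambda>k. Bochner_Integration.simple_bochner_integral M (r k)) \<longlonglongrightarrow> J"
    unfolding has_bochner_int_def by blast
  have sb: "bochner_measurable M (s k)" "bochner_measurable M (r k)" for k
    using s[of k] r[of k] by (auto intro: bochner_measurable_simple elim: Bochner_Integration.simple_bochner_integrable.cases)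
  have [measurable]: "(\<lambda>x. norm (f x - s k x)) \<in> borel_measurable M" "(\<lambda>x. norm (g x - r k x)) \<in> borel_measurable M" for k
    by (intro borel_measurable_norm_bochner bochner_measurable_diff f g sb)+
  have as: "Bochner_Integration.simple_bochner_integrable M (\<lambda>x. c *\<^sub>R u x)"
    if "Bochner_Integration.simple_bochner_integrable M u" for c and u :: "'a \<Rightarrow> 'b"
    using that that by (rule simple_bochner_integrable_compose2[where p = "\<lambda>x _. c *\<^sub>R x", rotated]) simp
  have sr: "Bochner_Integration.simple_bochner_integrable M (\<lambda>x. a *\<^sub>R s k x + b *\<^sub>R r k x)" for k
    using as[OF s] as[OF r] by (rule simple_bochner_integrable_compose2[where p = "(+)", rotated]) simp
  let ?e = "\<lambda>k. ennreal \<bar>a\<bar> * (\<integral>\<^sup>+x. ennreal (norm (f x - s k x)) \<partial>M) + ennreal \<bar>b\<bar> * (\<integral>\<^sup>+x. ennreal (norm (g x - r k x)) \<partial>M)"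
  have le: "(\<integral>\<^sup>+x. ennreal (norm (a *\<^sub>R f x + b *\<^sub>R g x - (a *\<^sub>R s k x + b *\<^sub>R r k x))) \<partial>M) \<le> ?e k" for k
  proof -
    have "(\<integral>\<^sup>+x. ennreal (norm (a *\<^sub>R f x + b *\<^sub>R g x - (a *\<^sub>R s k x + b *\<^sub>R r k x))) \<partial>M)
        \<le> (\<integral>\<^sup>+x. ennreal \<bar>a\<bar> * ennreal (norm (f x - s k x)) + ennreal \<bar>b\<bar> * ennreal (norm (g x - r k x)) \<partial>M)"
    proof (rule nn_integral_mono)
      fix x
      have "a *\<^sub>R f x + b *\<^sub>R g x - (a *\<^sub>R s k x + b *\<^sub>R r k x) = a *\<^sub>R (f x - s k x) + b *\<^sub>R (g x - r k x)"
        by (simp add: scaleR_diff_right)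
      then have "norm (a *\<^sub>R f x + b *\<^sub>R g x - (a *\<^sub>R s k x + b *\<^sub>R r k x)) \<le> \<bar>a\<bar> * norm (f x - s k x) + \<bar>b\<bar> * norm (g x - r k x)"
        by (metis norm_scaleR norm_triangle_ineq)
      then show "ennreal (norm (a *\<^sub>R f x + b *\<^sub>R g x - (a *\<^sub>R s k x + b *\<^sub>R r k x)))
          \<le> ennreal \<bar>a\<bar> * ennreal (norm (f x - s k x)) + ennreal \<bar>b\<bar> * ennreal (norm (g x - r k x))"
        by (metis abs_ge_zero ennreal_leI ennreal_mult' ennreal_plus norm_ge_zero mult_nonneg_nonneg)
    qed
    also have "\<dots> = ?e k" by (simp add: nn_integral_add nn_integral_cmult)
    finally show ?thesis .
  qed
  have "?e \<longlonglongrightarrow> ennreal \<bar>a\<bar> * 0 + ennreal \<bar>b\<bar> * 0"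
    by (rule tendsto_add[OF ennreal_tendsto_cmult[OF _ s0] ennreal_tendsto_cmult[OF _ r0]]) simp_all
  then have lim: "?e \<longlonglongrightarrow> 0" by simp
  have 0: "(\<lambda>k. \<integral>\<^sup>+x. ennreal (norm (a *\<^sub>R f x + b *\<^sub>R g x - (a *\<^sub>R s k x + b *\<^sub>R r k x))) \<partial>M) \<longlonglongrightarrow> 0"
    by (rule tendsto_sandwich[OF _ _ tendsto_const lim])
       (rule always_eventually, rule allI, simp, rule always_eventually, rule allI, rule le)
  have lin: "Bochner_Integration.simple_bochner_integral M (\<lambda>x. c *\<^sub>R u x) = c *\<^sub>R Bochner_Integration.simple_bochner_integral M u"
    if "Bochner_Integration.simple_bochner_integrable M u" for c and u :: "'a \<Rightarrow> 'b"
    using linear_scale_self by (intro simple_bochner_integral_linear that) (rule linear_scaleR)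
  have "(\<lambda>k. Bochner_Integration.simple_bochner_integral M (\<lambda>x. a *\<^sub>R s k x + b *\<^sub>R r k x)) \<longlonglongrightarrow> a *\<^sub>R I + b *\<^sub>R J"
    unfolding simple_bochner_integral_add[OF as[OF s] as[OF r]] lin[OF s] lin[OF r]
    by (intro tendsto_add tendsto_scaleR tendsto_const sI rJ)
  moreover have "bochner_measurable M (\<lambda>x. a *\<^sub>R f x + b *\<^sub>R g x)"
    by (intro bochner_measurable_add bochner_measurable_scaleR f g) simp_all
  ultimately show ?thesis using 0 sr
    unfolding has_bochner_int_def by (intro conjI exI[of _ "\<lambda>k x. a *\<^sub>R s k x + b *\<^sub>R r k x"] allI)
qed

lemma has_gen_deriv_lincomb:
  assumes e: "linear e" and f: "has_gen_deriv e T f f'" and g: "has_gen_deriv e T g g'"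
  shows "has_gen_deriv e T (\<lambda>t. a *\<^sub>R f t + b *\<^sub>R g t) (\<lambda>t. a *\<^sub>R f' t + b *\<^sub>R g' t)"
  unfolding has_gen_deriv_def
proof (intro allI impI)
  fix \<phi> assume \<phi>: "test_function T \<phi>"
  let ?M = "lebesgue_on {0..T}"
  from f \<phi> obtain I J where 1: "has_bochner_int ?M (\<lambda>t. deriv \<phi> t *\<^sub>R f t) I" "has_bochner_int ?M (\<lambda>t. \<phi> t *\<^sub>R f' t) J" "e I = - J"
    unfolding has_gen_deriv_def by blast
  from g \<phi> obtain I' J' where 2: "has_bochner_int ?M (\<lambda>t. deriv \<phi> t *\<^sub>R g t) I'" "has_bochner_int ?M (\<lambda>t. \<phi> t *\<^sub>R g' t) J'" "e I' = - J'"
    unfolding has_gen_deriv_def by blast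
  have "has_bochner_int ?M (\<lambda>t. deriv \<phi> t *\<^sub>R (a *\<^sub>R f t + b *\<^sub>R g t)) (a *\<^sub>R I + b *\<^sub>R I')"
    using has_bochner_int_lincomb[OF 1(1) 2(1) complete_measure_interval, of a b] by (simp add: scaleR_add_right mult.commute)
  moreover have "has_bochner_int ?M (\<lambda>t. \<phi> t *\<^sub>R (a *\<^sub>R f' t + b *\<^sub>R g' t)) (a *\<^sub>R J + b *\<^sub>R J')"
    using has_bochner_int_lincomb[OF 1(2) 2(2) complete_measure_interval, of a b] by (simp add: scaleR_add_right mult.commute)
  moreover have "e (a *\<^sub>R I + b *\<^sub>R I') = - (a *\<^sub>R J + b *\<^sub>R J')"
    using 1(3) 2(3) by (simp add: linear_add[OF e] linear_scale[OF e])
  ultimately show "\<exists>I J. has_bochner_int ?M (\<lambda>t. deriv \<phi> t *\<^sub>R (a *\<^sub>R f t + b *\<^sub>R g t)) I \<and>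
      has_bochner_int ?M (\<lambda>t. \<phi> t *\<^sub>R (a *\<^sub>R f' t + b *\<^sub>R g' t)) J \<and> e I = - J" by blast
qed

lemma bump_test_function:
  assumes "0 < a" "b < T"
  shows "test_function T (bump a b k)"
  unfolding test_function_def
proof (intro conjI allI)
  show "((deriv ^^ n) (bump a b k)) field_differentiable at t" for n t
    by (rule flat_algebra_smooth[OF bump_flat_algebra])
  show "\<exists>K. compact K \<and> K \<subseteq> {0<..<T} \<and> (\<forall>t. t \<notin> K \<longrightarrow> bump a b k t = 0)"
    using assms by (intro exI[of _ "{a..b}"]) (auto simp: bump_support)
qed

text \<open>\<open>gen_deriv\<close> is a chosen representative and therefore not literally linear.
  Uniqueness of the scalar derivatives obtained by testing with an element of \<open>Z\<close>
  restores linearity almost everywhere.\<close>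

lemma weak_derivative_unique:
  fixes f g :: "real \<Rightarrow> real"
  assumes T: "0 < T" and f: "integrable (lebesgue_on {0..T}) f" and g: "integrable (lebesgue_on {0..T}) g"
    and eq: "\<And>\<phi>. test_function T \<phi> \<Longrightarrow> (LINT t|lebesgue_on {0..T}. \<phi> t * f t) = (LINT t|lebesgue_on {0..T}. \<phi> t * g t)"
  shows "AE t in lebesgue_on {0..T}. f t = g t"
proof -
  let ?M = "lebesgue_on {0..T}"
  have "AE t in ?M. f t - g t = 0"
  proof (rule AE_zero_of_interval_integrals[OF T])
    show "integrable ?M (\<lambda>t. f t - g t)" using f g by simp
    fix a b assume ab: "0 < a" "a < b" "b < T"
    have "(\<lambda>k. LINT t|?M. bump a b k t * (f t - g t)) \<longlonglongrightarrow> (LINT t|?M. indicator {a<..<b} t * (f t - g t))"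
      by (intro integral_bump(2) Bochner_Integration.integrable_diff f g)
    moreover have "(LINT t|?M. bump a b k t * (f t - g t)) = 0" for k
      using eq[OF bump_test_function[OF ab(1,3)], of k] integral_bump(1)[OF f] integral_bump(1)[OF g] by (simp add: right_diff_distrib)
    ultimately show "(LINT t|?M. indicator {a<..<b} t * (f t - g t)) = 0"
      using LIMSEQ_unique[OF tendsto_const] by fastforce
  qed
  then show ?thesis by eventually_elim simp
qed

text \<open>The transpose of \<open>dual_embedding\<close>: the functional on \<open>V\<close> that
  a point of \<open>Z\<close> induces through \<open>H\<close>. The generalized derivative takes
  values in the dual of \<open>Z\<close>, so these are the functionals for which the scalar function
  has a weak derivative.\<close>

definition dual_element ::
  "('v::real_normed_vector \<Rightarrow>\<^sub>L 'h::real_inner) \<Rightarrow> ('z::real_normed_vector \<Rightarrow>\<^sub>L 'v) \<Rightarrow> 'z \<Rightarrow> 'v \<Rightarrow>\<^sub>L real" where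
  "dual_element i j z = blinfun_inner_left (blinfun_apply i (blinfun_apply j z)) o\<^sub>L i"

lemma dual_element_apply: "blinfun_apply (dual_element i j z) v = blinfun_apply (dual_embedding i j v) z"
  by (simp add: dual_element_def dual_embedding_def inner_commute)

lemma dual_element_inner: "blinfun_apply (dual_element i j z) v = blinfun_apply i v \<bullet> blinfun_apply i (blinfun_apply j z)"
  by (simp add: dual_element_apply dual_embedding_def)

lemma bounded_linear_dual_element: "bounded_linear (dual_element i j)"
  unfolding dual_element_def
  by (rule bounded_linear_compose[OF bounded_bilinear.bounded_linear_left[OF bounded_bilinear_blinfun_compose]
      bounded_linear_compose[OF bounded_linear_blinfun_inner_left
        bounded_linear_compose[OF blinfun.bounded_linear_right blinfun.bounded_linear_right]]])

lemma linear_dual_embedding: "linear (dual_embedding i j)"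
  by (intro linearI blinfun_eqI)
     (simp_all add: dual_embedding_def blinfun.add_left blinfun.add_right inner_add_left blinfun.scaleR_left blinfun.scaleR_right)

text \<open>By reflexivity an annihilator of these functionals is a point \<open>x\<close> with
  \<open>i x\<close> orthogonal to the image of \<open>Z\<close>. Density of \<open>j\<close> allows
  testing with \<open>x\<close> itself, so \<open>i x = 0\<close>, and injectivity gives
  \<open>x = 0\<close>.\<close>

lemma dual_elements_dense:
  fixes i :: "'v::banach \<Rightarrow>\<^sub>L 'h::real_inner" and j :: "'z::real_normed_vector \<Rightarrow>\<^sub>L 'v"
  assumes reflex: "reflexive TYPE('v)" and i: "inj (blinfun_apply i)" and j: "closure (range (blinfun_apply j)) = UNIV"
  shows "closure (range (dual_element i j)) = UNIV"
proof (rule ccontr)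
  assume nd: "closure (range (dual_element i j)) \<noteq> UNIV"
  have "linear (dual_element i j)" using bounded_linear_dual_element by (rule bounded_linear.linear)
  then have "subspace (range (dual_element i j))" by (rule linear_subspace_image) simp
  then obtain \<Phi> :: "('v \<Rightarrow>\<^sub>L real) \<Rightarrow>\<^sub>L real" where \<Phi>: "\<Phi> \<noteq> 0"
    "\<And>y. y \<in> range (dual_element i j) \<Longrightarrow> blinfun_apply \<Phi> y = 0"
    using subspace_not_dense_annihilator nd by blast
  obtain x where x: "\<And>\<xi>. blinfun_apply \<Phi> \<xi> = blinfun_apply \<xi> x"
    using reflexive_representation[OF reflex] by blast
  have "blinfun_apply i x \<bullet> blinfun_apply i (blinfun_apply j z) = 0" for z
    using \<Phi>(2)[of "dual_element i j z"] x[of "dual_element i j z"] by (simp add: dual_element_inner)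
  then have "range (blinfun_apply j) \<subseteq> {y. blinfun_apply i x \<bullet> blinfun_apply i y = 0}" by auto
  moreover have "closed {y. blinfun_apply i x \<bullet> blinfun_apply i y = 0}"
    by (intro closed_Collect_eq continuous_intros)
  ultimately have "closure (range (blinfun_apply j)) \<subseteq> {y. blinfun_apply i x \<bullet> blinfun_apply i y = 0}"
    by (rule closure_minimal)
  then have "x \<in> {y. blinfun_apply i x \<bullet> blinfun_apply i y = 0}" using j by blast
  then have "blinfun_apply i x = blinfun_apply i 0" by (simp add: blinfun.zero_right)
  then have "x = 0" by (rule injD[OF i])
  then have "\<Phi> = 0" by (intro blinfun_eqI) (simp add: x blinfun.zero_right)
  with \<Phi>(1) show False ..
qed

text \<open>The representation formula defines \<open>G s\<close> for every \<open>s\<close> as a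
  bounded functional, to which weak convergence applies. For each fixed element it equals the value
  at almost every \<open>s\<close>, and only the countably many elements \<open>v n\<close> and
  \<open>v0\<close> are involved, so the exceptional null sets can be united.\<close>

theorem weak_W1_convergence_pointwise:
  fixes i :: "'v::{banach, second_countable_topology} \<Rightarrow>\<^sub>L 'h::real_inner" and j :: "'z::banach \<Rightarrow>\<^sub>L 'v"
  assumes T: "0 < T" and p: "1 < p" "1 / p + 1 / q = 1"
    and conv: "weakly_converges_in (W1 (dual_embedding i j) T p q) (W1_norm (dual_embedding i j) T p q) v v0"
  shows "AE s in lebesgue_on {0..T}. (\<lambda>n. blinfun_apply (dual_element i j z) (v n s)) \<longlonglongrightarrow> blinfun_apply (dual_element i j z) (v0 s)"
proof -
  let ?M = "lebesgue_on {0..T}" and ?e = "dual_embedding i j"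
  let ?\<eta> = "dual_element i j z" and ?W = "W1 (dual_embedding i j) T p q"
  interpret finite_measure ?M by (rule finite_measure_interval)
  note q = conjugate_exponent[OF p]
  define d where "d u t = blinfun_apply (gen_deriv ?e T q u t) z" for u t
  have gd: "gen_deriv ?e T q u \<in> Lp T q" "has_gen_deriv ?e T u (gen_deriv ?e T q u)" if "u \<in> ?W" for u
  proof -
    have "\<exists>g. g \<in> Lp T q \<and> has_gen_deriv ?e T u g" using that by (auto simp: W1_def)
    then have "gen_deriv ?e T q u \<in> Lp T q \<and> has_gen_deriv ?e T u (gen_deriv ?e T q u)"
      unfolding gen_deriv_def by (rule someI_ex)
    then show "gen_deriv ?e T q u \<in> Lp T q" "has_gen_deriv ?e T u (gen_deriv ?e T q u)" by auto
  qed
  have uL: "u \<in> Lp T p" if "u \<in> ?W" for u using that by (simp add: W1_def)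
  have weak: "(LINT t|?M. deriv \<phi> t * blinfun_apply ?\<eta> (u t)) = - (LINT t|?M. \<phi> t * blinfun_apply (g t) z)"
    if \<phi>: "test_function T \<phi>" and g: "has_gen_deriv ?e T u g" for \<phi> u g
  proof -
    obtain I J where I: "has_bochner_int ?M (\<lambda>t. deriv \<phi> t *\<^sub>R u t) I"
      and J: "has_bochner_int ?M (\<lambda>t. \<phi> t *\<^sub>R g t) J" and IJ: "?e I = - J"
      using g \<phi> unfolding has_gen_deriv_def by blast
    let ?ev = "Blinfun (\<lambda>f :: 'z \<Rightarrow>\<^sub>L real. blinfun_apply f z)"
    have ev: "blinfun_apply ?ev f = blinfun_apply f z" for f
      by (simp add: bounded_linear_Blinfun_apply blinfun.bounded_linear_left)
    have "(LINT t|?M. deriv \<phi> t * blinfun_apply ?\<eta> (u t)) = blinfun_apply ?\<eta> I"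
      using has_bochner_integral_integral_eq[OF has_bochner_int_blinfun[OF I complete_measure_interval, of ?\<eta>]]
      by (simp add: blinfun.scaleR_right)
    also have "\<dots> = - blinfun_apply J z" by (simp add: dual_element_apply IJ blinfun.minus_left)
    also have "blinfun_apply J z = (LINT t|?M. \<phi> t * blinfun_apply (g t) z)"
      using has_bochner_integral_integral_eq[OF has_bochner_int_blinfun[OF J complete_measure_interval, of ?ev]]
      by (simp add: ev blinfun.scaleR_left)
    finally show ?thesis .
  qed
  have w_le: "\<bar>blinfun_apply ?\<eta> (u t)\<bar> \<le> norm ?\<eta> * norm (u t)" for u :: "real \<Rightarrow> 'v" and t
    using norm_blinfun[of ?\<eta> "u t"] by simp
  have d_le: "\<bar>blinfun_apply (g t) z\<bar> \<le> norm z * norm (g t)" for g :: "real \<Rightarrow> 'z \<Rightarrow>\<^sub>L real" and t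
    using norm_blinfun[of "g t" z] by (simp add: mult.commute)
  have w_int: "integrable ?M (\<lambda>t. blinfun_apply ?\<eta> (u t))" if u: "u \<in> Lp T p" for u
  proof (rule Bochner_Integration.integrable_bound)
    show "integrable ?M (\<lambda>t. norm ?\<eta> * norm (u t))" using Lp_integrable(1)[OF u p(1)] by simp
    show "(\<lambda>t. blinfun_apply ?\<eta> (u t)) \<in> borel_measurable ?M"
      by (intro complete_measure.borel_measurable_pairing complete_measure_interval bochner_measurable_const LpD(1)[OF u])
    show "AE t in ?M. norm (blinfun_apply ?\<eta> (u t)) \<le> norm (norm ?\<eta> * norm (u t))" using w_le by simp
  qed
  have g_int: "integrable ?M (\<lambda>t. blinfun_apply (g t) z)" if g: "g \<in> Lp T q" for g :: "real \<Rightarrow> 'z \<Rightarrow>\<^sub>L real"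
  proof (rule Bochner_Integration.integrable_bound)
    show "integrable ?M (\<lambda>t. norm z * norm (g t))" using Lp_integrable(1)[OF g q(1)] by simp
    show "(\<lambda>t. blinfun_apply (g t) z) \<in> borel_measurable ?M"
      by (intro complete_measure.borel_measurable_pairing complete_measure_interval bochner_measurable_const LpD(1)[OF g])
    show "AE t in ?M. norm (blinfun_apply (g t) z) \<le> norm (norm z * norm (g t))" using d_le by simp
  qed
  have d_int: "integrable ?M (d u)" if "u \<in> ?W" for u
    unfolding d_def by (rule g_int[OF gd(1)[OF that]])
  obtain \<rho> R :: "real \<Rightarrow> real" and B where \<rho>M[measurable]: "\<rho> \<in> borel_measurable ?M" and RM[measurable]: "R \<in> borel_measurable ?M"
    and \<rho>B: "\<And>t. \<bar>\<rho> t\<bar> \<le> B" and RB: "\<And>t. t \<in> {0..T} \<Longrightarrow> \<bar>R t\<bar> \<le> 1"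
    and rep: "\<And>w g. integrable ?M w \<Longrightarrow> integrable ?M g \<Longrightarrow>
      (\<And>\<phi>. test_function T \<phi> \<Longrightarrow> (LINT t|?M. deriv \<phi> t * w t) = - (LINT t|?M. \<phi> t * g t)) \<Longrightarrow>
      AE s in ?M. w s = (LINT t|?M. \<rho> t * w t) + (LINT t|?M. (R t - (if s \<le> t then 1 else 0)) * g t)"
    using weak_derivative_representation[OF T] by blast
  have B: "0 \<le> B" using \<rho>B[of 0] by simp
  let ?K = "\<lambda>s t. R t - (if s \<le> t then 1 else 0)"
  note borel_measurable_id_interval[measurable]
  have KB: "\<bar>?K s t\<bar> \<le> 2" if "t \<in> space ?M" for s t using RB[of t] that by (auto simp: space_restrict_space)
  have KM: "?K s \<in> borel_measurable ?M" for s by measurable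
  note \<rho>w = integrable_mult_bounded[OF \<rho>M _ \<rho>B] and Kw = integrable_mult_bounded[OF KM _ KB]
  define G where "G s u = (LINT t|?M. \<rho> t * blinfun_apply ?\<eta> (u t)) + (LINT t|?M. ?K s t * d u t)" for s u
  have d_unique: "AE t in ?M. d u t = blinfun_apply (g t) z"
    if u: "u \<in> ?W" and g: "g \<in> Lp T q" "has_gen_deriv ?e T u g" for u g
  proof (rule weak_derivative_unique[OF T d_int[OF u] g_int[OF g(1)]])
    fix \<phi> assume \<phi>: "test_function T \<phi>"
    show "(LINT t|?M. \<phi> t * d u t) = (LINT t|?M. \<phi> t * blinfun_apply (g t) z)"
      using weak[OF \<phi> gd(2)[OF u]] weak[OF \<phi> g(2)] by (simp add: d_def)
  qed
  have K_cong: "(LINT t|?M. ?K s t * f t) = (LINT t|?M. ?K s t * g t)"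
    if "integrable ?M f" "integrable ?M g" "AE t in ?M. f t = g t" for s f g
    using Kw(1)[OF that(1), of s] Kw(1)[OF that(2), of s] that(3)
    by (intro integral_cong_AE) (auto elim: eventually_mono)
  have G: "bounded_functional_on ?W (W1_norm ?e T p q) (G s)" for s
    unfolding bounded_functional_on_def
  proof (intro conjI ballI allI)
    have p0: "0 < p" "0 < q" using p q by auto
    \<comment> \<open>The derivative chosen for the combination agrees with the combination of the
      chosen derivatives only almost everywhere after testing, hence the detour through
      \<open>d_unique\<close>.\<close>
    have lin: "G s (\<lambda>t. a *\<^sub>R f t + b *\<^sub>R g t) = a * G s f + b * G s g" if f: "f \<in> ?W" and g: "g \<in> ?W" for a b f g
    proof -
      let ?u = "\<lambda>t. a *\<^sub>R f t + b *\<^sub>R g t"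
      have h: "(\<lambda>t. a *\<^sub>R gen_deriv ?e T q f t + b *\<^sub>R gen_deriv ?e T q g t) \<in> Lp T q"
        "has_gen_deriv ?e T ?u (\<lambda>t. a *\<^sub>R gen_deriv ?e T q f t + b *\<^sub>R gen_deriv ?e T q g t)"
        by (intro Lp_add Lp_scaleR gd f g p0) (intro has_gen_deriv_lincomb gd f g linear_dual_embedding)
      have "?u \<in> Lp T p" by (intro Lp_add Lp_scaleR uL f g p0)
      with h have W: "?u \<in> ?W" by (auto simp: W1_def)
      have "AE t in ?M. d ?u t = a * d f t + b * d g t"
        using d_unique[OF W h] by (simp add: d_def blinfun.add_left blinfun.scaleR_left)
      then have "(LINT t|?M. ?K s t * d ?u t) = (LINT t|?M. ?K s t * (a * d f t + b * d g t))"
        by (intro K_cong d_int W Bochner_Integration.integrable_add integrable_mult_right f g)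
      also have "\<dots> = a * (LINT t|?M. ?K s t * d f t) + b * (LINT t|?M. ?K s t * d g t)"
        using Kw(1)[OF d_int[OF f], of s] Kw(1)[OF d_int[OF g], of s]
        unfolding distrib_left mult.left_commute[of _ a] mult.left_commute[of _ b]
        by (subst Bochner_Integration.integral_add) (intro integrable_mult_right, assumption, intro integrable_mult_right, assumption, simp only: integral_mult_right_zero)
      finally have K: "(LINT t|?M. ?K s t * d ?u t) = a * (LINT t|?M. ?K s t * d f t) + b * (LINT t|?M. ?K s t * d g t)" .
      have "(LINT t|?M. \<rho> t * blinfun_apply ?\<eta> (?u t)) = a * (LINT t|?M. \<rho> t * blinfun_apply ?\<eta> (f t)) + b * (LINT t|?M. \<rho> t * blinfun_apply ?\<eta> (g t))"
        using \<rho>w(1)[OF w_int[OF uL[OF f]]] \<rho>w(1)[OF w_int[OF uL[OF g]]]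
        by (simp add: blinfun.add_right blinfun.scaleR_right distrib_left mult.left_commute[of _ a] mult.left_commute[of _ b])
      then show ?thesis unfolding G_def K by (simp add: distrib_left)
    qed
    show "G s (\<lambda>t. f t + g t) = G s f + G s g" if "f \<in> ?W" "g \<in> ?W" for f g
      using lin[OF that, of 1 1] by simp
    show "G s (\<lambda>t. a *\<^sub>R f t) = a * G s f" if "f \<in> ?W" for a f
      using lin[OF that that, of a 0] by simp
    let ?m = "LINT t|?M. 1"
    \<comment> \<open>Each summand is the kernel bound, times the norm of the tested vector, times
      the embedding constant of the Lebesgue space into \<open>L^1\<close>.\<close>
    define c where "c = B * norm ?\<eta> * ?m powr (1 - 1 / p) + 2 * norm z * ?m powr (1 - 1 / q)"
    show "\<exists>C. \<forall>f\<in>?W. \<bar>G s f\<bar> \<le> C * W1_norm ?e T p q f"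
    proof (intro exI ballI)
      fix f assume f: "f \<in> ?W"
      let ?g = "gen_deriv ?e T q f"
      have "\<bar>LINT t|?M. \<rho> t * blinfun_apply ?\<eta> (f t)\<bar> \<le> B * (LINT t|?M. \<bar>blinfun_apply ?\<eta> (f t)\<bar>)"
        by (rule \<rho>w(2)[OF w_int[OF uL[OF f]]])
      also have "\<dots> \<le> B * (LINT t|?M. norm ?\<eta> * norm (f t))"
        using w_int[OF uL[OF f]] Lp_integrable(1)[OF uL[OF f] p(1)]
        by (intro mult_left_mono B integral_mono w_le) auto
      also have "\<dots> = B * norm ?\<eta> * (LINT t|?M. norm (f t))" by simp
      also have "\<dots> \<le> B * norm ?\<eta> * (?m powr (1 - 1 / p) * Lp_norm T p f)"
        using B by (intro mult_left_mono Lp_integrable(2) uL f p) auto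
      finally have 1: "\<bar>LINT t|?M. \<rho> t * blinfun_apply ?\<eta> (f t)\<bar> \<le> B * norm ?\<eta> * ?m powr (1 - 1 / p) * Lp_norm T p f"
        by (simp add: mult.assoc)
      have "\<bar>LINT t|?M. ?K s t * d f t\<bar> \<le> 2 * (LINT t|?M. \<bar>d f t\<bar>)"
        by (rule Kw(2)[OF d_int[OF f]])
      also have "\<dots> \<le> 2 * (LINT t|?M. norm z * norm (?g t))"
        using integrable_abs[OF d_int[OF f]] Lp_integrable(1)[OF gd(1)[OF f] q(1)] d_le[of ?g]
        by (intro mult_left_mono integral_mono) (simp_all add: d_def)
      also have "\<dots> = 2 * norm z * (LINT t|?M. norm (?g t))" by simp
      also have "\<dots> \<le> 2 * norm z * (?m powr (1 - 1 / q) * Lp_norm T q ?g)"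
        by (intro mult_left_mono Lp_integrable(2) gd f q) auto
      finally have 2: "\<bar>LINT t|?M. ?K s t * d f t\<bar> \<le> 2 * norm z * ?m powr (1 - 1 / q) * Lp_norm T q ?g"
        by (simp add: mult.assoc)
      have c1: "B * norm ?\<eta> * ?m powr (1 - 1 / p) \<le> c" "2 * norm z * ?m powr (1 - 1 / q) \<le> c"
        unfolding c_def using B by auto
      have "\<bar>G s f\<bar> \<le> \<bar>LINT t|?M. \<rho> t * blinfun_apply ?\<eta> (f t)\<bar> + \<bar>LINT t|?M. ?K s t * d f t\<bar>"
        unfolding G_def by (rule abs_triangle_ineq)
      also have "\<dots> \<le> c * Lp_norm T p f + c * Lp_norm T q ?g"
        using mult_right_mono[OF c1(1) Lp_norm_nonneg[of T p f]] mult_right_mono[OF c1(2) Lp_norm_nonneg[of T q ?g]] 1 2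
        by linarith
      finally show "\<bar>G s f\<bar> \<le> c * W1_norm ?e T p q f" by (simp add: W1_norm_def distrib_left)
    qed
  qed
  have Geq: "AE s in ?M. blinfun_apply ?\<eta> (u s) = G s u" if u: "u \<in> ?W" for u
    unfolding G_def
    by (rule rep[OF w_int[OF uL[OF u]] d_int[OF u]]) (simp only: d_def weak[OF _ gd(2)[OF u]])
  have W: "v n \<in> ?W" "v0 \<in> ?W" for n using conv by (auto simp: weakly_converges_in_def)
  have lim: "(\<lambda>n. G s (v n)) \<longlonglongrightarrow> G s v0" for s
    using conv G[of s] by (simp add: weakly_converges_in_def)
  have "AE s in ?M. \<forall>n. blinfun_apply ?\<eta> (v n s) = G s (v n)"
    by (intro AE_all_countable[THEN iffD2] allI Geq W)
  with Geq[OF W(2)] show ?thesis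
  proof eventually_elim
    case (elim s)
    then show ?case using lim[of s] by simp
  qed
qed

section \<open>Pseudo-monotonicity of the induced operator\<close>

text \<open>The positive part of \<open>f0 - f n\<close> tends to zero and is dominated by
  \<open>\<bar>f0 + k\<bar>\<close>. Dominated convergence thus replaces Fatou's lemma and keeps all
  integrals real, although the liminf itself may be infinite.\<close>

lemma fatou_lower_bound:
  fixes f :: "nat \<Rightarrow> 'a \<Rightarrow> real"
  assumes f: "\<And>n. integrable M (f n)" and f0: "integrable M f0" and k: "integrable M k"
    and lower: "\<And>n. AE t in M. - k t \<le> f n t"
    and liminf: "AE t in M. ereal (f0 t) \<le> liminf (\<lambda>n. ereal (f n t))"
    and upper: "\<And>n. (LINT t|M. f n t) \<le> c"
  shows "(LINT t|M. f0 t) \<le> c"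
proof -
  have [measurable]: "f n \<in> borel_measurable M" "f0 \<in> borel_measurable M" for n using f f0 by auto
  have int: "integrable M (\<lambda>t. max 0 (f0 t - f n t))" for n
    by (intro integrable_max Bochner_Integration.integrable_diff f f0 integrable_zero)
  have "(\<lambda>n. LINT t|M. max 0 (f0 t - f n t)) \<longlonglongrightarrow> (LINT t|M. 0)"
  proof (rule integral_dominated_convergence[where w = "\<lambda>t. \<bar>f0 t + k t\<bar>"])
    show "integrable M (\<lambda>t. \<bar>f0 t + k t\<bar>)" using f0 k by simp
    show "AE t in M. norm (max 0 (f0 t - f n t)) \<le> \<bar>f0 t + k t\<bar>" for n
      using lower[of n] by eventually_elim (simp add: abs_if max_def)
    show "AE t in M. (\<lambda>n. max 0 (f0 t - f n t)) \<longlonglongrightarrow> 0"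
      using liminf
    proof eventually_elim
      case (elim t)
      show ?case
      proof (rule LIMSEQ_I)
        fix e :: real assume e: "0 < e"
        have "ereal (f0 t - e) < ereal (f0 t)" using e by simp
        with elim have "\<forall>\<^sub>F n in sequentially. ereal (f0 t - e) < ereal (f n t)"
          unfolding le_Liminf_iff by blast
        then have "\<forall>\<^sub>F n in sequentially. norm (max 0 (f0 t - f n t) - 0) < e"
          by eventually_elim (use e in \<open>auto simp: max_def\<close>)
        then show "\<exists>N. \<forall>n\<ge>N. norm (max 0 (f0 t - f n t) - 0) < e"
          by (simp add: eventually_sequentially)
      qed
    qed
  qed auto
  then have lim: "(\<lambda>n. LINT t|M. max 0 (f0 t - f n t)) \<longlonglongrightarrow> 0" by simp
  have "(LINT t|M. f0 t) - c \<le> (LINT t|M. max 0 (f0 t - f n t))" for n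
  proof -
    have "(LINT t|M. f0 t) - c \<le> (LINT t|M. f0 t) - (LINT t|M. f n t)" using upper[of n] by simp
    also have "\<dots> = (LINT t|M. f0 t - f n t)" using f f0 by simp
    also have "\<dots> \<le> (LINT t|M. max 0 (f0 t - f n t))"
      using f f0 by (intro integral_mono int) auto
    finally show ?thesis .
  qed
  then have "(LINT t|M. f0 t) - c \<le> 0" by (intro LIMSEQ_le_const[OF lim]) auto
  then show ?thesis by simp
qed

text \<open>Either \<open>C * b\<close> is at most \<open>d * a\<close>, and the last factor can be
  absorbed into the power of \<open>a\<close>, or \<open>a\<close> is below
  \<open>C / d * b\<close>, and everything is bounded by the power of \<open>b\<close>. The explicit
  constant comes from the second case.\<close>

lemma powr_absorb:
  fixes a b C d p :: real
  assumes "0 \<le> a" "0 \<le> b" "0 < C" "0 < d" "1 < p"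
  shows "C * a powr (p - 1) * b \<le> d * a powr p + C * (C / d) powr (p - 1) * b powr p"
proof -
  have split: "x powr (p - 1) * x = x powr p" if "0 \<le> x" for x :: real
  proof (cases "x = 0")
    case False
    then have "x powr (p - 1) * x powr 1 = x powr p" by (subst powr_add[symmetric]) simp
    then show ?thesis using that False by simp
  qed simp
  show ?thesis
  proof (cases "C * b \<le> d * a")
    case True
    have "C * a powr (p - 1) * b = a powr (p - 1) * (C * b)" by simp
    also have "\<dots> \<le> a powr (p - 1) * (d * a)" using True by (intro mult_left_mono) auto
    also have "\<dots> = d * a powr p" using split[OF assms(1)] by (simp add: mult.left_commute)
    finally show ?thesis using assms by (simp add: add_increasing2)
  next
    case False
    then have "a \<le> C / d * b" using assms by (simp add: field_simps)
    then have "a powr (p - 1) \<le> (C / d * b) powr (p - 1)" using assms by (intro powr_mono2) auto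
    also have "\<dots> = (C / d) powr (p - 1) * b powr (p - 1)" by (rule powr_mult)
    finally have "C * (a powr (p - 1) * b) \<le> C * ((C / d) powr (p - 1) * b powr (p - 1) * b)"
      using assms by (intro mult_left_mono mult_right_mono) auto
    also have "\<dots> = C * (C / d) powr (p - 1) * b powr p" using split[OF assms(2)] by (simp add: mult.assoc)
    finally show ?thesis using assms by (simp add: mult.assoc add_increasing)
  qed
qed

lemma weakly_converges_if_dense:
  fixes x :: "nat \<Rightarrow> 'a::real_normed_vector" and \<xi> :: "nat \<Rightarrow> 'a \<Rightarrow>\<^sub>L real"
  assumes dense: "closure (range \<xi>) = UNIV" and bound: "\<And>n. norm (x n) \<le> B"
    and lim: "\<And>k. (\<lambda>n. blinfun_apply (\<xi> k) (x n)) \<longlonglongrightarrow> blinfun_apply (\<xi> k) x0"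
  shows "weakly_converges x x0"
  unfolding weakly_converges_def
proof
  fix \<eta> :: "'a \<Rightarrow>\<^sub>L real"
  \<comment> \<open>The maximum with 1 makes \<open>B'\<close> a positive divisor even if all
    vectors vanish.\<close>
  define B' where "B' = max 1 (B + norm x0)"
  have B': "0 < B'" "\<And>n. norm (x n) + norm x0 \<le> B'"
  proof -
    show "0 < B'" by (simp add: B'_def)
    show "norm (x n) + norm x0 \<le> B'" for n using bound[of n] unfolding B'_def by linarith
  qed
  show "(\<lambda>n. blinfun_apply \<eta> (x n)) \<longlonglongrightarrow> blinfun_apply \<eta> x0"
  proof (rule LIMSEQ_I)
    fix e :: real assume e: "0 < e"
    have "\<eta> \<in> closure (range \<xi>)" using dense by simp
    moreover have "0 < e / (2 * B')" using e B' by simp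
    ultimately obtain k where k: "dist (\<xi> k) \<eta> < e / (2 * B')"
      unfolding closure_approachable by blast
    obtain N where N: "\<And>n. n \<ge> N \<Longrightarrow> norm (blinfun_apply (\<xi> k) (x n) - blinfun_apply (\<xi> k) x0) < e / 2"
      using LIMSEQ_D[OF lim[of k], of "e / 2"] e by auto
    have "norm (blinfun_apply \<eta> (x n) - blinfun_apply \<eta> x0) < e" if "n \<ge> N" for n
    proof -
      have "blinfun_apply \<eta> (x n) - blinfun_apply \<eta> x0
          = blinfun_apply (\<eta> - \<xi> k) (x n - x0) + (blinfun_apply (\<xi> k) (x n) - blinfun_apply (\<xi> k) x0)"
        by (simp add: blinfun.diff_left blinfun.diff_right)
      also have "norm \<dots> \<le> norm (\<eta> - \<xi> k) * norm (x n - x0) + norm (blinfun_apply (\<xi> k) (x n) - blinfun_apply (\<xi> k) x0)"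
        by (intro order.trans[OF norm_triangle_ineq] add_mono norm_blinfun order.refl)
      also have "norm (\<eta> - \<xi> k) * norm (x n - x0) \<le> e / (2 * B') * B'"
      proof (rule mult_mono)
        show "norm (\<eta> - \<xi> k) \<le> e / (2 * B')" using k by (simp add: dist_norm norm_minus_commute)
        show "norm (x n - x0) \<le> B'" using norm_triangle_ineq4[of "x n" x0] B'(2)[of n] by linarith
        show "0 \<le> e / (2 * B')" using e B'(1) by simp
      qed simp
      also have "e / (2 * B') * B' = e / 2" using B' by simp
      finally show ?thesis using N[OF that] by simp
    qed
    then show "\<exists>N. \<forall>n\<ge>N. norm (blinfun_apply \<eta> (x n) - blinfun_apply \<eta> x0) < e" by blast
  qed
qed

lemma frequently_subseq:
  assumes "\<exists>\<^sub>F n in sequentially. P n"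
  shows "\<exists>r::nat \<Rightarrow> nat. strict_mono r \<and> (\<forall>n. P (r n))"
proof -
  have inf: "infinite {n. P n}"
    using assms by (simp add: cofinite_eq_sequentially[symmetric] frequently_cofinite)
  show ?thesis
    using strict_mono_enumerate[OF inf] enumerate_in_set[OF inf]
    by (intro exI[of _ "enumerate {n. P n}"]) simp
qed

text \<open>The norm is an infimum, so an essential bound strictly below \<open>K + 1\<close> exists
  without showing that the infimum is attained. The enlarged bound is as good, and it is
  positive.\<close>

lemma Linf_norm_bound:
  assumes "f \<in> Linf T" "Linf_norm T f \<le> K"
  shows "AE t in lebesgue_on {0..T}. norm (f t) \<le> K + 1" "0 < K + 1"
proof -
  obtain C where "AE t in lebesgue_on {0..T}. norm (f t) \<le> C" using assms(1) by (auto simp: Linf_def)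
  then have "AE t in lebesgue_on {0..T}. norm (f t) \<le> \<bar>C\<bar>" by eventually_elim auto
  then have "\<bar>C\<bar> \<in> {C. 0 \<le> C \<and> (AE t in lebesgue_on {0..T}. norm (f t) \<le> C)}" by simp
  then have ne: "{C. 0 \<le> C \<and> (AE t in lebesgue_on {0..T}. norm (f t) \<le> C)} \<noteq> {}" by blast
  have "Inf {C. 0 \<le> C \<and> (AE t in lebesgue_on {0..T}. norm (f t) \<le> C)} < K + 1"
    using assms(2) by (simp add: Linf_norm_def)
  from cInf_lessD[OF ne this] obtain C' where
    "C' \<in> {C. 0 \<le> C \<and> (AE t in lebesgue_on {0..T}. norm (f t) \<le> C)}" "C' < K + 1" by (rule bexE)
  then have C': "0 \<le> C'" "AE t in lebesgue_on {0..T}. norm (f t) \<le> C'" "C' < K + 1" by simp_all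
  then show "0 < K + 1" by simp
  show "AE t in lebesgue_on {0..T}. norm (f t) \<le> K + 1"
    using C'(2) by eventually_elim (use C'(3) in simp)
qed

text \<open>The inequality is closed in \<open>y\<close> and extends to all of \<open>V\<close>; the
  choice \<open>y = x\<close> gives the norm bound after cancellation.\<close>

lemma norm_le_of_inner_le:
  fixes i :: "'v::real_normed_vector \<Rightarrow>\<^sub>L 'h::real_inner"
  assumes dense: "closure D = UNIV"
    and le: "\<And>y. y \<in> D \<Longrightarrow> blinfun_apply i x \<bullet> blinfun_apply i y \<le> K * norm (blinfun_apply i y)" and K: "0 \<le> K"
  shows "norm (blinfun_apply i x) \<le> K"
proof -
  have "closed {y. blinfun_apply i x \<bullet> blinfun_apply i y \<le> K * norm (blinfun_apply i y)}"
    by (intro closed_Collect_le continuous_intros)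
  then have "closure D \<subseteq> {y. blinfun_apply i x \<bullet> blinfun_apply i y \<le> K * norm (blinfun_apply i y)}"
    using le by (intro closure_minimal) auto
  then have "x \<in> {y. blinfun_apply i x \<bullet> blinfun_apply i y \<le> K * norm (blinfun_apply i y)}" using dense by blast
  then have le: "norm (blinfun_apply i x) * norm (blinfun_apply i x) \<le> K * norm (blinfun_apply i x)"
    by (simp add: dot_square_norm power2_eq_square)
  show ?thesis
  proof (cases "norm (blinfun_apply i x) = 0")
    case False
    then have "0 < norm (blinfun_apply i x)" by simp
    with le show ?thesis by (rule mult_right_le_imp_le)
  qed (use K in simp)
qed

theorem lemma4p2:
  fixes T p p' q c c1 c3 c4 K :: real
    and i :: "'v::{banach, second_countable_topology} \<Rightarrow>\<^sub>L 'h::{real_inner, complete_space}"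
    and j :: "'z::{banach, second_countable_topology} \<Rightarrow>\<^sub>L 'v"
    and Vn :: "nat \<Rightarrow> 'z set"
    and P :: "nat \<Rightarrow> 'h \<Rightarrow>\<^sub>L 'h"
    and A :: "real \<Rightarrow> 'v \<Rightarrow> 'v \<Rightarrow>\<^sub>L real"
    and C2 C5 :: "real \<Rightarrow> real"
    and v :: "nat \<Rightarrow> real \<Rightarrow> 'v"
    and v0 :: "real \<Rightarrow> 'v"
  assumes "0 < T" and "1 < p" and "1 / p + 1 / p' = 1"
    and "reflexive TYPE('v)" and "dense_embedding i"
    and "reflexive TYPE('z)" and "dense_embedding j"
    and "\<And>n. finite_dim_subspace (Vn n)" and "mono Vn"
    and "closure (\<Union>n. blinfun_apply j ` Vn n) = UNIV"
    and "\<And>n. self_adjoint_projection (P n)"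
    and "\<And>n. blinfun_apply (P n) ` range (blinfun_apply i) = (\<lambda>z. blinfun_apply i (blinfun_apply j z)) ` Vn n"
    and "\<And>n. \<exists>Q :: 'z \<Rightarrow>\<^sub>L 'z. (i o\<^sub>L j) o\<^sub>L Q = P n o\<^sub>L (i o\<^sub>L j) \<and> norm Q \<le> c"
    and A1: "AE t in lebesgue_on {0..T}. pseudo_monotone (A t)"
    and A2: "\<And>u. u \<in> Lp T p \<Longrightarrow> (\<lambda>t. blinfun_apply i (u t)) \<in> Linf T \<Longrightarrow>
               bochner_measurable (lebesgue_on {0..T}) (\<lambda>t. A t (u t))"
    and A3: "0 < c1" "integrable (lebesgue_on {0..T}) C2" "AE t in lebesgue_on {0..T}. 0 \<le> C2 t"
            "AE t in lebesgue_on {0..T}. \<forall>x. blinfun_apply (A t x) x \<ge> c1 * norm x powr p - C2 t"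
    and A4: "0 \<le> q" "0 < c3" "0 \<le> c4" "C5 \<in> Lp T p'" "AE t in lebesgue_on {0..T}. 0 \<le> C5 t"
            "AE t in lebesgue_on {0..T}. \<forall>x. norm (A t x) \<le> c3 * norm x powr (p - 1)
               + c4 * norm (blinfun_apply i x) powr q * norm x powr (p - 1) + C5 t"
    and "\<And>n. v n \<in> W1 (dual_embedding i j) T p p'"
    and "\<And>n. (\<lambda>t. blinfun_apply i (v n t)) \<in> Linf T"
    and "v0 \<in> W1 (dual_embedding i j) T p p'"
    and "weakly_converges_in (W1 (dual_embedding i j) T p p') (W1_norm (dual_embedding i j) T p p') v v0"
    and "\<And>n. Linf_norm T (\<lambda>t. blinfun_apply i (v n t)) \<le> K"
    and "limsup (\<lambda>n. ereal (pairing T (induced_operator A (v n)) (\<lambda>t. v n t - v0 t))) \<le> 0"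
  shows "(\<forall>z \<in> Lp T p.
            ereal (pairing T (induced_operator A v0) (\<lambda>t. v0 t - z t))
              \<le> liminf (\<lambda>n. ereal (pairing T (induced_operator A (v n)) (\<lambda>t. v n t - z t))))
       \<and> weakly_converges_in (Lp T p') (Lp_norm T p') (\<lambda>n. induced_operator A (v n)) (induced_operator A v0)"
proof -
  let ?M = "lebesgue_on {0..T}"
  interpret finite_measure ?M by (rule finite_measure_interval)
  note p = \<open>1 < p\<close> \<open>1 / p + 1 / p' = 1\<close>
  note p' = conjugate_exponent[OF p]
  have pos: "0 < p" "0 < p'" using p p' by auto
  note limsup0 = \<open>limsup (\<lambda>n. ereal (pairing T (induced_operator A (v n)) (\<lambda>t. v n t - v0 t))) \<le> 0\<close>
  have vL: "v n \<in> Lp T p" "v0 \<in> Lp T p" for n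
    using \<open>v n \<in> W1 (dual_embedding i j) T p p'\<close> \<open>v0 \<in> W1 (dual_embedding i j) T p p'\<close> by (simp_all add: W1_def)

  \<comment> \<open>Countable dense families of test functionals\<close>
  obtain Dz :: "'z set" where Dz: "countable Dz" "closure Dz = UNIV"
  proof -
    obtain Dz :: "'z set" where Dz: "countable Dz" "\<And>X. open X \<Longrightarrow> X \<noteq> {} \<Longrightarrow> \<exists>d\<in>Dz. d \<in> X"
      by (rule countable_dense_setE) (rule that, assumption, blast)
    have "x \<in> closure Dz" for x
      unfolding closure_approachable using Dz(2)[of "ball x _"] by (fastforce simp: dist_commute)
    then show thesis using that Dz(1) by blast
  qed
  then have ne: "Dz \<noteq> {}" by auto
  define zs where "zs = from_nat_into Dz"
  have zs: "range zs = Dz" unfolding zs_def by (rule range_from_nat_into[OF ne Dz(1)])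
  define \<xi> where "\<xi> k = dual_element i j (zs k)" for k
  have image_dense: "closure (f ` Dz) = UNIV" if f: "continuous_on UNIV f" "closure (range f) = UNIV" for f :: "'z \<Rightarrow> 'b::topological_space"
  proof -
    have "f ` closure Dz \<subseteq> closure (f ` Dz)"
      using f(1) closure_subset[of "f ` Dz"] by (intro image_closure_subset) (auto intro: continuous_on_subset)
    then have "closure (range f) \<subseteq> closure (f ` Dz)" using Dz(2) by (intro closure_minimal) auto
    then show ?thesis using f(2) by blast
  qed
  have j_dense: "closure (blinfun_apply j ` Dz) = UNIV"
    using \<open>dense_embedding j\<close> by (intro image_dense) (auto simp: dense_embedding_def intro!: continuous_intros)
  have \<xi>_dense: "closure (range \<xi>) = UNIV"
  proof -
    have "continuous_on UNIV (dual_element i j)"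
      using bounded_linear_dual_element by (rule linear_continuous_on)
    moreover have "closure (range (dual_element i j)) = UNIV"
      using \<open>dense_embedding i\<close> \<open>dense_embedding j\<close>
      by (intro dual_elements_dense \<open>reflexive TYPE('v)\<close>) (auto simp: dense_embedding_def)
    ultimately have "closure (dual_element i j ` Dz) = UNIV" by (rule image_dense)
    moreover have "range \<xi> = dual_element i j ` Dz" unfolding \<xi>_def zs[symmetric] by auto
    ultimately show ?thesis by simp
  qed

  \<comment> \<open>Bounds in \<open>H\<close> and convergence of the tested values\<close>
  define K1 where "K1 = K + 1"
  have K1: "0 < K1" unfolding K1_def
    by (rule Linf_norm_bound(2)[OF \<open>\<And>n. (\<lambda>t. blinfun_apply i (v n t)) \<in> Linf T\<close> \<open>\<And>n. Linf_norm T (\<lambda>t. blinfun_apply i (v n t)) \<le> K\<close>])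
  have H_bound: "AE t in ?M. \<forall>n. norm (blinfun_apply i (v n t)) \<le> K1"
    unfolding K1_def
    by (intro AE_all_countable[THEN iffD2] allI Linf_norm_bound(1)
        \<open>\<And>n. (\<lambda>t. blinfun_apply i (v n t)) \<in> Linf T\<close> \<open>\<And>n. Linf_norm T (\<lambda>t. blinfun_apply i (v n t)) \<le> K\<close>)
  have pointwise: "AE t in ?M. \<forall>k. (\<lambda>n. blinfun_apply (\<xi> k) (v n t)) \<longlonglongrightarrow> blinfun_apply (\<xi> k) (v0 t)"
    unfolding \<xi>_def
    by (intro AE_all_countable[THEN iffD2] allI weak_W1_convergence_pointwise[OF \<open>0 < T\<close> p]
        \<open>weakly_converges_in (W1 (dual_embedding i j) T p p') (W1_norm (dual_embedding i j) T p p') v v0\<close>)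
  \<comment> \<open>Convergence is known only for pairings with elements coming from
    \<open>Z\<close>, so the bound is passed to \<open>v0\<close> through these and the norm is
    recovered afterwards. Without it \<open>A t (v0 t)\<close> could not be placed in the dual
    space.\<close>
  have H_bound0: "AE t in ?M. norm (blinfun_apply i (v0 t)) \<le> K1"
    using H_bound pointwise
  proof eventually_elim
    case (elim t)
    show ?case
    proof (rule norm_le_of_inner_le[OF j_dense])
      fix y assume "y \<in> blinfun_apply j ` Dz"
      then obtain k where y: "y = blinfun_apply j (zs k)" using zs by auto
      have "blinfun_apply (\<xi> k) (v n t) \<le> K1 * norm (blinfun_apply i y)" for n
      proof -
        have "blinfun_apply (\<xi> k) (v n t) \<le> norm (blinfun_apply i (v n t)) * norm (blinfun_apply i y)"
          unfolding \<xi>_def dual_element_inner y by (rule norm_cauchy_schwarz)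
        also have "\<dots> \<le> K1 * norm (blinfun_apply i y)" using elim(1) by (intro mult_right_mono) auto
        finally show ?thesis .
      qed
      then have "blinfun_apply (\<xi> k) (v0 t) \<le> K1 * norm (blinfun_apply i y)"
        using elim(2) by (intro LIMSEQ_le_const2[of "\<lambda>n. blinfun_apply (\<xi> k) (v n t)"]) auto
      then show "blinfun_apply i (v0 t) \<bullet> blinfun_apply i y \<le> K1 * norm (blinfun_apply i y)"
        by (simp add: \<xi>_def dual_element_inner y)
    qed (use K1 in simp)
  qed
  have v0_Linf: "(\<lambda>t. blinfun_apply i (v0 t)) \<in> Linf T"
    using H_bound0 bochner_measurable_blinfun_apply[OF bochner_measurable_const LpD(1)[OF vL(2)]]
    unfolding Linf_def by blast

  \<comment> \<open>Growth and coercivity with constants depending on \<open>K\<close>\<close>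
  define c6 where "c6 = c3 + c4 * K1 powr q"
  have c6: "0 < c6" using A4(2,3) by (simp add: c6_def add_pos_nonneg)
  have growth: "AE t in ?M. \<forall>x. norm (blinfun_apply i x) \<le> K1 \<longrightarrow> norm (A t x) \<le> c6 * norm x powr (p - 1) + C5 t"
    using A4(6)
  proof eventually_elim
    case (elim t)
    show ?case
    proof (intro allI impI)
      fix x assume x: "norm (blinfun_apply i x) \<le> K1"
      have "c4 * norm (blinfun_apply i x) powr q * norm x powr (p - 1) \<le> c4 * K1 powr q * norm x powr (p - 1)"
        using x A4(1,3) by (intro mult_right_mono mult_left_mono powr_mono2) auto
      then show "norm (A t x) \<le> c6 * norm x powr (p - 1) + C5 t"
        using elim[rule_format, of x] by (simp add: c6_def distrib_right)
    qed
  qed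
  have op_Lp: "induced_operator A u \<in> Lp T p'"
    if u: "u \<in> Lp T p" "(\<lambda>t. blinfun_apply i (u t)) \<in> Linf T" "AE t in ?M. norm (blinfun_apply i (u t)) \<le> K1" for u
  proof (rule Lp_norm_dominated(1)[OF _ pos(2)])
    show "bochner_measurable ?M (induced_operator A u)"
      unfolding induced_operator_def by (rule A2[OF u(1,2)])
    have "(\<lambda>t. norm (u t) powr (p - 1)) \<in> Lp T p'"
    proof -
      have [measurable]: "(\<lambda>t. norm (u t)) \<in> borel_measurable ?M" by (rule LpD(3)[OF u(1)])
      have "(\<lambda>t. norm (u t) powr (p - 1)) \<in> borel_measurable ?M" by measurable
      then have "bochner_measurable ?M (\<lambda>t. norm (u t) powr (p - 1))" by (rule bochner_measurable_borel)
      then show ?thesis using LpD(2)[OF u(1)] p'(3) by (simp add: Lp_def powr_powr mult.commute)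
    qed
    then show "(\<lambda>t. c6 *\<^sub>R (norm (u t) powr (p - 1)) + C5 t) \<in> Lp T p'"
      by (intro Lp_add Lp_scaleR pos A4(4))
    show "AE t in ?M. norm (induced_operator A u t) \<le> norm (c6 *\<^sub>R (norm (u t) powr (p - 1)) + C5 t)"
      using growth u(3) by eventually_elim (auto simp: induced_operator_def intro: order.trans[OF _ abs_ge_self])
  qed
  have Av: "induced_operator A (v n) \<in> Lp T p'" for n
    using H_bound by (intro op_Lp vL \<open>\<And>n. (\<lambda>t. blinfun_apply i (v n t)) \<in> Linf T\<close>) (auto elim: eventually_mono)
  have Av0: "induced_operator A v0 \<in> Lp T p'" by (intro op_Lp vL v0_Linf H_bound0)

  \<comment> \<open>The constant that \<open>powr_absorb\<close> produces when the growth term of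
    size \<open>c6\<close> is absorbed into half of the coercivity.\<close>
  define c7 where "c7 = c6 * (c6 / (c1 / 2)) powr (p - 1)"
  \<comment> \<open>The test element stays a parameter: \<open>v0\<close> is inserted for the lower
    bound of \<open>h\<close>, the given \<open>z\<close> for Fatou's lemma.\<close>
  define \<kappa> where "\<kappa> z t = C2 t + c7 * norm (z t) powr p + \<bar>C5 t\<bar> * norm (z t)" for z :: "real \<Rightarrow> 'v" and t
  have \<kappa>_int: "integrable ?M (\<kappa> z)" if z: "z \<in> Lp T p" for z
  proof -
    have C5: "integrable ?M (\<lambda>t. \<bar>\<bar>C5 t\<bar>\<bar> powr p')" "(\<lambda>t. \<bar>C5 t\<bar>) \<in> borel_measurable ?M"
      using LpD(2,3)[OF A4(4)] by auto
    have "integrable ?M (\<lambda>t. norm (z t) * \<bar>C5 t\<bar>)"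
      using Holder_inequality(1)[OF p LpD(3)[OF z] C5(2)] LpD(2)[OF z] C5(1) by simp
    then show ?thesis unfolding \<kappa>_def using A3(2) LpD(2)[OF z] by (simp add: mult.commute)
  qed
  have lower: "AE t in ?M. \<forall>x y. norm (blinfun_apply i x) \<le> K1 \<longrightarrow> y = z t \<longrightarrow>
      c1 / 2 * norm x powr p - \<kappa> z t \<le> blinfun_apply (A t x) (x - y)" for z
    using growth A3(4)
  proof eventually_elim
    case (elim t)
    show ?case
    proof (intro allI impI)
      fix x y assume x: "norm (blinfun_apply i x) \<le> K1" and y: "y = z t"
      have "blinfun_apply (A t x) y \<le> norm (A t x) * norm y" using norm_blinfun[of "A t x" y] by simp
      also have "\<dots> \<le> (c6 * norm x powr (p - 1) + \<bar>C5 t\<bar>) * norm y"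
        using elim(1) x by (intro mult_right_mono) (auto intro: order.trans)
      also have "\<dots> = c6 * norm x powr (p - 1) * norm y + \<bar>C5 t\<bar> * norm y" by (rule distrib_right)
      also have "c6 * norm x powr (p - 1) * norm y \<le> c1 / 2 * norm x powr p + c7 * norm y powr p"
        unfolding c7_def using c6 A3(1) p(1) by (intro powr_absorb) auto
      finally have "blinfun_apply (A t x) y \<le> c1 / 2 * norm x powr p + c7 * norm y powr p + \<bar>C5 t\<bar> * norm y" by simp
      moreover have "c1 * norm x powr p - C2 t \<le> blinfun_apply (A t x) x" using elim(2) by blast
      ultimately show "c1 / 2 * norm x powr p - \<kappa> z t \<le> blinfun_apply (A t x) (x - y)"
        unfolding \<kappa>_def y blinfun.diff_right by (simp add: field_simps)
    qed
  qed

  \<comment> \<open>Pseudo-monotonicity along an arbitrary subsequence\<close>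
  have pair_int: "integrable ?M (\<lambda>t. blinfun_apply (A t (v n t)) (u t))" if "u \<in> Lp T p" for n u
    using pairing_Holder(2)[OF p Av[of n] that] by (simp add: induced_operator_def)
  have pair_int0: "integrable ?M (\<lambda>t. blinfun_apply (A t (v0 t)) (u t))" if "u \<in> Lp T p" for u
    using pairing_Holder(2)[OF p Av0 that] by (simp add: induced_operator_def)

  \<comment> \<open>An arbitrary subsequence with an upper bound \<open>a\<close> is allowed, so
    that the liminf inequality follows by contradiction; further subsequences retain the
    bound.\<close>
  have core: "pairing T (induced_operator A v0) (\<lambda>t. v0 t - z t) \<le> a"
    if z: "z \<in> Lp T p" and r: "strict_mono r"
      and upper: "\<And>k. pairing T (induced_operator A (v (r k))) (\<lambda>t. v (r k) t - z t) \<le> a" for z a and r :: "nat \<Rightarrow> nat"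
  proof -
    define h where "h k t = blinfun_apply (A t (v (r k) t)) (v (r k) t - v0 t)" for k t
    have h_int: "integrable ?M (h k)" for k
      unfolding h_def by (rule pair_int[OF Lp_diff[OF vL(1) vL(2) pos(1)]])
    have hM[measurable]: "h k \<in> borel_measurable ?M" for k using h_int by auto
    have h_lower: "AE t in ?M. \<forall>k. c1 / 2 * norm (v (r k) t) powr p - \<kappa> v0 t \<le> h k t"
      using lower[of v0] H_bound by eventually_elim (auto simp: h_def)
    \<comment> \<open>The coercive lower bound converts an upper bound for \<open>h\<close> at time
      \<open>t\<close> into a bound in \<open>V\<close>. Convergence against the dense functionals
      then becomes weak convergence.\<close>
    have weak_limit: "weakly_converges (\<lambda>k. v (r (s k)) t) (v0 t)"
      if t: "\<forall>k. (\<lambda>n. blinfun_apply (\<xi> k) (v n t)) \<longlonglongrightarrow> blinfun_apply (\<xi> k) (v0 t)"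
        "\<forall>k. c1 / 2 * norm (v (r k) t) powr p - \<kappa> v0 t \<le> h k t"
        and s: "strict_mono s" and b: "\<And>k. h (s k) t \<le> b" for t b and s :: "nat \<Rightarrow> nat"
    proof (rule weakly_converges_if_dense[OF \<xi>_dense])
      fix k
      have "strict_mono (r \<circ> s)" using r s by (rule strict_mono_o)
      from LIMSEQ_subseq_LIMSEQ[OF t(1)[rule_format, of k] this]
      show "(\<lambda>n. blinfun_apply (\<xi> k) (v (r (s n)) t)) \<longlonglongrightarrow> blinfun_apply (\<xi> k) (v0 t)" by (simp add: comp_def)
    next
      fix k
      let ?x = "norm (v (r (s k)) t)" and ?B = "max 0 (2 / c1 * (b + \<kappa> v0 t))"
      have "c1 / 2 * ?x powr p \<le> b + \<kappa> v0 t" using t(2)[rule_format, of "s k"] b[of k] by linarith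
      then have "?x powr p \<le> 2 / c1 * (b + \<kappa> v0 t)" using A3(1) by (simp add: field_simps)
      then have "?x powr p \<le> ?B" by simp
      then have "(?x powr p) powr (1 / p) \<le> ?B powr (1 / p)" using p(1) by (intro powr_mono2) auto
      then show "?x \<le> ?B powr (1 / p)" using p(1) by (simp add: powr_powr)
    qed
    \<comment> \<open>If \<open>h\<close> were at most \<open>- e\<close> along a subsequence,
      pseudo-monotonicity tested with \<open>v0 t\<close> itself would give
      \<open>0 \<le> - e\<close>.\<close>
    have neg_AE: "AE t in ?M. (\<lambda>k. max 0 (- h k t)) \<longlonglongrightarrow> 0"
      using A1 pointwise h_lower
    proof eventually_elim
      case (elim t)
      show ?case
      proof (rule ccontr)
        assume "\<not> (\<lambda>k. max 0 (- h k t)) \<longlonglongrightarrow> 0"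
        then obtain e where e: "0 < e" "\<not> (\<forall>\<^sub>F k in sequentially. dist (max 0 (- h k t)) 0 < e)"
          unfolding tendsto_iff by blast
        then have "\<exists>\<^sub>F k in sequentially. \<not> dist (max 0 (- h k t)) 0 < e" by (simp only: not_eventually)
        then have freq: "\<exists>\<^sub>F k in sequentially. h k t \<le> - e"
          by (rule frequently_elim1) (use e(1) in \<open>auto simp: max_def split: if_splits\<close>)
        obtain s :: "nat \<Rightarrow> nat" where s: "strict_mono s" "\<And>k. h (s k) t \<le> - e"
          using frequently_subseq[OF freq] by blast
        have wc: "weakly_converges (\<lambda>k. v (r (s k)) t) (v0 t)"
          by (rule weak_limit[OF elim(2) elim(3) s(1) s(2)])
        have le: "limsup (\<lambda>k. ereal (h (s k) t)) \<le> ereal (- e)"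
        proof (rule Limsup_bounded)
          show "\<forall>\<^sub>F k in sequentially. ereal (h (s k) t) \<le> ereal (- e)" using s(2) by simp
        qed
        moreover have "ereal (- e) \<le> 0" using e(1) by simp
        ultimately have "limsup (\<lambda>k. ereal (h (s k) t)) \<le> 0" by (rule order.trans)
        then have "ereal (blinfun_apply (A t (v0 t)) (v0 t - v0 t)) \<le> liminf (\<lambda>k. ereal (h (s k) t))"
          using elim(1) wc unfolding pseudo_monotone_def h_def by blast
        also have "\<dots> \<le> limsup (\<lambda>k. ereal (h (s k) t))" by (rule Liminf_le_Limsup) simp
        also note le
        finally show False using e(1) by (simp add: blinfun.zero_right)
      qed
    qed
    have neg_lim: "(\<lambda>k. LINT t|?M. max 0 (- h k t)) \<longlonglongrightarrow> 0"
    proof -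
      have "(\<lambda>k. LINT t|?M. max 0 (- h k t)) \<longlonglongrightarrow> (LINT t|?M. 0)"
      proof (rule integral_dominated_convergence[where w = "\<lambda>t. \<bar>\<kappa> v0 t\<bar>"])
        show "integrable ?M (\<lambda>t. \<bar>\<kappa> v0 t\<bar>)" using \<kappa>_int[OF vL(2)] by simp
        show "AE t in ?M. norm (max 0 (- h k t)) \<le> \<bar>\<kappa> v0 t\<bar>" for k
          using h_lower
        proof eventually_elim
          case (elim t)
          have "0 \<le> c1 / 2 * norm (v (r k) t) powr p" using A3(1) by simp
          with elim[rule_format, of k] have "- h k t \<le> \<kappa> v0 t" by linarith
          then show ?case by (simp add: max_def)
        qed
      qed (use neg_AE in auto)
      then show ?thesis by simp
    qed
    \<comment> \<open>The absolute value is \<open>h\<close> plus twice its negative part. The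
      limsup hypothesis keeps the first integral below \<open>e / 2\<close>, and the second is below
      \<open>e / 4\<close>.\<close>
    have "(\<lambda>k. LINT t|?M. norm (h k t)) \<longlonglongrightarrow> 0"
    proof (rule LIMSEQ_I)
      fix e :: real assume e: "0 < e"
      have "limsup (\<lambda>k. ereal (pairing T (induced_operator A (v k)) (\<lambda>t. v k t - v0 t))) < ereal (e / 2)"
        using limsup0 e by (intro le_less_trans[OF limsup0]) simp
      then have "\<forall>\<^sub>F k in sequentially. ereal (pairing T (induced_operator A (v k)) (\<lambda>t. v k t - v0 t)) < ereal (e / 2)"
        by (rule Limsup_lessD)
      then have "\<forall>\<^sub>F k in sequentially. (LINT t|?M. h k t) < e / 2"
        using eventually_subseq[OF r] by (simp add: pairing_def induced_operator_def h_def)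
      moreover have "\<forall>\<^sub>F k in sequentially. (LINT t|?M. max 0 (- h k t)) < e / 4"
        by (rule order_tendstoD(2)[OF neg_lim]) (use e in simp)
      ultimately have "\<forall>\<^sub>F k in sequentially. norm ((LINT t|?M. norm (h k t)) - 0) < e"
      proof eventually_elim
        case (elim k)
        have "(LINT t|?M. norm (h k t)) = (LINT t|?M. h k t + 2 * max 0 (- h k t))"
          by (intro Bochner_Integration.integral_cong) (auto simp: max_def)
        also have "\<dots> = (LINT t|?M. h k t) + 2 * (LINT t|?M. max 0 (- h k t))"
          using h_int[of k] by simp
        finally have "(LINT t|?M. norm (h k t)) < e" using elim by linarith
        moreover have "norm ((LINT t|?M. norm (h k t)) - 0) = (LINT t|?M. norm (h k t))" by simp
        ultimately show ?case by linarith
      qed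
      then show "\<exists>N. \<forall>k\<ge>N. norm ((LINT t|?M. norm (h k t)) - 0) < e" by (simp add: eventually_sequentially)
    qed
    from tendsto_L1_AE_subseq[OF h_int this] obtain s :: "nat \<Rightarrow> nat" where s: "strict_mono s"
      and s_lim: "AE t in ?M. (\<lambda>k. h (s k) t) \<longlonglongrightarrow> 0" by blast
    let ?f = "\<lambda>k t. blinfun_apply (A t (v (r (s k)) t)) (v (r (s k)) t - z t)"
    have "(LINT t|?M. blinfun_apply (A t (v0 t)) (v0 t - z t)) \<le> a"
    proof (rule fatou_lower_bound[where f = ?f and k = "\<kappa> z"])
      show "integrable ?M (?f k)" for k by (rule pair_int[OF Lp_diff[OF vL(1) z pos(1)]])
      show "integrable ?M (\<lambda>t. blinfun_apply (A t (v0 t)) (v0 t - z t))" by (rule pair_int0[OF Lp_diff[OF vL(2) z pos(1)]])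
      show "integrable ?M (\<kappa> z)" by (rule \<kappa>_int[OF z])
      show "AE t in ?M. - \<kappa> z t \<le> ?f k t" for k
        using lower[of z] H_bound
      proof eventually_elim
        case (elim t)
        have "0 \<le> c1 / 2 * norm (v (r (s k)) t) powr p" using A3(1) by simp
        moreover have "c1 / 2 * norm (v (r (s k)) t) powr p - \<kappa> z t \<le> ?f k t" using elim by blast
        ultimately show ?case by linarith
      qed
      show "(LINT t|?M. ?f k t) \<le> a" for k
        using upper[of "s k"] by (simp add: pairing_def induced_operator_def)
      show "AE t in ?M. ereal (blinfun_apply (A t (v0 t)) (v0 t - z t)) \<le> liminf (\<lambda>k. ereal (?f k t))"
        using A1 pointwise h_lower s_lim
      proof eventually_elim
        case (elim t)
        \<comment> \<open>Convergence of \<open>h\<close> at this time bounds it from above, which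
          again gives weak convergence; the test element is now \<open>z t\<close> instead of
          \<open>v0 t\<close>.\<close>
        obtain b where b: "\<And>k. h (s k) t \<le> b"
          using convergent_imp_Bseq[OF convergentI[OF elim(4)]] by (auto simp: Bseq_def abs_le_iff)
        have "weakly_converges (\<lambda>k. v (r (s k)) t) (v0 t)"
          by (rule weak_limit[OF elim(2,3) s b])
        moreover have "(\<lambda>k. ereal (h (s k) t)) \<longlonglongrightarrow> ereal 0" using elim(4) by simp
        then have "limsup (\<lambda>k. ereal (h (s k) t)) = ereal 0" by (intro lim_imp_Limsup) simp
        then have "limsup (\<lambda>k. ereal (h (s k) t)) \<le> 0" by simp
        ultimately show ?case using elim(1) unfolding pseudo_monotone_def h_def by blast
      qed
    qed
    then show ?thesis by (simp add: pairing_def induced_operator_def)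
  qed

  \<comment> \<open>From subsequences to the liminf inequality\<close>
  have liminf: "ereal (pairing T (induced_operator A v0) (\<lambda>t. v0 t - z t))
      \<le> liminf (\<lambda>n. ereal (pairing T (induced_operator A (v n)) (\<lambda>t. v n t - z t)))" if z: "z \<in> Lp T p" for z
    unfolding le_Liminf_iff
  proof (intro allI impI)
    fix y assume y: "y < ereal (pairing T (induced_operator A v0) (\<lambda>t. v0 t - z t))"
    show "\<forall>\<^sub>F n in sequentially. y < ereal (pairing T (induced_operator A (v n)) (\<lambda>t. v n t - z t))"
    proof (rule ccontr)
      assume "\<not> (\<forall>\<^sub>F n in sequentially. y < ereal (pairing T (induced_operator A (v n)) (\<lambda>t. v n t - z t)))"
      then have freq: "\<exists>\<^sub>F n in sequentially. ereal (pairing T (induced_operator A (v n)) (\<lambda>t. v n t - z t)) \<le> y"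
        by (simp add: not_eventually not_less)
      obtain r :: "nat \<Rightarrow> nat" where r: "strict_mono r" "\<And>k. ereal (pairing T (induced_operator A (v (r k))) (\<lambda>t. v (r k) t - z t)) \<le> y"
        using frequently_subseq[OF freq] by blast
      \<comment> \<open>\<open>y\<close> lies between two finite values and is therefore
        real.\<close>
      obtain a where a: "y = ereal a" using r(2)[of 0] y by (cases y) auto
      have "pairing T (induced_operator A v0) (\<lambda>t. v0 t - z t) \<le> a"
        by (rule core[OF z r(1)]) (use r(2) a in simp)
      with y a show False by simp
    qed
  qed

  \<comment> \<open>Weak convergence of the images\<close>
  have weak: "(\<lambda>n. pairing T (induced_operator A (v n)) x) \<longlonglongrightarrow> pairing T (induced_operator A v0) x" if x: "x \<in> Lp T p" for x
  proof -
    \<comment> \<open>Choosing \<open>v0 - y\<close> as test element separates a term with limsup at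
      most zero from the pairing with \<open>y\<close>. The liminf inequality then bounds the
      pairing with \<open>y\<close> from below, and \<open>y = x\<close> together with
      \<open>y = - x\<close> gives convergence.\<close>
    have split: "pairing T (induced_operator A (v n)) (\<lambda>t. v n t - (v0 t - y t))
        = pairing T (induced_operator A (v n)) (\<lambda>t. v n t - v0 t) + pairing T (induced_operator A (v n)) y"
      if y: "y \<in> Lp T p" for n y
    proof -
      have "(\<lambda>t. blinfun_apply (A t (v n t)) (v n t - (v0 t - y t)))
          = (\<lambda>t. blinfun_apply (A t (v n t)) (v n t - v0 t) + blinfun_apply (A t (v n t)) (y t))"
        by (simp add: blinfun.diff_right fun_eq_iff)
      then show ?thesis
        using pair_int[OF Lp_diff[OF vL(1) vL(2) pos(1)]] pair_int[OF y]
        by (simp add: pairing_def induced_operator_def)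
    qed
    have ev: "\<forall>\<^sub>F n in sequentially. pairing T (induced_operator A v0) y - e < pairing T (induced_operator A (v n)) y"
      if y: "y \<in> Lp T p" and e: "0 < e" for y e
    proof -
      have "ereal (pairing T (induced_operator A v0) (\<lambda>t. v0 t - (v0 t - y t)))
          \<le> liminf (\<lambda>n. ereal (pairing T (induced_operator A (v n)) (\<lambda>t. v n t - (v0 t - y t))))"
        by (rule liminf[OF Lp_diff[OF vL(2) y pos(1)]])
      moreover have "ereal (pairing T (induced_operator A v0) y - e / 2) < ereal (pairing T (induced_operator A v0) (\<lambda>t. v0 t - (v0 t - y t)))"
        using e by simp
      ultimately have "\<forall>\<^sub>F n in sequentially. ereal (pairing T (induced_operator A v0) y - e / 2)
          < ereal (pairing T (induced_operator A (v n)) (\<lambda>t. v n t - (v0 t - y t)))"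
        unfolding le_Liminf_iff by blast
      moreover have "limsup (\<lambda>k. ereal (pairing T (induced_operator A (v k)) (\<lambda>t. v k t - v0 t))) < ereal (e / 2)"
        using limsup0 e by (intro le_less_trans[OF limsup0]) simp
      then have "\<forall>\<^sub>F k in sequentially. ereal (pairing T (induced_operator A (v k)) (\<lambda>t. v k t - v0 t)) < ereal (e / 2)"
        by (rule Limsup_lessD)
      ultimately show ?thesis
      proof eventually_elim
        case (elim n)
        then show ?case unfolding split[OF y] by simp
      qed
    qed
    have neg: "pairing T g (\<lambda>t. - x t) = - pairing T g x" for g
      by (simp add: pairing_def blinfun.minus_right)
    have nx: "(\<lambda>t. - x t) \<in> Lp T p" using Lp_scaleR[OF x pos(1), of "-1"] by simp
    show ?thesis
    proof (rule LIMSEQ_I)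
      fix e :: real assume e: "0 < e"
      have "\<forall>\<^sub>F n in sequentially. norm (pairing T (induced_operator A (v n)) x - pairing T (induced_operator A v0) x) < e"
        using ev[OF x e] ev[OF nx e] by eventually_elim (auto simp: neg)
      then show "\<exists>N. \<forall>n\<ge>N. norm (pairing T (induced_operator A (v n)) x - pairing T (induced_operator A v0) x) < e"
        by (simp add: eventually_sequentially)
    qed
  qed
  have "weakly_converges_in (Lp T p') (Lp_norm T p') (\<lambda>n. induced_operator A (v n)) (induced_operator A v0)"
    unfolding weakly_converges_in_def
  proof (intro conjI allI impI)
    fix F :: "(real \<Rightarrow> 'v \<Rightarrow>\<^sub>L real) \<Rightarrow> real" assume F: "bounded_functional_on (Lp T p') (Lp_norm T p') F"
    obtain x where x: "x \<in> Lp T p" "\<And>g. g \<in> Lp T p' \<Longrightarrow> F g = pairing T g x"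
      using Lp_functional_representation[OF p \<open>reflexive TYPE('v)\<close> \<xi>_dense F] by blast
    show "(\<lambda>n. F (induced_operator A (v n))) \<longlonglongrightarrow> F (induced_operator A v0)"
      using weak[OF x(1)] by (simp add: x(2) Av Av0)
  qed (rule Av Av0)+
  with liminf show ?thesis by blast
qed

end
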